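(* Let $P=(p_1,\dots,p_n)$ be a generic cyclic configuration of an $n$-linkage, and introduce its subconfigurations $P_i=(p_1,\dots,p_i)$, $i=3,\dots,n$. Put $\mathcal{H}(P_3)=1$ for the trigonal configuration $P_3$. Then the Morse index $m(P)$ of the signed area function $A$ at $P$ equals the number of sign changes in the sequence $$\mathcal{H}(P_3),\ \mathcal{H}(P_4),\ \mathcal{H}(P_5),\ \dots,\ \mathcal{H}(P_n),$$ where, for $i\ge 4$, the value $\mathcal{H}(P_i)$ is given by $\mathcal{H}(P_i)=-d(P_i)(-1)^{e(P_i)}$.
   Context: An $n$-linkage ($n\ge 3$) is a sequence $L=(l_1,\dots,l_n)$ of positive reals that can be realized as the consecutive edge lengths of a closed planar polygon. Indices are cyclic: $p_{n+1}=p_1$. A configuration of $L$ is a tuple $P=(p_1,\dots,p_n)$ of points of $\mathbb{R}^2$ with $|p_i p_{i+1}|=l_i$ for all $i$ and with the first two vertices pinned: $p_1=(0,0)$, $p_2=(0,l_1)$. Self-intersections are allowed. The moduli space $\mathcal{M}(L)\subset\mathbb{R}^{2(n-2)}$ is the set of all configurations of $L$ (listing the coordinates of $p_3,\dots,p_n$); for generic $L$ it is a smooth manifold of dimension $n-3$. The signed area is $A(P)=\frac12\sum_{i=1}^n (x_i y_{i+1}-x_{i+1}y_i)$, where $p_i=(x_i,y_i)$. A configuration is cyclic if all its vertices lie on a circle; let $O$ be the center of that circle. It is central if one of its edges passes through $O$. For generic $L$, the critical points of $A$ on $\mathcal{M}(L)$ are exactly the cyclic configurations. $m(P)$ is the Morse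 index of $A:\mathcal{M}(L)\to\mathbb{R}$ at the critical point $P$ (the number of negative eigenvalues of the Hessian), and $\mathcal{H}(P)$ is the sign of the determinant of the Hessian of $A$ at $P$. For a non-central cyclic configuration $P$: $\alpha_i\in(0,\pi/2)$ is half of the (unoriented, positive) angle between $\overrightarrow{Op_i}$ and $\overrightarrow{Op_{i+1}}$; $\varepsilon_i=1$ if $O$ lies to the left of the directed edge $p_ip_{i+1}$ and $\varepsilon_i=-1$ if $O$ lies to its right; $e(P)$ is the number of indices $i$ with $\varepsilon_i=1$; $\delta P=\sum_i\varepsilon_i\tan\alpha_i$; $d(P)$ is the sign of $\delta P$. The subconfiguration $P_i=(p_1,\dots,p_i)$ is the closed $i$-gon with directed edges $p_1p_2,\dots,p_{i-1}p_i,p_ip_1$. It is a cyclic configuration (inscribed in the same circle) of the linkage formed by its own edge lengths, and $\mathcal{H}(P_i)$, $d(P_i)$, $e(P_i)$ are computed for it as such. Genericity: a linkage $L$ is generic if $\mathcal{M}(L)$ is smooth (i.e. no configuration of $L$ has all its vertices on one line) and $A$ is a Morse function on $\mathcal{M}(L)$. Here "$P$ is a generic cyclic configuration" means that, for every $i=3,\dots,n$, one has $p_i\ne p_1$, the configuration $P_i$ is non-central, and the linkage of edge lengths of $P_i$ is generic (in particular for $P_n=P$). *)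

theory Defs
  imports "HOL-Analysis.Analysis" "Jordan_Normal_Form.Char_Poly"
begin

section \<open>Linkages and configurations\<close>

text \<open>
  A linkage \<open>(l\<^sub>1, \<dots>, l\<^sub>n)\<close> is a function on \<open>nat\<close> of which only the values at \<open>{1..n}\<close> are
  used. An \<open>n\<close>-tuple of points of the plane is a function on \<open>nat\<close> that is extensional on
  \<open>{1..n}\<close>, so that distinct tuples are distinct functions and the product topology on
  \<^typ>\<open>nat \<Rightarrow> real \<times> real\<close> induces the Euclidean topology on the set of \<open>n\<close>-tuples.
\<close>

definition nxt :: "nat \<Rightarrow> nat \<Rightarrow> nat" where
  "nxt n k = (if k = n then 1 else k + 1)"

definition side_lengths :: "nat \<Rightarrow> (nat \<Rightarrow> real \<times> real) \<Rightarrow> nat \<Rightarrow> real" where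
  "side_lengths n P k = dist (P k) (P (nxt n k))"

definition linkage :: "nat \<Rightarrow> (nat \<Rightarrow> real) \<Rightarrow> bool" where
  "linkage n L \<longleftrightarrow> n \<ge> 3 \<and> (\<forall>k\<in>{1..n}. L k > 0) \<and>
     (\<exists>Q. \<forall>k\<in>{1..n}. side_lengths n Q k = L k)"

definition moduli_space :: "nat \<Rightarrow> (nat \<Rightarrow> real) \<Rightarrow> (nat \<Rightarrow> real \<times> real) set" where
  "moduli_space n L = {P \<in> extensional {1..n}.
     P 1 = (0, 0) \<and> P 2 = (0, L 1) \<and> (\<forall>k\<in>{1..n}. side_lengths n P k = L k)}"

definition signed_area :: "nat \<Rightarrow> (nat \<Rightarrow> real \<times> real) \<Rightarrow> real" where
  "signed_area n P = 1/2 * (\<Sum>k=1..n. fst (P k) * snd (P (nxt n k)) - fst (P (nxt n k)) * snd (P k))"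

definition subconf :: "nat \<Rightarrow> (nat \<Rightarrow> real \<times> real) \<Rightarrow> nat \<Rightarrow> real \<times> real" where
  "subconf i P = restrict P {1..i}"


section \<open>Smooth functions of \<open>d\<close> real variables and local parametrizations\<close>

text \<open>
  The space \<open>\<real>\<^sup>d\<close> for a varying \<open>d\<close> is the library's \<^const>\<open>Euclidean_space\<close>: the sequences
  vanishing at all indices \<open>\<ge> d\<close>. Coordinates are therefore indexed by \<open>{..<d}\<close>.
\<close>

definition partial_deriv ::
  "nat \<Rightarrow> ((nat \<Rightarrow> real) \<Rightarrow> 'b::real_normed_vector) \<Rightarrow> (nat \<Rightarrow> real) \<Rightarrow> 'b" where
  "partial_deriv j f x = vector_derivative (\<lambda>t. f (x(j := t))) (at (x j))"

primrec C_k_on ::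
  "nat \<Rightarrow> nat \<Rightarrow> (nat \<Rightarrow> real) set \<Rightarrow> ((nat \<Rightarrow> real) \<Rightarrow> 'b::real_normed_vector) \<Rightarrow> bool" where
  "C_k_on d 0 U f = continuous_on U f"
| "C_k_on d (Suc k) U f = (continuous_on U f \<and>
     (\<forall>j<d. (\<forall>x\<in>U. (\<lambda>t. f (x(j := t))) differentiable at (x j)) \<and>
            C_k_on d k U (partial_deriv j f)))"

definition smooth_fun_on ::
  "nat \<Rightarrow> (nat \<Rightarrow> real) set \<Rightarrow> ((nat \<Rightarrow> real) \<Rightarrow> 'b::real_normed_vector) \<Rightarrow> bool" where
  "smooth_fun_on d U f \<longleftrightarrow> (\<forall>k. C_k_on d k U f)"

text \<open>
  A local parametrization (inverse chart) of the \<open>(n - 3)\<close>-dimensional submanifold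
  \<open>M(L)\<close>: a smooth immersion of an open subset of \<open>\<real>\<^sup>n\<^sup>-\<^sup>3\<close> that is a homeomorphism onto a
  (relatively) open subset of \<open>M(L)\<close>.
\<close>

definition local_param ::
  "nat \<Rightarrow> (nat \<Rightarrow> real) \<Rightarrow> (nat \<Rightarrow> real) set \<Rightarrow> ((nat \<Rightarrow> real) \<Rightarrow> nat \<Rightarrow> real \<times> real) \<Rightarrow> bool" where
  "local_param n L U \<phi> \<longleftrightarrow>
     openin (Euclidean_space (n - 3)) U \<and>
     (\<forall>k\<in>{1..n}. smooth_fun_on (n - 3) U (\<lambda>x. \<phi> x k)) \<and>
     (\<forall>x\<in>U. \<forall>c :: nat \<Rightarrow> real.
        (\<forall>k\<in>{1..n}. (\<Sum>j<n - 3. c j *\<^sub>R partial_deriv j (\<lambda>y. \<phi> y k) x) = 0) \<longrightarrow>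
        (\<forall>j<n - 3. c j = 0)) \<and>
     (\<exists>V \<psi>. openin (top_of_set (moduli_space n L)) V \<and> homeomorphism U V \<phi> \<psi>)"


section \<open>Hessian, Morse index and genericity\<close>

definition hessian :: "nat \<Rightarrow> ((nat \<Rightarrow> real) \<Rightarrow> real) \<Rightarrow> (nat \<Rightarrow> real) \<Rightarrow> real mat" where
  "hessian d f u = Matrix.mat d d (\<lambda>(i, j). partial_deriv i (partial_deriv j f) u)"

text \<open>Eigenvalues are counted with multiplicity.\<close>

definition num_neg_eigenvalues :: "real mat \<Rightarrow> nat" where
  "num_neg_eigenvalues M = (\<Sum>a | eigenvalue M a \<and> a < 0. Polynomial.order a (char_poly M))"

text \<open>
  At a critical point, the number of negative eigenvalues and the sign of the determinant of the
  Hessian in local coordinates do not depend on the coordinates; the two definitions below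
  take this common value.
\<close>

definition morse_index :: "nat \<Rightarrow> (nat \<Rightarrow> real) \<Rightarrow> (nat \<Rightarrow> real \<times> real) \<Rightarrow> nat" where
  "morse_index n L P = (THE m. \<exists>U \<phi> u. local_param n L U \<phi> \<and> u \<in> U \<and> \<phi> u = P \<and>
     m = num_neg_eigenvalues (hessian (n - 3) (\<lambda>x. signed_area n (\<phi> x)) u))"

definition hessian_sign :: "nat \<Rightarrow> (nat \<Rightarrow> real) \<Rightarrow> (nat \<Rightarrow> real \<times> real) \<Rightarrow> real" where
  "hessian_sign n L P = (THE s. \<exists>U \<phi> u. local_param n L U \<phi> \<and> u \<in> U \<and> \<phi> u = P \<and>
     s = sgn (Determinant.det (hessian (n - 3) (\<lambda>x. signed_area n (\<phi> x)) u)))"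

definition area_is_morse :: "nat \<Rightarrow> (nat \<Rightarrow> real) \<Rightarrow> bool" where
  "area_is_morse n L \<longleftrightarrow> (\<forall>U \<phi>. local_param n L U \<phi> \<longrightarrow>
     (\<forall>u\<in>U. (\<forall>j<n - 3. partial_deriv j (\<lambda>x. signed_area n (\<phi> x)) u = 0) \<longrightarrow>
       Determinant.det (hessian (n - 3) (\<lambda>x. signed_area n (\<phi> x)) u) \<noteq> 0))"

definition generic_linkage :: "nat \<Rightarrow> (nat \<Rightarrow> real) \<Rightarrow> bool" where
  "generic_linkage n L \<longleftrightarrow>
     (\<forall>P\<in>moduli_space n L. \<not> collinear (P ` {1..n})) \<and> area_is_morse n L"


section \<open>Cyclic configurations\<close>

definition inscribed :: "nat \<Rightarrow> (nat \<Rightarrow> real \<times> real) \<Rightarrow> real \<times> real \<Rightarrow> bool" where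
  "inscribed n P C \<longleftrightarrow> (\<exists>r>0. \<forall>k\<in>{1..n}. dist C (P k) = r)"

definition cyclic_conf :: "nat \<Rightarrow> (nat \<Rightarrow> real \<times> real) \<Rightarrow> bool" where
  "cyclic_conf n P \<longleftrightarrow> (\<exists>C. inscribed n P C)"

text \<open>The center is unique as soon as the vertices are not collinear.\<close>

definition center :: "nat \<Rightarrow> (nat \<Rightarrow> real \<times> real) \<Rightarrow> real \<times> real" where
  "center n P = (THE C. inscribed n P C)"

definition central_conf :: "nat \<Rightarrow> (nat \<Rightarrow> real \<times> real) \<Rightarrow> bool" where
  "central_conf n P \<longleftrightarrow> (\<exists>k\<in>{1..n}. center n P \<in> closed_segment (P k) (P (nxt n k)))"

definition angle_between :: "real \<times> real \<Rightarrow> real \<times> real \<Rightarrow> real" where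
  "angle_between v w = arccos (v \<bullet> w / (norm v * norm w))"

definition half_angle :: "nat \<Rightarrow> (nat \<Rightarrow> real \<times> real) \<Rightarrow> nat \<Rightarrow> real" where
  "half_angle n P k = angle_between (P k - center n P) (P (nxt n k) - center n P) / 2"

definition left_of :: "real \<times> real \<Rightarrow> real \<times> real \<Rightarrow> real \<times> real \<Rightarrow> bool" where
  "left_of C p q \<longleftrightarrow> (fst q - fst p) * (snd C - snd p) - (snd q - snd p) * (fst C - fst p) > 0"

definition edge_sign :: "nat \<Rightarrow> (nat \<Rightarrow> real \<times> real) \<Rightarrow> nat \<Rightarrow> real" where
  "edge_sign n P k = (if left_of (center n P) (P k) (P (nxt n k)) then 1 else -1)"

definition num_pos_edges :: "nat \<Rightarrow> (nat \<Rightarrow> real \<times> real) \<Rightarrow> nat" where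
  "num_pos_edges n P = card {k\<in>{1..n}. edge_sign n P k = 1}"

definition delta :: "nat \<Rightarrow> (nat \<Rightarrow> real \<times> real) \<Rightarrow> real" where
  "delta n P = (\<Sum>k=1..n. edge_sign n P k * tan (half_angle n P k))"

definition delta_sign :: "nat \<Rightarrow> (nat \<Rightarrow> real \<times> real) \<Rightarrow> real" where
  "delta_sign n P = sgn (delta n P)"

definition generic_cyclic :: "nat \<Rightarrow> (nat \<Rightarrow> real \<times> real) \<Rightarrow> bool" where
  "generic_cyclic n P \<longleftrightarrow> cyclic_conf n P \<and>
     (\<forall>i\<in>{3..n}. P i \<noteq> P 1 \<and> \<not> central_conf i (subconf i P) \<and>
        generic_linkage i (side_lengths i (subconf i P)))"


section \<open>The sequence of Hessian signs\<close>

definition H_seq :: "(nat \<Rightarrow> real \<times> real) \<Rightarrow> nat \<Rightarrow> real" where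
  "H_seq P i = (if i = 3 then 1
     else hessian_sign i (side_lengths i (subconf i P)) (subconf i P))"

text \<open>Sign changes in \<open>h m, \<dots>, h n\<close>, for a sequence without zero terms.\<close>

definition sign_changes :: "(nat \<Rightarrow> real) \<Rightarrow> nat \<Rightarrow> nat \<Rightarrow> nat" where
  "sign_changes h m n = card {i\<in>{m..<n}. h i * h (i + 1) < 0}"

end

theory Submission
  imports Defs
begin

text \<open>
  Let \<open>q k\<close> be the vertices of a cyclic polygon relative to the center and \<open>t k\<close> the tangents of
  the oriented half angles of its edges. The area minus a suitable combination of the squared edge
  lengths is a quadratic polynomial whose gradient vanishes at the polygon, so in every chart the
  Hessian of the area is its Hessian form restricted to the tangent space of the moduli space. In
  terms of the radial components \<open>a k\<close> of a variation, that form is a multiple of the sum of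
  \<open>t k * (a k + a (k + 1))\<^sup>2 - (a (k + 1) - a k)\<^sup>2 / t k\<close>, and infinitesimal translations
  can be used to make \<open>a 1\<close> and \<open>a n\<close> vanish. The tangent spaces \<open>T\<^sub>i\<close> of the subconfigurations
  then form a flag of coordinate subspaces intersected with one hyperplane, namely the orthogonal
  complement of the constant vector \<open>1\<close>, on which the form takes the value \<open>4 * \<delta> n\<close>.
  Since infinitesimal translations are isotropic and orthogonal to everything, cutting them off at
  \<open>i\<close> gives explicit vectors orthogonal to \<open>T\<^sub>i\<close>, from which one obtains an orthogonal basis
  \<open>f i\<close> of \<open>T\<^sub>n\<close> adapted to the flag such that the value of the form at \<open>f i\<close> has the sign
  \<open>H i * H (i + 1)\<close>. The theorem follows by Sylvester's law of inertia.
\<close>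

text \<open>The coefficients of the squared edge lengths are Lagrange multipliers, proportional to
  the reciprocals of the edge tangents. An edge of fixed length forces the tangential increment
  \<open>- t k * (a k + a (k + 1))\<close>, so a radial vector determines its variation up to rigid
  motions, and closing up is the single equation \<open>ell a = 0\<close>. The vector 1 is
  infinitesimal scaling, and its product with \<open>a\<close> is \<open>2 * ell a\<close>. If
  \<open>\<delta> n = 0\<close>, scaling corrected by a translation becomes tangent and lies in the
  kernel of the Hessian; so the Morse property of each subconfiguration enters as
  \<open>\<delta> i \<noteq> 0\<close>. The same number decides whether \<open>f i\<close> leaves
  \<open>T\<^sub>i\<close>, since \<open>f i i\<close> is a nonzero multiple of it. The corrected
  scalings for \<open>i\<close> and \<open>i + 1\<close> differ by a multiple of \<open>x i\<close>,
  which ties consecutive values of \<delta> together and yields the factor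
  \<open>\<delta> i * \<delta> (i + 1)\<close> in the value at \<open>f i\<close>. Index and Hessian
  sign are definite descriptions over all charts: the computation must hold in every chart, and one
  chart must be constructed, which also makes the Morse hypothesis usable.\<close>

no_notation vec_nth (infixl "$" 90)

section \<open>Inertia of real symmetric matrices\<close>

lemma vec_mult_sym:
  fixes A :: "real mat"
  assumes A: "A \<in> carrier_mat n n" and sym: "transpose_mat A = A"
  shows "(\<Sum>i<n. x i * (\<Sum>j<n. A $$ (i,j) * y j)) = (\<Sum>i<n. y i * (\<Sum>j<n. A $$ (i,j) * x j))"
proof -
  have s: "A $$ (j,i) = A $$ (i,j)" if "i < n" "j < n" for i j
    using that A by (metis sym index_transpose_mat(1) carrier_matD)
  have "(\<Sum>i<n. x i * (\<Sum>j<n. A $$ (i,j) * y j)) = (\<Sum>i<n. \<Sum>j<n. x i * A $$ (i,j) * y j)"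
    by (simp add: sum_distrib_left mult.assoc)
  also have "\<dots> = (\<Sum>j<n. \<Sum>i<n. x i * A $$ (i,j) * y j)" by (rule sum.swap)
  also have "\<dots> = (\<Sum>j<n. \<Sum>i<n. y j * (A $$ (j,i) * x i))"
    by (intro sum.cong refl) (simp add: s)
  finally show ?thesis by (simp add: sum_distrib_left)
qed

text \<open>A complex eigenvector is split into real part \<open>x\<close> and imaginary part
  \<open>y\<close>. Symmetry applied to the pair \<open>y\<close>, \<open>x\<close> gives
  \<open>b * (|x|^2 + |y|^2) = 0\<close> for the imaginary part \<open>b\<close> of the eigenvalue.
  So the eigenvalue is real, and whichever of \<open>x\<close> and \<open>y\<close> is nonzero is a
  real eigenvector.\<close>

lemma real_symmetric_has_eigenvector:
  fixes A :: "real mat"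
  assumes A: "A \<in> carrier_mat n n" and sym: "transpose_mat A = A" and n: "n > 0"
  obtains e v where "(\<Sum>i<n. (v i)\<^sup>2) = (1::real)"
    "\<And>i. i < n \<Longrightarrow> (\<Sum>j<n. A $$ (i,j) * v j) = e * v i"
proof -
  define C where "C = map_mat complex_of_real A"
  have C: "C \<in> carrier_mat n n" using A by (simp add: C_def)
  have "degree (char_poly C) = n" using degree_monic_char_poly[OF C] by simp
  then obtain z where "poly (char_poly C) z = 0"
    using alg_closed_imp_poly_has_root[of "char_poly C"] n by auto
  then have "eigenvalue C z" using eigenvalue_root_char_poly[OF C] by simp
  then obtain w where w: "w \<in> carrier_vec n" "w \<noteq> 0\<^sub>v n" and Cw: "C *\<^sub>v w = z \<cdot>\<^sub>v w"
    using C unfolding eigenvalue_def eigenvector_def by auto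
  define x y where "x = (\<lambda>i. Re (w $ i))" and "y = (\<lambda>i. Im (w $ i))"
  define a b where "a = Re z" and "b = Im z"
  have eq: "(\<Sum>j<n. complex_of_real (A $$ (i,j)) * w $ j) = z * w $ i" if "i < n" for i
  proof -
    have "(C *\<^sub>v w) $ i = (\<Sum>j<n. complex_of_real (A $$ (i,j)) * w $ j)"
      using that A w by (auto simp: C_def scalar_prod_def lessThan_atLeast0 intro!: sum.cong)
    then show ?thesis using Cw that w by simp
  qed
  have Ax: "(\<Sum>j<n. A $$ (i,j) * x j) = a * x i - b * y i" if "i < n" for i
    using arg_cong[OF eq[OF that], of Re] by (simp add: x_def y_def a_def b_def)
  have Ay: "(\<Sum>j<n. A $$ (i,j) * y j) = b * x i + a * y i" if "i < n" for i
    using arg_cong[OF eq[OF that], of Im] by (simp add: x_def y_def a_def b_def)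
  have "(\<Sum>i<n. y i * (a * x i - b * y i)) = (\<Sum>i<n. x i * (b * x i + a * y i))"
    using vec_mult_sym[OF A sym, of y x] by (simp add: Ax Ay)
  then have "(\<Sum>i<n. b * ((x i)\<^sup>2 + (y i)\<^sup>2)) = 0"
    by (simp add: algebra_simps sum_subtractf sum.distrib power2_eq_square)
  then have b0: "b * (\<Sum>i<n. (x i)\<^sup>2 + (y i)\<^sup>2) = 0" by (simp add: sum_distrib_left)
  obtain i0 where i0: "i0 < n" "w $ i0 \<noteq> 0" using w by (metis eq_vecI index_zero_vec carrier_vecD)
  have "b = 0"
  proof (rule ccontr)
    assume "b \<noteq> 0"
    then have "(\<Sum>i<n. (x i)\<^sup>2 + (y i)\<^sup>2) = 0" using b0 by simp
    then have "(x i0)\<^sup>2 + (y i0)\<^sup>2 = 0"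
      using i0 by (subst (asm) sum_nonneg_eq_0_iff) auto
    then show False using i0 by (simp add: x_def y_def complex_eq_iff)
  qed
  have "\<exists>u. (\<Sum>i<n. (u i)\<^sup>2) \<noteq> 0 \<and> (\<forall>i<n. (\<Sum>j<n. A $$ (i,j) * u j) = a * u i)"
  proof (cases "x i0 = 0")
    case True
    then have "y i0 \<noteq> 0" using i0 by (simp add: x_def y_def complex_eq_iff)
    then have "(\<Sum>i<n. (y i)\<^sup>2) \<noteq> 0" using i0 by (subst sum_nonneg_eq_0_iff) auto
    then show ?thesis using Ay \<open>b = 0\<close> by auto
  next
    case False
    then have "(\<Sum>i<n. (x i)\<^sup>2) \<noteq> 0" using i0 by (subst sum_nonneg_eq_0_iff) auto
    then show ?thesis using Ax \<open>b = 0\<close> by auto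
  qed
  then obtain u where u: "(\<Sum>i<n. (u i)\<^sup>2) \<noteq> 0" "\<And>i. i < n \<Longrightarrow> (\<Sum>j<n. A $$ (i,j) * u j) = a * u i"
    by auto
  define r where "r = sqrt (\<Sum>i<n. (u i)\<^sup>2)"
  have r: "r\<^sup>2 = (\<Sum>i<n. (u i)\<^sup>2)" "r \<noteq> 0"
    using u by (auto simp: r_def real_sqrt_eq_iff sum_nonneg)
  show ?thesis
  proof (rule that[of "\<lambda>i. u i / r" a])
    show "(\<Sum>i<n. (u i / r)\<^sup>2) = 1"
      using u(1) by (simp add: power_divide r(1) flip: sum_divide_distrib)
    show "(\<Sum>j<n. A $$ (i,j) * (u j / r)) = a * (u i / r)" if "i < n" for i
      using u(2)[OF that] by (simp flip: sum_divide_distrib)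
  qed
qed

text \<open>The matrix is the reflection exchanging \<open>v\<close> and the first unit vector; if these two
  vectors coincide, then \<open>k = 2 / 0 = 0\<close> and it is the identity.\<close>

lemma orthogonal_symmetric_mat_with_first_column:
  fixes v :: "nat \<Rightarrow> real"
  assumes v: "(\<Sum>i<n. (v i)\<^sup>2) = 1" and n: "n > 0"
  obtains W :: "real mat" where "W \<in> carrier_mat n n" "transpose_mat W = W" "W * W = 1\<^sub>m n"
    "\<And>i. i < n \<Longrightarrow> W $$ (i, 0) = v i"
proof -
  define u where "u = (\<lambda>i. v i - (if i = 0 then 1 else 0))"
  define N where "N = (\<Sum>i<n. (u i)\<^sup>2)"
  define k where "k = 2 / N"
  define W where "W = Matrix.mat n n (\<lambda>(i,j). (if i = j then 1 else 0) - k * u i * u j)"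
  have W: "W \<in> carrier_mat n n" by (simp add: W_def)
  have "N = (\<Sum>i<n. (v i)\<^sup>2 - 2 * (if i = 0 then v i else 0) + (if i = 0 then 1 else 0))"
    unfolding N_def u_def by (intro sum.cong) (auto simp: power2_eq_square algebra_simps)
  also have "\<dots> = 2 - 2 * v 0"
    using n v by (simp add: sum.distrib sum_subtractf sum_distrib_left[symmetric] sum.delta)
  finally have N: "N = - 2 * u 0" by (simp add: u_def)
  have u0: "u i = 0" if "N = 0" "i < n" for i
  proof -
    have "(u i)\<^sup>2 = 0" using that unfolding N_def by (subst (asm) sum_nonneg_eq_0_iff) auto
    then show ?thesis by simp
  qed
  \<comment> \<open>This holds also for \<open>N = 0\<close>, where \<open>k = 0\<close>, so the
    involution property needs no case distinction.\<close>
  have kk: "k * k * N = 2 * k" by (simp add: k_def)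
  show ?thesis
  proof (rule that[OF W])
    show "transpose_mat W = W" by (rule eq_matI) (auto simp: W_def)
    show "W * W = 1\<^sub>m n"
    proof (rule eq_matI)
      fix i j assume "i < dim_row (1\<^sub>m n :: real mat)" "j < dim_col (1\<^sub>m n :: real mat)"
      then have ij: "i < n" "j < n" by auto
      have "(W * W) $$ (i,j) = (\<Sum>l<n. ((if i = l then 1 else 0) - k * u i * u l) * ((if l = j then 1 else 0) - k * u l * u j))"
        using ij by (simp add: W_def scalar_prod_def lessThan_atLeast0)
      also have "\<dots> = (\<Sum>l<n. (if i = l then (if l = j then 1 else 0) - k * u l * u j else 0)
            - (if l = j then k * u i * u l else 0) + (k * k * u i * u j) * (u l)\<^sup>2)"
        by (intro sum.cong) (auto simp: algebra_simps power2_eq_square)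
      also have "\<dots> = (if i = j then 1 else 0) - k * u i * u j - k * u i * u j + k * k * u i * u j * N"
        using ij by (simp add: sum.distrib sum_subtractf N_def sum_distrib_left)
      also have "\<dots> = (if i = j then 1 else 0) + u i * u j * (k * k * N - 2 * k)"
        by (simp add: algebra_simps)
      also have "\<dots> = (if i = j then 1 else 0)" by (simp only: kk) simp
      finally show "(W * W) $$ (i,j) = 1\<^sub>m n $$ (i,j)" using ij by simp
    qed (use W in auto)
    show "W $$ (i, 0) = v i" if "i < n" for i
    proof (cases "N = 0")
      case True
      then show ?thesis using u0[OF True that] that n by (auto simp: W_def u_def)
    next
      case False
      then have "k * u 0 = -1" using N by (simp add: k_def field_simps)
      then have "k * u i * u 0 = - u i" by (metis mult.commute mult.left_commute mult_minus1_right)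
      then show ?thesis using that n by (simp add: W_def u_def)
    qed
  qed
qed

text \<open>Deflation: \<open>W\<close> is a symmetric involution whose first column is an
  eigenvector, so \<open>W * A * W\<close> has the eigenvalue alone in its first row and column, and
  the remaining block is again symmetric.\<close>

lemma real_symmetric_diagonalization:
  fixes A :: "real mat"
  assumes "A \<in> carrier_mat n n" and "transpose_mat A = A"
  shows "\<exists>W es. W \<in> carrier_mat n n \<and> transpose_mat W * W = 1\<^sub>m n \<and>
    transpose_mat W * A * W = mat_diag n es"
  using assms
proof (induction n arbitrary: A)
  case 0
  then show ?case by (intro exI[of _ "1\<^sub>m 0"] exI[of _ "\<lambda>_. 0"]) (auto intro!: eq_matI simp: mat_diag_def)
next
  case (Suc n)
  note A = Suc.prems(1) and sym = Suc.prems(2)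
  obtain e v where v: "(\<Sum>i<Suc n. (v i)\<^sup>2) = (1::real)"
    and ev: "\<And>i. i < Suc n \<Longrightarrow> (\<Sum>j<Suc n. A $$ (i,j) * v j) = e * v i"
    using real_symmetric_has_eigenvector[OF A sym] by blast
  obtain W where W: "W \<in> carrier_mat (Suc n) (Suc n)" "transpose_mat W = W" "W * W = 1\<^sub>m (Suc n)"
    "\<And>i. i < Suc n \<Longrightarrow> W $$ (i, 0) = v i"
    using orthogonal_symmetric_mat_with_first_column[OF v] by blast
  define M where "M = W * A * W"
  have M: "M \<in> carrier_mat (Suc n) (Suc n)" using W A by (simp add: M_def)
  have Msym: "transpose_mat M = M"
    using W A sym by (simp add: M_def transpose_mult[of _ "Suc n" "Suc n" _ "Suc n"]
        assoc_mult_mat[of _ "Suc n" "Suc n" _ "Suc n" _ "Suc n"])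
  have AW: "(A * W) $$ (i, 0) = e * W $$ (i, 0)" if "i < Suc n" for i
  proof -
    have "(A * W) $$ (i, 0) = (\<Sum>j<Suc n. A $$ (i,j) * v j)"
      using that A W(1) by (auto simp: scalar_prod_def lessThan_atLeast0 W(4) intro!: sum.cong)
    then show ?thesis using ev[OF that] W(4)[OF that] by simp
  qed
  have M0: "M $$ (i, 0) = (if i = 0 then e else 0)" if "i < Suc n" for i
  proof -
    have "M $$ (i, 0) = (W * (A * W)) $$ (i, 0)"
      using A W by (simp add: M_def assoc_mult_mat[of _ "Suc n" "Suc n" _ "Suc n" _ "Suc n"])
    also have "\<dots> = (\<Sum>j<Suc n. W $$ (i,j) * (A * W) $$ (j,0))"
      using that A W(1) by (simp add: scalar_prod_def lessThan_atLeast0 del: sum.op_ivl_Suc)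
    also have "\<dots> = (\<Sum>j<Suc n. W $$ (i,j) * (e * W $$ (j,0)))"
      by (intro sum.cong refl) (use AW in auto)
    also have "\<dots> = e * (W * W) $$ (i, 0)"
      using that W(1) by (simp add: scalar_prod_def lessThan_atLeast0 sum_distrib_left algebra_simps del: sum.op_ivl_Suc)
    finally show ?thesis using that by (simp add: W(3))
  qed
  have M0': "M $$ (0, i) = (if i = 0 then e else 0)" if "i < Suc n" for i
    using M0[OF that] that M Msym by (metis index_transpose_mat(1) carrier_matD zero_less_Suc)
  define N where "N = Matrix.mat n n (\<lambda>(i,j). M $$ (Suc i, Suc j))"
  have N: "N \<in> carrier_mat n n" by (simp add: N_def)
  have MN: "M = four_block_mat (Matrix.mat 1 1 (\<lambda>_. e)) (0\<^sub>m 1 n) (0\<^sub>m n 1) N"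
    using M by (intro eq_matI) (auto simp: N_def M0 M0')
  have "M $$ (Suc i, Suc j) = M $$ (Suc j, Suc i)" if "i < n" "j < n" for i j
    using that M Msym by (metis index_transpose_mat(1) carrier_matD Suc_less_eq)
  then have Nsym: "transpose_mat N = N"
    by (intro eq_matI) (auto simp: N_def)
  obtain V ds where V: "V \<in> carrier_mat n n" "transpose_mat V * V = 1\<^sub>m n"
    and VNV: "transpose_mat V * N * V = mat_diag n ds"
    using Suc.IH[OF N Nsym] by blast
  define X where "X = four_block_mat (1\<^sub>m 1) (0\<^sub>m 1 n) (0\<^sub>m n 1) V"
  have X: "X \<in> carrier_mat (Suc n) (Suc n)"
    using four_block_carrier_mat[OF one_carrier_mat[of 1] V(1)] by (simp add: X_def)
  have Xt: "transpose_mat X = four_block_mat (1\<^sub>m 1) (0\<^sub>m 1 n) (0\<^sub>m n 1) (transpose_mat V)"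
    unfolding X_def using V by (subst transpose_four_block_mat) auto
  have XX: "transpose_mat X * X = 1\<^sub>m (Suc n)"
    unfolding Xt unfolding X_def using V
    by (subst mult_four_block_mat[of _ 1 1 _ n _ n _ _ 1 _ n]) auto
  have XMX: "transpose_mat X * M * X = mat_diag (Suc n) (\<lambda>i. case i of 0 \<Rightarrow> e | Suc j \<Rightarrow> ds j)"
  proof -
    have "transpose_mat X * M = four_block_mat (Matrix.mat 1 1 (\<lambda>_. e)) (0\<^sub>m 1 n) (0\<^sub>m n 1) (transpose_mat V * N)"
      unfolding Xt MN using V N by (subst mult_four_block_mat[of _ 1 1 _ n _ n _ _ 1 _ n]) auto
    then have "transpose_mat X * M * X = four_block_mat (Matrix.mat 1 1 (\<lambda>_. e)) (0\<^sub>m 1 n) (0\<^sub>m n 1) (mat_diag n ds)"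
      unfolding X_def using V N VNV[symmetric] by (simp only:, subst mult_four_block_mat[of _ 1 1 _ n _ n _ _ 1 _ n]) auto
    also have "\<dots> = mat_diag (Suc n) (\<lambda>i. case i of 0 \<Rightarrow> e | Suc j \<Rightarrow> ds j)"
      by (rule eq_matI) (auto simp: mat_diag_def split: nat.split)
    finally show ?thesis .
  qed
  note assoc = assoc_mult_mat[of _ "Suc n" "Suc n" _ "Suc n" _ "Suc n"]
  have WXt: "transpose_mat (W * X) = transpose_mat X * W"
    using W X by (simp add: transpose_mult[of _ "Suc n" "Suc n" _ "Suc n"])
  have "transpose_mat (W * X) * (W * X) = transpose_mat X * (W * W * X)"
    using W(1) X by (simp add: WXt assoc)
  also have "\<dots> = 1\<^sub>m (Suc n)" using W(3) X XX by simp
  finally have 1: "transpose_mat (W * X) * (W * X) = 1\<^sub>m (Suc n)" .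
  have "transpose_mat (W * X) * A * (W * X) = transpose_mat X * M * X"
    using W(1) X A by (simp add: WXt M_def assoc)
  with 1 XMX W(1) X show ?case by (metis mult_carrier_mat)
qed

section \<open>Inertia and the sign of the determinant\<close>

lemma order_linear: "Polynomial.order a [:- e, 1 :: real:] = (if e = a then 1 else 0)"
  using order_power_n_n[of a 1] by (auto intro: order_0I)

lemma num_neg_eigenvalues_diagonalization:
  fixes A :: "real mat"
  assumes A: "A \<in> carrier_mat n n" and W: "W \<in> carrier_mat n n" "transpose_mat W * W = 1\<^sub>m n"
    and D: "transpose_mat W * A * W = mat_diag n es"
  shows "num_neg_eigenvalues A = card {i. i < n \<and> es i < 0}"
    and "Determinant.det A = (\<Prod>i<n. es i)"
proof -
  note assoc = assoc_mult_mat[of _ n n _ n _ n]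
  have W': "W * transpose_mat W = 1\<^sub>m n"
    by (rule mat_mult_left_right_inverse[OF _ W(1) W(2)]) (use W in auto)
  have "W * (transpose_mat W * A * W) * transpose_mat W = (W * transpose_mat W) * A * (W * transpose_mat W)"
    using A W(1) by (simp add: assoc)
  then have "A = W * mat_diag n es * transpose_mat W" using A by (simp add: W' D)
  then have "similar_mat A (mat_diag n es)"
    using A W W' by (intro similar_matI[of _ _ W "transpose_mat W" n]) auto
  then have cp: "char_poly A = (\<Prod>a\<leftarrow>diag_mat (mat_diag n es). [:- a, 1:])"
    by (simp add: char_poly_similar, intro char_poly_upper_triangular[of _ n])
      (auto simp: mat_diag_def)
  have diag: "diag_mat (mat_diag n es) = map es [0..<n]"
    by (simp add: diag_mat_def mat_diag_def)
  have cp': "char_poly A = (\<Prod>i\<leftarrow>[0..<n]. [:- es i, 1:])"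
    by (simp add: cp diag comp_def)
  have ord: "Polynomial.order a (char_poly A) = (\<Sum>i<n. if es i = a then 1 else 0)" for a
    unfolding cp' by (subst order_prod_list)
      (auto simp: comp_def order_linear interv_sum_list_conv_sum_set_nat atLeast0LessThan)
  have ev: "eigenvalue A a \<longleftrightarrow> a \<in> es ` {..<n}" for a
    unfolding eigenvalue_root_char_poly[OF A] cp' by (auto simp: poly_prod_list prod_list_zero_iff)
  have "num_neg_eigenvalues A = (\<Sum>a | a \<in> es ` {..<n} \<and> a < 0. \<Sum>i<n. if es i = a then 1 else 0)"
    by (simp add: num_neg_eigenvalues_def ev ord)
  \<comment> \<open>The multiplicity of \<open>a\<close> is the number of indices with
    \<open>es i = a\<close>; after the exchange every index with a negative entry is counted
    once.\<close>
  also have "\<dots> = (\<Sum>i<n. \<Sum>a | a \<in> es ` {..<n} \<and> a < 0. if es i = a then 1 else 0)"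
    by (rule sum.swap)
  also have "\<dots> = (\<Sum>i<n. if es i < 0 then 1 else 0)"
    by (intro sum.cong refl, subst sum.delta') auto
  also have "\<dots> = card {i. i < n \<and> es i < 0}"
    by (simp flip: sum.inter_filter)
  finally show "num_neg_eigenvalues A = card {i. i < n \<and> es i < 0}" .
  have "Determinant.det A = Determinant.det (mat_diag n es)"
    by (rule det_similar) fact
  also have "\<dots> = prod_list (diag_mat (mat_diag n es))"
    by (rule det_upper_triangular[of _ n]) (auto simp: mat_diag_def)
  also have "\<dots> = (\<Prod>i<n. es i)"
    by (simp add: diag prod.list_conv_set_nth atLeast0LessThan)
  finally show "Determinant.det A = (\<Prod>i<n. es i)" .
qed

text \<open>Zero rows pad the system to a square matrix whose last row is zero, so its determinant
  vanishes. The equations are indexed by an arbitrary type so that two families can be joined in a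
  sum type.\<close>

lemma homogeneous_system_nontrivial_solution:
  fixes L :: "'k \<Rightarrow> nat \<Rightarrow> real"
  assumes I: "finite I" "card I < n"
  obtains c where "\<exists>i<n. c i \<noteq> 0" "\<And>k. k \<in> I \<Longrightarrow> (\<Sum>i<n. L k i * c i) = 0"
proof -
  obtain h where h: "bij_betw h {0..<card I} I" using ex_bij_betw_nat_finite[OF I(1)] by blast
  define M where "M = Matrix.mat n n (\<lambda>(r,i). if r < card I then L (h r) i else 0)"
  have M: "M \<in> carrier_mat n n" by (simp add: M_def)
  have "transpose_mat M *\<^sub>v unit_vec n (n - 1) = 0\<^sub>v n"
    using I(2) by (intro eq_vecI) (auto simp: M_def scalar_prod_def unit_vec_def intro!: sum.neutral)
  moreover have "unit_vec n (n - 1) \<noteq> (0\<^sub>v n :: real vec)"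
    using I(2) by (metis index_unit_vec(1) index_zero_vec(1) diff_less less_imp_neq less_numeral_extra(1) not_less_zero zero_neq_one neq0_conv)
  ultimately have "Determinant.det (transpose_mat M) = 0"
    using M det_0_iff_vec_prod_zero_field[of "transpose_mat M" n]
    by (metis transpose_carrier_mat unit_vec_carrier)
  then have "Determinant.det M = 0" using det_transpose[OF M] by simp
  then obtain v where v: "v \<in> carrier_vec n" "v \<noteq> 0\<^sub>v n" "M *\<^sub>v v = 0\<^sub>v n"
    using det_0_iff_vec_prod_zero_field[OF M] by blast
  show ?thesis
  proof (rule that[of "\<lambda>i. v $ i"])
    show "\<exists>i<n. v $ i \<noteq> 0" using v by (metis eq_vecI index_zero_vec carrier_vecD)
    fix k assume "k \<in> I"
    then obtain r where r: "r < card I" "h r = k" using h by (metis atLeastLessThan_iff bij_betw_def imageE)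
    then have "r < n" using I by simp
    then have "(M *\<^sub>v v) $ r = (\<Sum>i<n. L k i * v $ i)"
      using r v(1) by (auto simp: M_def scalar_prod_def lessThan_atLeast0 intro!: sum.cong)
    then show "(\<Sum>i<n. L k i * v $ i) = 0" using v(3) \<open>r < n\<close> by simp
  qed
qed

text \<open>Suppose \<open>D\<close> had more negative entries than \<open>E\<close>. Then the
  equations that kill the \<open>K\<close>-coordinates with \<open>D j \<ge> 0\<close> and the
  \<open>M\<close>-coordinates with \<open>E j < 0\<close> are fewer than \<open>d\<close>, and at a
  nonzero common solution one form is negative and the other is not.\<close>

lemma card_neg_le_of_equal_forms:
  fixes D E :: "nat \<Rightarrow> real" and K M :: "nat \<Rightarrow> nat \<Rightarrow> real"
  assumes inj: "\<And>c. (\<forall>j<d. (\<Sum>i<d. K j i * c i) = 0) \<Longrightarrow> \<forall>i<d. c i = 0"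
    and eq: "\<And>c. (\<Sum>j<d. D j * (\<Sum>i<d. K j i * c i)\<^sup>2) = (\<Sum>j<d. E j * (\<Sum>i<d. M j i * c i)\<^sup>2)"
  shows "card {j. j < d \<and> D j < 0} \<le> card {j. j < d \<and> E j < 0}"
proof (rule ccontr)
  assume "\<not> ?thesis"
  then have less: "card {j. j < d \<and> E j < 0} < card {j. j < d \<and> D j < 0}" by simp
  define I where "I = Inl ` {j. j < d \<and> \<not> D j < 0} \<union> Inr ` {j. j < d \<and> E j < 0}"
  define L where "L = (\<lambda>s. case s of Inl j \<Rightarrow> K j | Inr j \<Rightarrow> M j)"
  have fin: "finite {j. j < d \<and> P j}" for P by simp
  have "card {j. j < d \<and> D j < 0} + card {j. j < d \<and> \<not> D j < 0}
      = card ({j. j < d \<and> D j < 0} \<union> {j. j < d \<and> \<not> D j < 0})"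
    by (subst card_Un_disjoint) auto
  also have "{j. j < d \<and> D j < 0} \<union> {j. j < d \<and> \<not> D j < 0} = {..<d}" by auto
  finally have "card {j. j < d \<and> D j < 0} + card {j. j < d \<and> \<not> D j < 0} = d" by simp
  moreover have "card I = card {j. j < d \<and> \<not> D j < 0} + card {j. j < d \<and> E j < 0}"
    unfolding I_def by (subst card_Un_disjoint) (auto simp: card_image)
  ultimately have "finite I" "card I < d" using less by (auto simp: I_def)
  then obtain c where c: "\<exists>i<d. c i \<noteq> 0" "\<And>k. k \<in> I \<Longrightarrow> (\<Sum>i<d. L k i * c i) = 0"
    using homogeneous_system_nontrivial_solution by blast
  have Kc: "(\<Sum>i<d. K j i * c i) = 0" if "j < d" "\<not> D j < 0" for j
    using c(2)[of "Inl j"] that by (simp add: I_def L_def)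
  have Mc: "(\<Sum>i<d. M j i * c i) = 0" if "j < d" "E j < 0" for j
    using c(2)[of "Inr j"] that by (simp add: I_def L_def)
  obtain j where j: "j < d" "(\<Sum>i<d. K j i * c i) \<noteq> 0" using inj[of c] c(1) by blast
  have np: "D j * (\<Sum>i<d. K j i * c i)\<^sup>2 \<le> 0" if "j < d" for j
    using Kc[OF that] by (cases "D j < 0") (auto simp: mult_nonpos_nonneg)
  have "D j * (\<Sum>i<d. K j i * c i)\<^sup>2 < 0"
    using j Kc[of j] by (intro mult_neg_pos) auto
  then have "(\<Sum>j<d. D j * (\<Sum>i<d. K j i * c i)\<^sup>2) < (\<Sum>j<d. 0)"
    using np j by (intro sum_strict_mono_ex1) auto
  moreover have "0 \<le> (\<Sum>j<d. E j * (\<Sum>i<d. M j i * c i)\<^sup>2)"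
  proof (intro sum_nonneg)
    fix j assume "j \<in> {..<d}"
    then show "0 \<le> E j * (\<Sum>i<d. M j i * c i)\<^sup>2" using Mc[of j] by (cases "E j < 0") auto
  qed
  ultimately show False using eq[of c] by simp
qed

lemma prod_sgn_eq_power_card:
  fixes D :: "nat \<Rightarrow> real"
  assumes "\<And>j. j < d \<Longrightarrow> D j \<noteq> 0"
  shows "(\<Prod>j<d. sgn (D j)) = (-1) ^ card {j. j < d \<and> D j < 0}"
proof -
  have "(\<Prod>j<d. sgn (D j)) = (\<Prod>j<d. if D j < 0 then -1 else 1)"
    using assms by (intro prod.cong) (auto simp: sgn_if)
  also have "\<dots> = (\<Prod>j | j \<in> {..<d} \<and> D j < 0. -1)"
    by (subst prod.inter_filter) auto
  finally show ?thesis by (simp add: prod_constant)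
qed

lemma sgn_prod: "sgn (\<Prod>i\<in>A. f i :: real) = (\<Prod>i\<in>A. sgn (f i))"
  by (induction A rule: infinite_finite_induct) (auto simp: sgn_mult)

text \<open>The spectral theorem provides a second diagonal expression of the same form, with the
  eigenvalues as coefficients. Comparing both the forms and their negatives equates the negative and
  the positive counts; hence no eigenvalue vanishes, and the sign of the determinant is the parity
  of the negative count.\<close>

theorem sylvester_inertia:
  fixes S :: "real mat" and D :: "nat \<Rightarrow> real" and K :: "nat \<Rightarrow> nat \<Rightarrow> real"
  assumes S: "S \<in> carrier_mat d d" and sym: "\<And>i j. i < d \<Longrightarrow> j < d \<Longrightarrow> S $$ (i,j) = S $$ (j,i)"
    and inj: "\<And>c. (\<forall>j<d. (\<Sum>i<d. K j i * c i) = 0) \<Longrightarrow> \<forall>i<d. c i = 0"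
    and nz: "\<And>j. j < d \<Longrightarrow> D j \<noteq> 0"
    and form: "\<And>c. (\<Sum>i<d. \<Sum>j<d. c i * c j * S $$ (i,j)) = (\<Sum>j<d. D j * (\<Sum>i<d. K j i * c i)\<^sup>2)"
  shows "num_neg_eigenvalues S = card {j. j < d \<and> D j < 0}"
    and "sgn (Determinant.det S) = (\<Prod>j<d. sgn (D j))"
proof -
  have St: "transpose_mat S = S" using S sym by (intro eq_matI) auto
  obtain W es where W: "W \<in> carrier_mat d d" "transpose_mat W * W = 1\<^sub>m d"
    "transpose_mat W * S * W = mat_diag d es"
    using real_symmetric_diagonalization[OF S St] by blast
  note assoc = assoc_mult_mat[of _ d d _ d _ d]
  have W': "W * transpose_mat W = 1\<^sub>m d"
    by (rule mat_mult_left_right_inverse[OF _ W(1) W(2)]) (use W in auto)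
  have "W * (transpose_mat W * S * W) * transpose_mat W = (W * transpose_mat W) * S * (W * transpose_mat W)"
    using S W(1) by (simp add: assoc)
  then have SW: "S = W * mat_diag d es * transpose_mat W" using S by (simp add: W' W(3))
  have Sij: "S $$ (i,j) = (\<Sum>l<d. es l * W $$ (i,l) * W $$ (j,l))" if "i < d" "j < d" for i j
    unfolding SW using that W(1)
    by (subst mat_diag_mult_right[OF W(1)]) (auto simp: scalar_prod_def lessThan_atLeast0 intro!: sum.cong)
  define M where "M = (\<lambda>l i. W $$ (i,l))"
  have form2: "(\<Sum>i<d. \<Sum>j<d. c i * c j * S $$ (i,j)) = (\<Sum>l<d. es l * (\<Sum>i<d. M l i * c i)\<^sup>2)" for c
  proof -
    have "(\<Sum>i<d. \<Sum>j<d. c i * c j * S $$ (i,j)) = (\<Sum>i<d. \<Sum>j<d. \<Sum>l<d. es l * ((M l i * c i) * (M l j * c j)))"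
      by (intro sum.cong refl) (auto simp: Sij M_def sum_distrib_left algebra_simps intro!: sum.cong)
    also have "\<dots> = (\<Sum>i<d. \<Sum>l<d. \<Sum>j<d. es l * ((M l i * c i) * (M l j * c j)))"
      by (intro sum.cong refl sum.swap)
    also have "\<dots> = (\<Sum>l<d. \<Sum>i<d. \<Sum>j<d. es l * ((M l i * c i) * (M l j * c j)))"
      by (rule sum.swap)
    also have "\<dots> = (\<Sum>l<d. es l * (\<Sum>i<d. M l i * c i)\<^sup>2)"
      by (simp add: power2_eq_square sum_product) (simp add: sum_distrib_left)
    finally show ?thesis .
  qed
  have inj2: "\<forall>i<d. c i = 0" if c: "\<forall>l<d. (\<Sum>i<d. M l i * c i) = 0" for c
  proof -
    have "transpose_mat W *\<^sub>v vec d c = 0\<^sub>v d"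
      using c W(1) by (intro eq_vecI) (auto simp: M_def scalar_prod_def lessThan_atLeast0)
    then have "W *\<^sub>v (transpose_mat W *\<^sub>v vec d c) = 0\<^sub>v d" using W(1) by auto
    then have "(W * transpose_mat W) *\<^sub>v vec d c = 0\<^sub>v d"
      using W(1) by (subst assoc_mult_mat_vec[of _ d d _ d]) auto
    then have "vec d c = 0\<^sub>v d" by (simp add: W')
    then show ?thesis by (metis index_vec index_zero_vec(1))
  qed
  have eq: "(\<Sum>j<d. D j * (\<Sum>i<d. K j i * c i)\<^sup>2) = (\<Sum>l<d. es l * (\<Sum>i<d. M l i * c i)\<^sup>2)" for c
    using form form2 by metis
  have neg: "card {j. j < d \<and> D j < 0} = card {j. j < d \<and> es j < 0}"
    by (intro antisym card_neg_le_of_equal_forms[of d K D es M] card_neg_le_of_equal_forms[of d M es D K])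
      (use inj inj2 eq in auto)
  have pos: "card {j. j < d \<and> - D j < 0} = card {j. j < d \<and> - es j < 0}"
    by (intro antisym card_neg_le_of_equal_forms[of d K "\<lambda>j. - D j" "\<lambda>j. - es j" M]
        card_neg_le_of_equal_forms[of d M "\<lambda>j. - es j" "\<lambda>j. - D j" K])
      (use inj inj2 eq in \<open>auto simp: sum_negf\<close>)
  show n: "num_neg_eigenvalues S = card {j. j < d \<and> D j < 0}"
    using num_neg_eigenvalues_diagonalization(1)[OF S W] neg by simp
  have part: "card {j. j < d \<and> E j < 0} + card {j. j < d \<and> - E j < 0} + card {j. j < d \<and> E j = 0} = d"
    for E :: "nat \<Rightarrow> real"
  proof -
    have "{..<d} = ({j. j < d \<and> E j < 0} \<union> {j. j < d \<and> - E j < 0}) \<union> {j. j < d \<and> E j = 0}" by auto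
    then have "d = card (({j. j < d \<and> E j < 0} \<union> {j. j < d \<and> - E j < 0}) \<union> {j. j < d \<and> E j = 0})"
      by (metis card_lessThan)
    also have "\<dots> = card {j. j < d \<and> E j < 0} + card {j. j < d \<and> - E j < 0} + card {j. j < d \<and> E j = 0}"
      by (subst card_Un_disjoint; auto)+
    finally show ?thesis by simp
  qed
  have "{j. j < d \<and> D j = 0} = {}" using nz by auto
  then have "card {j. j < d \<and> D j = 0} = 0" by (simp only: card.empty)
  then have "card {j. j < d \<and> es j = 0} = 0" using part[of D] part[of es] neg pos by linarith
  then have nz': "es j \<noteq> 0" if "j < d" for j using that by auto
  have "sgn (Determinant.det S) = (\<Prod>j<d. sgn (es j))"
    by (simp add: num_neg_eigenvalues_diagonalization(2)[OF S W] sgn_prod)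
  also have "\<dots> = (\<Prod>j<d. sgn (D j))"
    using nz nz' neg by (simp add: prod_sgn_eq_power_card)
  finally show "sgn (Determinant.det S) = (\<Prod>j<d. sgn (D j))" .
qed

section \<open>The quadratic form of an inscribed polygon\<close>

definition rot90 :: "real \<times> real \<Rightarrow> real \<times> real" where
  "rot90 p = (- snd p, fst p)"

definition cross2 :: "real \<times> real \<Rightarrow> real \<times> real \<Rightarrow> real" where
  "cross2 p r = fst p * snd r - snd p * fst r"

text \<open>If \<open>p\<close> and \<open>r\<close> are at distance \<open>\<surd>\<rho>\<close> from the origin, this is the tangent of half of the
  oriented angle from \<open>p\<close> to \<open>r\<close>.\<close>

definition half_tan :: "real \<Rightarrow> real \<times> real \<Rightarrow> real \<times> real \<Rightarrow> real" where
  "half_tan \<rho> p r = cross2 p r / (\<rho> + inner p r)"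

lemmas plane_defs = rot90_def cross2_def inner_prod_def

lemma cross2_eq_inner: "cross2 p r = inner (rot90 p) r"
  by (simp add: plane_defs)

lemma cross2_swap: "cross2 r p = - cross2 p r"
  by (simp add: plane_defs)

text \<open>The expression is half the square of \<open>|p + r|\<close>, and \<open>p\<close>,
  \<open>r\<close> are not antipodal.\<close>

lemma denominator_pos:
  assumes "inner p p = \<rho>" "inner r r = \<rho>" "cross2 p r \<noteq> 0"
  shows "\<rho> + inner p r > 0"
proof -
  have "inner (p + r) (p + r) = 2 * (\<rho> + inner p r)"
    using assms by (simp add: inner_add_left inner_add_right inner_commute)
  moreover have "p + r \<noteq> 0"
    using assms(3) by (auto simp: cross2_def prod_eq_iff add_eq_0_iff)
  ultimately show ?thesis by (metis inner_gt_zero_iff zero_less_mult_pos zero_less_numeral)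
qed

text \<open>The sum of two vectors of equal length is parallel to their difference turned by a right
  angle; the lengths are proportional to cosine and sine of the half angle, so the ratio is its
  tangent.\<close>

lemma half_tan_rot:
  assumes "inner p p = \<rho>" "inner r r = \<rho>" "cross2 p r \<noteq> 0"
  shows "half_tan \<rho> p r *\<^sub>R (p + r) = rot90 p - rot90 r"
proof -
  note pos = denominator_pos[OF assms]
  obtain a b c d where pr: "p = (a, b)" "r = (c, d)" by (cases p, cases r) auto
  have r1: "a * a + b * b = \<rho>" and r2: "c * c + d * d = \<rho>" using assms(1,2) by (simp_all add: pr)
  have "\<rho> * d = (a * a + b * b) * d" "\<rho> * b = (c * c + d * d) * b"
    "\<rho> * a = (c * c + d * d) * a" "\<rho> * c = (a * a + b * b) * c"
    by (simp_all only: r1 r2)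
  then have "(a * d - b * c) * (a + c) = (\<rho> + (a * c + b * d)) * (d - b)"
    "(a * d - b * c) * (b + d) = (\<rho> + (a * c + b * d)) * (a - c)"
    by (simp_all add: algebra_simps)
  then have "cross2 p r *\<^sub>R (p + r) = (\<rho> + inner p r) *\<^sub>R (rot90 p - rot90 r)"
    by (simp add: pr plane_defs)
  then have "(1 / (\<rho> + inner p r)) *\<^sub>R (cross2 p r *\<^sub>R (p + r)) = rot90 p - rot90 r"
    using pos by simp
  then show ?thesis by (simp add: half_tan_def)
qed

lemma sgn_half_tan:
  assumes "inner p p = \<rho>" "inner r r = \<rho>" "cross2 p r \<noteq> 0"
  shows "sgn (half_tan \<rho> p r) = sgn (cross2 p r)"
  using denominator_pos[OF assms] by (simp add: half_tan_def sgn_divide)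

text \<open>Pairings of the vector relation with \<open>s\<close> and with \<open>rot90 s\<close>.
  For the radial part of a translation by \<open>s\<close> they turn the sum and the difference of
  the values at the two ends of an edge into expressions in the rotated vectors, whose sums over
  edges telescope.\<close>

lemma inner_half_tan_rot:
  assumes "inner p p = \<rho>" "inner r r = \<rho>" "cross2 p r \<noteq> 0"
  shows "half_tan \<rho> p r * (inner s p + inner s r) = inner s (rot90 p) - inner s (rot90 r)"
    and "inner s r - inner s p = half_tan \<rho> p r * (inner s (rot90 p) + inner s (rot90 r))"
proof -
  show "half_tan \<rho> p r * (inner s p + inner s r) = inner s (rot90 p) - inner s (rot90 r)"
    using arg_cong[OF half_tan_rot[OF assms], of "inner s"] by (simp add: inner_add_right inner_diff_right)
  have "inner s (rot90 v) = - inner (rot90 s) v" for v by (simp add: plane_defs)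
  moreover have "inner (rot90 s) (rot90 v) = inner s v" for v by (simp add: plane_defs)
  ultimately show "inner s r - inner s p = half_tan \<rho> p r * (inner s (rot90 p) + inner s (rot90 r))"
    using arg_cong[OF half_tan_rot[OF assms], of "inner (rot90 s)"]
    by (simp add: inner_add_right inner_diff_right algebra_simps)
qed

text \<open>The oriented angles of a triangle seen from the center add up to a multiple of a full
  turn, hence the half angles to a multiple of \<pi>, and the addition theorem of the tangent gives
  sum equals product. The factor \<open>\<rho>\<close> allows cosine and sine of the third angle to
  be expressed through those of the other two.\<close>

lemma half_tan_triangle:
  assumes "inner p p = \<rho>" "inner q q = \<rho>" "inner r r = \<rho>"
    and "cross2 p q \<noteq> 0" "cross2 q r \<noteq> 0" "cross2 r p \<noteq> 0"
  shows "half_tan \<rho> p q + half_tan \<rho> q r + half_tan \<rho> r p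
    = half_tan \<rho> p q * half_tan \<rho> q r * half_tan \<rho> r p"
proof -
  note d = denominator_pos[OF assms(1,2,4)] denominator_pos[OF assms(2,3,5)] denominator_pos[OF assms(3,1,6)]
  define c1 c2 s1 s2 where "c1 = inner p q" "c2 = inner q r" "s1 = cross2 p q" "s2 = cross2 q r"
  have "(inner u v)\<^sup>2 + (cross2 u v)\<^sup>2 = inner u u * inner v v" for u v
    by (simp add: plane_defs power2_eq_square algebra_simps)
  then have 1: "c1\<^sup>2 + s1\<^sup>2 = \<rho>\<^sup>2" "c2\<^sup>2 + s2\<^sup>2 = \<rho>\<^sup>2"
    unfolding c1_c2_s1_s2_def by (simp_all only: assms(1-3) power2_eq_square)
  have "inner q q * inner r p = inner p q * inner q r - cross2 p q * cross2 q r"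
    "inner q q * cross2 r p = - (cross2 p q * inner q r + inner p q * cross2 q r)"
    by (simp_all add: plane_defs algebra_simps)
  then have 2: "\<rho> * inner r p = c1 * c2 - s1 * s2" "\<rho> * cross2 r p = - (s1 * c2 + c1 * s2)"
    unfolding c1_c2_s1_s2_def by (simp_all only: assms(2))
  have "\<rho> * (s1 * (\<rho> + c2) * (\<rho> + inner r p) + (\<rho> + c1) * s2 * (\<rho> + inner r p)
      + (\<rho> + c1) * (\<rho> + c2) * cross2 r p)
    = (s1 * (\<rho> + c2) + (\<rho> + c1) * s2) * (\<rho>\<^sup>2 + \<rho> * inner r p) + (\<rho> + c1) * (\<rho> + c2) * (\<rho> * cross2 r p)"
    by (simp add: algebra_simps power2_eq_square)
  also have "\<dots> = s1 * s2 * (\<rho> * cross2 r p) + s1 * \<rho> * (\<rho>\<^sup>2 - (c2\<^sup>2 + s2\<^sup>2)) + s2 * \<rho> * (\<rho>\<^sup>2 - (c1\<^sup>2 + s1\<^sup>2))"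
    unfolding 2 by (simp add: algebra_simps power2_eq_square)
  also have "\<dots> = \<rho> * (s1 * s2 * cross2 r p)" unfolding 1 by simp
  finally have "\<rho> * (s1 * (\<rho> + c2) * (\<rho> + inner r p) + (\<rho> + c1) * s2 * (\<rho> + inner r p)
      + (\<rho> + c1) * (\<rho> + c2) * cross2 r p) = \<rho> * (s1 * s2 * cross2 r p)" .
  moreover have "\<rho> \<noteq> 0" using assms(1,4) by (auto simp: cross2_def)
  ultimately have "s1 * (\<rho> + c2) * (\<rho> + inner r p) + (\<rho> + c1) * s2 * (\<rho> + inner r p)
      + (\<rho> + c1) * (\<rho> + c2) * cross2 r p = s1 * s2 * cross2 r p"
    by simp
  then have "cross2 p q * (\<rho> + inner q r) * (\<rho> + inner r p) + (\<rho> + inner p q) * cross2 q r * (\<rho> + inner r p)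
      + (\<rho> + inner p q) * (\<rho> + inner q r) * cross2 r p = cross2 p q * cross2 q r * cross2 r p"
    by (simp add: c1_c2_s1_s2_def)
  moreover have "S1 / d1 + S2 / d2 + S3 / d3 = (S1 * d2 * d3 + d1 * S2 * d3 + d1 * d2 * S3) / (d1 * d2 * d3)"
    if "d1 > 0" "d2 > 0" "d3 > 0" for S1 S2 S3 d1 d2 d3 :: real
    using that by (simp add: field_simps)
  ultimately show ?thesis using d by (simp add: half_tan_def)
qed

text \<open>The assumption \<open>diagonal\<close> covers the closing edges of all
  subconfigurations, so a single sequence \<open>q\<close> serves the whole flag.\<close>

locale inscribed_polygon =
  fixes n :: nat and \<rho> :: real and q :: "nat \<Rightarrow> real \<times> real"
  assumes n_ge_3: "n \<ge> 3"
    and on_circle: "\<And>k. k \<in> {1..n} \<Longrightarrow> inner (q k) (q k) = \<rho>"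
    and edge: "\<And>k. k \<in> {1..<n} \<Longrightarrow> cross2 (q k) (q (k + 1)) \<noteq> 0"
    and diagonal: "\<And>k. k \<in> {2..n} \<Longrightarrow> cross2 (q 1) (q k) \<noteq> 0"
begin

definition t :: "nat \<Rightarrow> real" where
  "t k = half_tan \<rho> (q k) (q (k + 1))"

definition \<delta> :: "nat \<Rightarrow> real" where
  "\<delta> i = (\<Sum>k=1..<i. t k) + half_tan \<rho> (q i) (q 1)"

text \<open>Up to the factor \<open>\<rho> / 2\<close>, \<open>B\<close> is the second variation of the area in terms of the
  radial components of the variations, whenever these vanish at \<open>1\<close> and \<open>n\<close>.\<close>

definition E :: "nat \<Rightarrow> (nat \<Rightarrow> real) \<Rightarrow> (nat \<Rightarrow> real) \<Rightarrow> real" where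
  "E k a b = t k * (a k + a (k + 1)) * (b k + b (k + 1))
    - (1 / t k) * (a (k + 1) - a k) * (b (k + 1) - b k)"

definition B :: "(nat \<Rightarrow> real) \<Rightarrow> (nat \<Rightarrow> real) \<Rightarrow> real" where
  "B a b = (\<Sum>k=1..<n. E k a b)"

text \<open>Minus the total tangential increment that \<open>a\<close> forces along the edges 1 to
  \<open>n - 1\<close>. When \<open>a\<close> vanishes at 1 and \<open>n\<close>, the closing edge
  adds nothing, and the polygon closes up to first order only if this is zero.\<close>

definition ell :: "(nat \<Rightarrow> real) \<Rightarrow> real" where
  "ell a = (\<Sum>k=1..<n. t k * (a k + a (k + 1)))"

text \<open>The translation vector whose radial component, taken as the inner product with the
  vertex, is 1 at both ends of the closing edge of the \<open>i\<close>-th subconfiguration.\<close>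

definition \<sigma> :: "nat \<Rightarrow> real \<times> real" where
  "\<sigma> i = (1 / (\<rho> + inner (q 1) (q i))) *\<^sub>R (q 1 + q i)"

text \<open>Up to a cutoff at \<open>i\<close>, \<open>x i\<close> is the radial part of the translation that fixes the
  coordinate \<open>1\<close>, and \<open>y i\<close> is the difference of the constant vector \<open>1\<close> and the radial part of
  a translation, chosen to vanish at \<open>1\<close> and \<open>i\<close>.\<close>

definition x :: "nat \<Rightarrow> nat \<Rightarrow> real" where
  "x i k = (if k \<le> i then cross2 (q 1) (q k) else 0)"

definition y :: "nat \<Rightarrow> nat \<Rightarrow> real" where
  "y i k = (if k \<le> i then 1 - inner (\<sigma> i) (q k) else 0)"

text \<open>The coefficients make \<open>ell\<close> vanish, because
  \<open>ell (y i) = 2 * \<delta> i\<close>. Both summands are orthogonal to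
  \<open>T\<^sub>i\<close>: the first because its products are multiples of \<open>ell\<close>, the
  second because it is a truncated translation.\<close>

definition f :: "nat \<Rightarrow> nat \<Rightarrow> real" where
  "f i k = ell (x i) * y i k - 2 * \<delta> i * x i k"

text \<open>With \<open>ell a = 0\<close> added, this describes \<open>T\<^sub>i\<close>: there are
  \<open>i - 2\<close> free coordinates and one equation, hence dimension
  \<open>i - 3\<close>.\<close>

definition supp :: "nat \<Rightarrow> (nat \<Rightarrow> real) \<Rightarrow> bool" where
  "supp i a \<longleftrightarrow> a 1 = 0 \<and> (\<forall>k\<ge>i. a k = 0)"

text \<open>This is \<open>-d(P\<^sub>i)(-1)\<^bsup>e(P\<^sub>i)\<^esup>\<close>: the product runs over the edges of
  the subconfiguration, the last factor belonging to its closing edge.\<close>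

definition H :: "nat \<Rightarrow> real" where
  "H i = - sgn (\<delta> i) * ((\<Prod>k=1..<i. - sgn (t k)) * (- sgn (half_tan \<rho> (q i) (q 1))))"

section \<open>Truncated translations and scalings under the form\<close>

lemma t_nz: "k \<in> {1..<n} \<Longrightarrow> t k \<noteq> 0"
  using edge[of k] denominator_pos[of "q k" \<rho> "q (k + 1)"] on_circle[of k] on_circle[of "k + 1"]
  by (auto simp: t_def half_tan_def)

lemma closing: "i \<in> {2..n} \<Longrightarrow> cross2 (q i) (q 1) \<noteq> 0"
  using diagonal[of i] cross2_swap[of "q i" "q 1"] by simp

lemma closing_nz: "i \<in> {2..n} \<Longrightarrow> half_tan \<rho> (q i) (q 1) \<noteq> 0"
  using closing[of i] denominator_pos[of "q i" \<rho> "q 1"] on_circle[of i] on_circle[of 1]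
  by (auto simp: half_tan_def)

lemma edge_rot:
  assumes "k \<in> {1..<n}"
  shows "t k * (inner s (q k) + inner s (q (k + 1))) = inner s (rot90 (q k)) - inner s (rot90 (q (k + 1)))"
    and "inner s (q (k + 1)) - inner s (q k) = t k * (inner s (rot90 (q k)) + inner s (rot90 (q (k + 1))))"
  unfolding t_def
  by (rule inner_half_tan_rot; use assms edge[of k] on_circle[of k] on_circle[of "k + 1"] in auto)+

text \<open>If one argument is the radial part of a translation, the edge term is a difference of
  values at its two ends. Sums over consecutive edges therefore reduce to boundary terms.\<close>

lemma E_linear:
  assumes k: "k \<in> {1..<n}" and a: "a k = inner s (q k)" "a (k + 1) = inner s (q (k + 1))"
  shows "E k a b = 2 * (b k * inner s (rot90 (q k)) - b (k + 1) * inner s (rot90 (q (k + 1))))"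
proof -
  have "(1 / t k) * (a (k + 1) - a k) = inner s (rot90 (q k)) + inner s (rot90 (q (k + 1)))"
    unfolding a edge_rot(2)[OF k, of s] using t_nz[OF k] by simp
  moreover have "t k * (a k + a (k + 1)) = inner s (rot90 (q k)) - inner s (rot90 (q (k + 1)))"
    unfolding a by (rule edge_rot(1)[OF k])
  ultimately show ?thesis by (simp only: E_def) (simp add: algebra_simps)
qed

lemma E_comm: "E k a b = E k b a"
  by (simp add: E_def algebra_simps)

lemma B_comm: "B a b = B b a"
  unfolding B_def by (intro sum.cong refl E_comm)

lemma E_comb: "E j (\<lambda>k. c * a k + d * b k) e = c * E j a e + d * E j b e"
  by (simp add: E_def algebra_simps add_divide_distrib diff_divide_distrib)

lemma B_comb: "B (\<lambda>k. c * a k + d * b k) e = c * B a e + d * B b e"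
  by (simp add: B_def E_comb sum_distrib_left sum.distrib)

lemma B_comb2: "B e (\<lambda>k. c * a k + d * b k) = c * B e a + d * B e b"
  using B_comb[of c a d b e] by (simp add: B_comm)

lemma ell_comb: "ell (\<lambda>k. c * a k + d * b k) = c * ell a + d * ell b"
  by (simp add: ell_def sum_distrib_left sum.distrib[symmetric] algebra_simps)

lemma sum_split: "i \<in> {1..n} \<Longrightarrow> (\<Sum>k=1..<n. g k) = (\<Sum>k=1..<i. g k) + (\<Sum>k=i..<n. g k :: real)"
  by (subst sum.atLeastLessThan_concat) auto

lemma B_supp:
  assumes "i \<in> {1..n}" "\<forall>k\<ge>i. b k = 0"
  shows "B a b = (\<Sum>k=1..<i. E k a b)"
  unfolding B_def sum_split[OF assms(1)]
  by (subst (2) sum.neutral) (use assms(2) in \<open>auto simp: E_def\<close>)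

lemma ell_supp:
  assumes "i \<in> {1..n}" "\<forall>k\<ge>i. b k = 0"
  shows "ell b = (\<Sum>k=1..<i. t k * (b k + b (k + 1)))"
  unfolding ell_def sum_split[OF assms(1)]
  by (subst (2) sum.neutral) (use assms(2) in auto)

lemma sum_telescope: "1 \<le> (i::nat) \<Longrightarrow> (\<Sum>k=1..<i. g k - g (k + 1)) = g 1 - (g i :: real)"
  by (induction i rule: nat_induct_at_least) auto

lemma sum_E_linear:
  assumes i: "i \<in> {1..n}" and a: "\<And>k. k \<in> {1..i} \<Longrightarrow> a k = inner s (q k)"
  shows "(\<Sum>k=1..<i. E k a b) = 2 * (b 1 * inner s (rot90 (q 1)) - b i * inner s (rot90 (q i)))"
proof -
  have "(\<Sum>k=1..<i. E k a b)
      = (\<Sum>k=1..<i. 2 * (b k * inner s (rot90 (q k))) - 2 * (b (k + 1) * inner s (rot90 (q (k + 1)))))"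
    by (intro sum.cong refl, subst E_linear[where s = s]) (use i a in \<open>auto simp: algebra_simps\<close>)
  also have "\<dots> = 2 * (b 1 * inner s (rot90 (q 1))) - 2 * (b i * inner s (rot90 (q i)))"
    using i sum_telescope[of i "\<lambda>k. 2 * (b k * inner s (rot90 (q k)))"] by simp
  finally show ?thesis by (simp add: algebra_simps)
qed

lemma x_1: "x i 1 = 0"
  by (simp add: x_def cross2_def)

lemma x_supp: "supp (i + 1) (x i)"
  unfolding supp_def using x_1 by (auto simp: x_def)

text \<open>Up to \<open>i\<close>, \<open>x i\<close> is a translation, and \<open>b\<close>
  vanishes at 1 and \<open>i\<close>, so both boundary terms disappear.\<close>

lemma B_x_eq_0:
  assumes i: "i \<in> {1..n}" and b: "supp i b"
  shows "B (x i) b = 0"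
proof -
  have "(\<Sum>k=1..<i. E k (x i) b) = 2 * (b 1 * inner (rot90 (q 1)) (rot90 (q 1)) - b i * inner (rot90 (q 1)) (rot90 (q i)))"
    by (rule sum_E_linear[OF i]) (auto simp: x_def cross2_eq_inner)
  then show ?thesis using b B_supp[OF i, of b "x i"] by (simp add: supp_def)
qed

text \<open>Up to \<open>i\<close> only boundary terms survive; the cutoff adds the single edge from
  \<open>i\<close> to \<open>i + 1\<close>. Eliminating the rotated vector in favour of
  \<open>q (i + 1)\<close> cancels the square and leaves a product whose sign can be read
  off.\<close>

lemma B_x_x:
  assumes i: "i \<in> {2..<n}"
  shows "B (x i) (x i) = - (t i + 1 / t i) * cross2 (q 1) (q i) * cross2 (q 1) (q (i + 1))"
proof -
  let ?s = "rot90 (q 1)"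
  have "B (x i) (x i) = (\<Sum>k=1..<i+1. E k (x i) (x i))"
    by (rule B_supp) (use i in \<open>auto simp: x_def\<close>)
  also have "\<dots> = (\<Sum>k=1..<i. E k (x i) (x i)) + E i (x i) (x i)"
    using i by simp
  also have "(\<Sum>k=1..<i. E k (x i) (x i)) = 2 * (x i 1 * inner ?s (rot90 (q 1)) - x i i * inner ?s (rot90 (q i)))"
    by (rule sum_E_linear) (use i in \<open>auto simp: x_def cross2_eq_inner\<close>)
  also have "E i (x i) (x i) = (t i - 1 / t i) * (x i i)\<^sup>2"
    by (simp add: E_def x_def power2_eq_square algebra_simps)
  finally have "B (x i) (x i) = 2 * (x i 1 * inner ?s (rot90 (q 1)) - x i i * inner ?s (rot90 (q i)))
    + (t i - 1 / t i) * (x i i)\<^sup>2" .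
  moreover have "2 * (x i 1 * inner ?s (rot90 (q 1)) - x i i * inner ?s (rot90 (q i)))
      = - x i i * (2 * inner ?s (rot90 (q i)))"
    unfolding x_1 by simp
  \<comment> \<open>The sum of the two relations for the edge \<open>i\<close>, the second divided
    by \<open>t i\<close>; the term with \<open>rot90 (q (i + 1))\<close> drops out.\<close>
  moreover have "2 * inner ?s (rot90 (q i)) = (t i - 1 / t i) * inner ?s (q i) + (t i + 1 / t i) * inner ?s (q (i + 1))"
  proof -
    have k: "i \<in> {1..<n}" using i by auto
    have "(1 / t i) * (inner ?s (q (i + 1)) - inner ?s (q i)) = inner ?s (rot90 (q i)) + inner ?s (rot90 (q (i + 1)))"
      using edge_rot(2)[OF k, of ?s] t_nz[OF k] by simp
    then show ?thesis using edge_rot(1)[OF k, of ?s] by (simp add: algebra_simps)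
  qed
  ultimately have "B (x i) (x i) = - x i i * ((t i - 1 / t i) * inner ?s (q i) + (t i + 1 / t i) * inner ?s (q (i + 1)))
      + (t i - 1 / t i) * (x i i)\<^sup>2"
    by (simp only:)
  moreover have "x i i = inner ?s (q i)" by (simp add: x_def cross2_eq_inner)
  ultimately show ?thesis
    by (simp only: cross2_eq_inner power2_eq_square) (simp add: algebra_simps)
qed

lemma \<sigma>_inner:
  assumes i: "i \<in> {2..n}"
  shows "inner (\<sigma> i) (q 1) = 1" "inner (\<sigma> i) (q i) = 1"
proof -
  have c: "inner (q 1) (q 1) = \<rho>" "inner (q i) (q i) = \<rho>" using i by (auto intro: on_circle)
  have "\<rho> + inner (q 1) (q i) > 0" using denominator_pos[OF c diagonal[OF i]] .
  then show "inner (\<sigma> i) (q 1) = 1" "inner (\<sigma> i) (q i) = 1"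
    unfolding \<sigma>_def inner_scaleR_left inner_add_left c inner_commute[of "q i" "q 1"]
    by (simp_all add: add.commute)
qed

lemma y_supp: "i \<in> {2..n} \<Longrightarrow> supp i (y i)"
  using \<sigma>_inner[of i] by (auto simp: supp_def y_def le_less)

text \<open>Scaling has constant radial part, so only the \<open>t\<close>-terms of the form see it,
  and they give \<open>2 * ell b\<close>. The translation subtracted from it contributes boundary
  terms, which vanish.\<close>

lemma B_y:
  assumes i: "i \<in> {2..n}" and b: "supp i b"
  shows "B (y i) b = 2 * ell b"
proof -
  have i': "i \<in> {1..n}" using i by auto
  have E: "E k (y i) b = 2 * (t k * (b k + b (k + 1))) - E k (\<lambda>k. inner (\<sigma> i) (q k)) b" if "k \<in> {1..<i}" for k
    using that by (simp add: E_def y_def algebra_simps)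
  have "B (y i) b = (\<Sum>k=1..<i. E k (y i) b)"
    by (rule B_supp[OF i']) (use b in \<open>auto simp: supp_def\<close>)
  also have "\<dots> = 2 * (\<Sum>k=1..<i. t k * (b k + b (k + 1))) - (\<Sum>k=1..<i. E k (\<lambda>k. inner (\<sigma> i) (q k)) b)"
    by (simp add: E sum_subtractf sum_distrib_left)
  also have "(\<Sum>k=1..<i. E k (\<lambda>k. inner (\<sigma> i) (q k)) b) = 0"
    using sum_E_linear[OF i', of "\<lambda>k. inner (\<sigma> i) (q k)" "\<sigma> i" b] b by (simp add: supp_def)
  also have "(\<Sum>k=1..<i. t k * (b k + b (k + 1))) = ell b"
    by (rule ell_supp[OF i', symmetric]) (use b in \<open>auto simp: supp_def\<close>)
  finally show ?thesis by simp
qed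

text \<open>The constant part gives twice the tangents of the edges before \<open>i\<close>. The
  translation part telescopes to a difference between the ends \<open>i\<close> and 1, which the
  closing edge converts into twice its own tangent.\<close>

lemma ell_y:
  assumes i: "i \<in> {2..n}"
  shows "ell (y i) = 2 * \<delta> i"
proof -
  have i': "i \<in> {1..n}" using i by auto
  let ?g = "\<lambda>k. inner (\<sigma> i) (rot90 (q k))"
  have "ell (y i) = (\<Sum>k=1..<i. t k * (y i k + y i (k + 1)))"
    by (rule ell_supp[OF i']) (use y_supp[OF i] in \<open>auto simp: supp_def\<close>)
  also have "\<dots> = (\<Sum>k=1..<i. 2 * t k - (?g k - ?g (k + 1)))"
  proof (intro sum.cong refl)
    fix k assume "k \<in> {1..<i}"
    then show "t k * (y i k + y i (k + 1)) = 2 * t k - (?g k - ?g (k + 1))"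
      using edge_rot(1)[of k "\<sigma> i"] i by (auto simp: y_def algebra_simps)
  qed
  also have "\<dots> = 2 * (\<Sum>k=1..<i. t k) - (?g 1 - ?g i)"
    using i sum_telescope[of i ?g] by (simp add: sum_subtractf sum_distrib_left)
  also have "?g 1 - ?g i = - 2 * half_tan \<rho> (q i) (q 1)"
  proof -
    have "half_tan \<rho> (q i) (q 1) * (inner (\<sigma> i) (q i) + inner (\<sigma> i) (q 1)) = ?g i - ?g 1"
      by (rule inner_half_tan_rot(1)) (use i closing[of i] on_circle[of i] on_circle[of 1] in auto)
    then have "half_tan \<rho> (q i) (q 1) * 2 = ?g i - ?g 1" by (simp only: \<sigma>_inner[OF i] one_add_one)
    then show ?thesis by simp
  qed
  finally show ?thesis by (simp add: \<delta>_def)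
qed

text \<open>The difference \<open>\<sigma> i - \<sigma> (i + 1)\<close> is orthogonal to
  \<open>q 1\<close>, hence a multiple of \<open>rot90 (q 1)\<close>, and the translation in that
  direction is the one defining \<open>x i\<close>.\<close>

lemma y_step:
  assumes i: "i \<in> {2..<n}"
  obtains \<mu> where "\<And>k. k \<ge> 1 \<Longrightarrow> y (i + 1) k = y i k + \<mu> * x i k"
proof -
  define w where "w = \<sigma> i - \<sigma> (i + 1)"
  have "\<rho> \<noteq> 0" using on_circle[of 1] diagonal[of 2] n_ge_3 by (auto simp: cross2_def)
  have c: "inner (q 1) (q 1) = \<rho>" using n_ge_3 by (auto intro: on_circle)
  have "inner w (q 1) = 0" using \<sigma>_inner(1)[of i] \<sigma>_inner(1)[of "i + 1"] i by (auto simp: w_def inner_diff_left)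
  moreover have "inner w (rot90 (q 1)) * cross2 (q 1) v
      = inner (q 1) (q 1) * inner w v - inner w (q 1) * inner (q 1) v" for v
    by (simp add: plane_defs algebra_simps)
  ultimately have "\<rho> * inner w v = inner w (rot90 (q 1)) * cross2 (q 1) v" for v
    by (simp only: c)
  then have w: "inner w v = (inner w (rot90 (q 1)) / \<rho>) * cross2 (q 1) v" for v
    using \<open>\<rho> \<noteq> 0\<close> by (simp add: field_simps)
  show ?thesis
  proof (rule that[of "inner w (rot90 (q 1)) / \<rho>"])
    fix k :: nat assume "k \<ge> 1"
    \<comment> \<open>At \<open>i + 1\<close> the left side vanishes by the normalization of
      \<open>\<sigma> (i + 1)\<close> and the right side by the cutoffs at \<open>i\<close>.\<close>
    consider "k \<le> i" | "k = i + 1" | "k > i + 1" by linarith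
    then show "y (i + 1) k = y i k + inner w (rot90 (q 1)) / \<rho> * x i k"
    proof cases
      case 1
      then show ?thesis using w[of "q k"] by (simp add: y_def x_def w_def inner_diff_left)
    next
      case 2
      then show ?thesis using \<sigma>_inner(2)[of "i + 1"] i by (simp add: y_def x_def)
    qed (auto simp: y_def x_def)
  qed
qed

lemma B_cong: "(\<And>k. k \<ge> 1 \<Longrightarrow> a k = a' k) \<Longrightarrow> B a b = B a' b"
  unfolding B_def E_def by (intro sum.cong refl) auto

lemma ell_cong: "(\<And>k. k \<ge> 1 \<Longrightarrow> a k = a' k) \<Longrightarrow> ell a = ell a'"
  unfolding ell_def by (intro sum.cong refl) auto

text \<open>Pairing the relation between \<open>y (i + 1)\<close> and \<open>y i\<close> with
  \<open>x i\<close>, and applying \<open>ell\<close> to it, gives two linear equations for the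
  factor \<open>\<mu>\<close>; eliminating \<open>\<mu>\<close> gives the claim.\<close>

lemma \<delta>_step:
  assumes i: "i \<in> {2..<n}"
  shows "(ell (x i))\<^sup>2 = (\<delta> (i + 1) - \<delta> i) * B (x i) (x i)"
proof -
  obtain \<mu> where \<mu>: "\<And>k. k \<ge> 1 \<Longrightarrow> y (i + 1) k = y i k + \<mu> * x i k" using y_step[OF i] by blast
  have ii: "i \<in> {2..n}" "i + 1 \<in> {2..n}" "i \<in> {1..n}" using i by auto
  have "2 * ell (x i) = B (y (i + 1)) (x i)" using B_y[OF ii(2) x_supp] by simp
  also have "\<dots> = B (\<lambda>k. 1 * y i k + \<mu> * x i k) (x i)" by (rule B_cong) (simp only: \<mu> mult_1)
  also have "\<dots> = B (x i) (y i) + \<mu> * B (x i) (x i)" unfolding B_comb by (simp add: B_comm)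
  also have "B (x i) (y i) = 0" using B_x_eq_0[OF ii(3) y_supp[OF ii(1)]] .
  finally have 1: "2 * ell (x i) = \<mu> * B (x i) (x i)" by simp
  have "2 * \<delta> (i + 1) = ell (y (i + 1))" using ell_y[OF ii(2)] by simp
  also have "\<dots> = ell (\<lambda>k. 1 * y i k + \<mu> * x i k)" by (rule ell_cong) (simp only: \<mu> mult_1)
  also have "\<dots> = 2 * \<delta> i + \<mu> * ell (x i)" unfolding ell_comb using ell_y[OF ii(1)] by simp
  finally have 2: "2 * \<delta> (i + 1) = 2 * \<delta> i + \<mu> * ell (x i)" .
  have "2 * (ell (x i))\<^sup>2 = (\<mu> * ell (x i)) * B (x i) (x i)"
    using 1 by (simp add: power2_eq_square)
  also have "\<dots> = 2 * (\<delta> (i + 1) - \<delta> i) * B (x i) (x i)" using 2 by simp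
  finally show ?thesis by linarith
qed

section \<open>The orthogonal basis adapted to the flag\<close>

lemma f_alt: "f i = (\<lambda>k. ell (x i) * y i k + (- 2 * \<delta> i) * x i k)"
  by (simp add: f_def fun_eq_iff)

lemma f_supp: "i \<in> {2..n} \<Longrightarrow> supp (i + 1) (f i)"
  using y_supp[of i] x_supp[of i] by (auto simp: supp_def f_def)

lemma ell_f: "i \<in> {2..n} \<Longrightarrow> ell (f i) = 0"
  unfolding f_alt ell_comb by (simp add: ell_y)

lemma f_i_i: "i \<in> {2..n} \<Longrightarrow> f i i = - 2 * \<delta> i * cross2 (q 1) (q i)"
  using y_supp[of i] by (auto simp: supp_def f_def x_def)

lemma B_f_eq_0: "i \<in> {2..n} \<Longrightarrow> supp i b \<Longrightarrow> ell b = 0 \<Longrightarrow> B (f i) b = 0"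
  unfolding f_alt B_comb by (simp add: B_y B_x_eq_0)

text \<open>The vectors \<open>x i\<close> and \<open>y i\<close> are orthogonal and
  \<open>B (y i) (y i) = 4 * \<delta> i\<close>. Replacing \<open>(ell (x i))\<^sup>2\<close> by
  means of \<open>\<delta>_step\<close> cancels the square of \<open>\<delta> i\<close>.\<close>

lemma B_f_f:
  assumes i: "i \<in> {2..<n}"
  shows "B (f i) (f i) = 4 * \<delta> i * \<delta> (i + 1) * B (x i) (x i)"
proof -
  have ii: "i \<in> {2..n}" "i \<in> {1..n}" using i by auto
  have xy: "B (x i) (y i) = 0" using B_x_eq_0[OF ii(2) y_supp[OF ii(1)]] .
  then have yx: "B (y i) (x i) = 0" by (simp add: B_comm)
  have yy: "B (y i) (y i) = 4 * \<delta> i" using B_y[OF ii(1) y_supp[OF ii(1)]] ell_y[OF ii(1)] by simp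
  have "B (f i) (f i) = (ell (x i))\<^sup>2 * (4 * \<delta> i) + 4 * (\<delta> i)\<^sup>2 * B (x i) (x i)"
    unfolding f_alt B_comb B_comb2 xy yx yy by (simp add: power2_eq_square)
  also have "\<dots> = 4 * \<delta> i * \<delta> (i + 1) * B (x i) (x i)"
    unfolding \<delta>_step[OF i] by (simp add: power2_eq_square algebra_simps)
  finally show ?thesis .
qed

lemma triangle: "t 1 + t 2 + half_tan \<rho> (q 3) (q 1) = t 1 * t 2 * half_tan \<rho> (q 3) (q 1)"
  using half_tan_triangle[of "q 1" \<rho> "q 2" "q 3"] edge[of 1] edge[of 2] closing[of 3] on_circle n_ge_3
  by (simp add: t_def numeral_eq_Suc)

lemma \<delta>_3: "\<delta> 3 = t 1 * t 2 * half_tan \<rho> (q 3) (q 1)"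
  using triangle by (simp add: \<delta>_def numeral_eq_Suc)

text \<open>Otherwise the triangle relation would make the closing tangent times
  \<open>1 + (t 1)\<^sup>2\<close> vanish. This is the rigidity of triangles, on which the flag
  starts.\<close>

lemma t1_t2_nz: "t 1 + t 2 \<noteq> 0"
proof
  assume "t 1 + t 2 = 0"
  then have "t 2 = - t 1" by simp
  then have "half_tan \<rho> (q 3) (q 1) * (1 + (t 1)\<^sup>2) = 0" using triangle by (simp add: algebra_simps power2_eq_square)
  moreover have "1 + (t 1)\<^sup>2 > 0" by (simp add: add_pos_nonneg)
  ultimately show False using closing_nz[of 3] n_ge_3 by simp
qed

text \<open>By the triangle relation \<open>\<delta> 3\<close> is the product of the three tangents,
  whose signs cancel against those in \<open>H\<close>. So the value prescribed for the triangle
  agrees with the general formula.\<close>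

lemma H_3: "H 3 = 1"
proof -
  have nz: "t 1 \<noteq> 0" "t 2 \<noteq> 0" "half_tan \<rho> (q 3) (q 1) \<noteq> 0"
    using t_nz[of 1] t_nz[of 2] closing_nz[of 3] n_ge_3 by auto
  then have sq: "sgn (t 1) * sgn (t 1) = 1" "sgn (t 2) * sgn (t 2) = 1"
    "sgn (half_tan \<rho> (q 3) (q 1)) * sgn (half_tan \<rho> (q 3) (q 1)) = 1"
    by (auto simp: sgn_if)
  have "{1..<3::nat} = {1, 2}" by auto
  then have "H 3 = - (sgn (t 1) * sgn (t 2) * sgn (half_tan \<rho> (q 3) (q 1)))
      * (- sgn (t 1) * - sgn (t 2) * - sgn (half_tan \<rho> (q 3) (q 1)))"
    unfolding H_def \<delta>_3 sgn_mult by simp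
  also have "\<dots> = (sgn (t 1) * sgn (t 1)) * (sgn (t 2) * sgn (t 2))
      * (sgn (half_tan \<rho> (q 3) (q 1)) * sgn (half_tan \<rho> (q 3) (q 1)))"
    by (simp only: mult_minus_left mult_minus_right minus_minus mult_ac)
  finally show ?thesis by (simp only: sq mult_1)
qed

text \<open>In \<open>H i * H (i + 1)\<close> the signs of the edges common to both
  subconfigurations square to 1. What remains is the edge \<open>i\<close>, the two closing edges
  and the two values of \<delta>, and these are the factors of \<open>B (f i) (f i)\<close>.\<close>

lemma sgn_B_f_f:
  assumes i: "i \<in> {3..<n}"
  shows "sgn (B (f i) (f i)) = H i * H (i + 1)"
proof -
  have i': "i \<in> {2..<n}" "i \<in> {1..<n}" and ii: "i \<in> {2..n}" "i + 1 \<in> {2..n}" using i by auto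
  have cl: "sgn (half_tan \<rho> (q j) (q 1)) = - sgn (cross2 (q 1) (q j))" if "j \<in> {2..n}" for j
    using sgn_half_tan[of "q j" \<rho> "q 1"] closing[OF that] on_circle[of j] on_circle[of 1] that n_ge_3
      cross2_swap[of "q j" "q 1"] by (simp add: sgn_minus)
  have sgn_t: "sgn (t i + 1 / t i) = sgn (t i)"
  proof (cases "t i > 0")
    case True
    then show ?thesis using add_pos_pos[of "t i" "1 / t i"] by simp
  next
    case False
    then have "t i < 0" using t_nz[OF i'(2)] by simp
    then show ?thesis using add_neg_neg[of "t i" "1 / t i"] by simp
  qed
  have pp: "(\<Prod>k=1..<i. - sgn (t k)) * (\<Prod>k=1..<i. - sgn (t k)) = 1"
  proof -
    have "(- sgn (t k)) * (- sgn (t k)) = 1" if "k \<in> {1..<i}" for k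
      using t_nz[of k] that i by (auto simp: sgn_if)
    then show ?thesis unfolding prod.distrib[symmetric] by (intro prod.neutral) auto
  qed
  have "H i * H (i + 1) = sgn (\<delta> i) * sgn (\<delta> (i + 1)) *
    ((\<Prod>k=1..<i. - sgn (t k)) * (\<Prod>k=1..<i. - sgn (t k))) * (- sgn (t i)) *
    sgn (half_tan \<rho> (q i) (q 1)) * sgn (half_tan \<rho> (q (i + 1)) (q 1))"
    using i by (simp add: H_def)
  also have "\<dots> = sgn (B (f i) (f i))"
    unfolding B_f_f[OF i'(1)] B_x_x[OF i'(1)] pp sgn_mult sgn_minus sgn_t
    unfolding cl[OF ii(1)] cl[OF ii(2)] by simp
  finally show ?thesis by simp
qed

text \<open>Only \<open>a 2\<close> is free, and \<open>ell a\<close> is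
  \<open>(t 1 + t 2) * a 2\<close>, so \<open>T\<^sub>3\<close> is zero.\<close>

lemma base_case:
  assumes "supp 3 a" "ell a = 0" "k \<ge> 1"
  shows "a k = 0"
proof -
  have "ell a = (\<Sum>k=1..<3. t k * (a k + a (k + 1)))"
    by (rule ell_supp) (use n_ge_3 assms in \<open>auto simp: supp_def\<close>)
  also have "{1..<3::nat} = {1, 2}" by auto
  finally have "(t 1 + t 2) * a 2 = 0" using assms by (simp add: supp_def algebra_simps numeral_eq_Suc)
  then have "a 2 = 0" using t1_t2_nz by simp
  moreover have "k = 1 \<or> k = 2 \<or> k \<ge> 3" using assms(3) by linarith
  ultimately show ?thesis using assms(1) by (auto simp: supp_def)
qed

text \<open>Orthogonal projection from the top of the flag downwards: removing the right multiple of
  \<open>f m\<close> moves a vector of the next space into \<open>T\<^sub>m\<close>, to which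
  \<open>f m\<close> is orthogonal. The second conjunct says that the coordinates in this basis
  separate vectors.\<close>

lemma orthogonal_expansion:
  assumes nz: "\<And>i. i \<in> {3..<n} \<Longrightarrow> \<delta> i \<noteq> 0" and nz': "\<And>i. i \<in> {3..<n} \<Longrightarrow> B (f i) (f i) \<noteq> 0"
    and m: "3 \<le> m" "m \<le> n" and a: "supp m a" "ell a = 0"
  shows "B a a = (\<Sum>i=3..<m. (B (f i) a)\<^sup>2 / B (f i) (f i)) \<and>
    ((\<forall>i\<in>{3..<m}. B (f i) a = 0) \<longrightarrow> (\<forall>k\<ge>1. a k = 0))"
  using m a
proof (induction m arbitrary: a rule: nat_induct_at_least)
  case base
  have 0: "a k = 0" if "k \<ge> 1" for k using base_case[OF base(2,3) that] .
  then have "B a a = 0" unfolding B_def E_def by (intro sum.neutral) auto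
  then show ?case using 0 by simp
next
  case (Suc m)
  have mm: "m \<in> {2..n}" "m \<in> {3..<n}" using Suc by auto
  have fm: "f m m \<noteq> 0" using f_i_i[OF mm(1)] nz[OF mm(2)] diagonal[OF mm(1)] by simp
  \<comment> \<open>Chosen to make the coordinate \<open>m\<close> of \<open>a'\<close> vanish;
    \<open>f m m\<close> is nonzero because \<open>\<delta> m\<close> is.\<close>
  define \<kappa> where "\<kappa> = a m / f m m"
  define a' where "a' = (\<lambda>k. 1 * a k + (- \<kappa>) * f m k)"
  have supp': "supp m a'"
    using Suc.prems(2) f_supp[OF mm(1)] fm
    by (auto simp: supp_def a'_def \<kappa>_def le_eq_less_or_eq[of m])
  have ell0: "ell a' = 0" using Suc.prems(3) ell_f[OF mm(1)] by (simp only: a'_def ell_comb)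
  have a: "a = (\<lambda>k. 1 * a' k + \<kappa> * f m k)" by (simp add: a'_def)
  have fa': "B (f m) a' = 0" using B_f_eq_0[OF mm(1) supp' ell0] .
  then have a'f: "B a' (f m) = 0" by (simp add: B_comm)
  have Bm: "B (f m) a = \<kappa> * B (f m) (f m)"
    by (subst a, simp only: B_comb2 fa')
  have Bi: "B (f i) a = B (f i) a'" if "i \<in> {3..<m}" for i
  proof -
    have "supp m (f i)" using f_supp[of i] that mm by (auto simp: supp_def)
    then have "B (f m) (f i) = 0" using B_f_eq_0[OF mm(1)] ell_f[of i] that mm by auto
    then have "B (f i) (f m) = 0" by (simp add: B_comm)
    then show ?thesis by (subst a, simp only: B_comb2)
  qed
  have "B a a = B a' a' + \<kappa> * \<kappa> * B (f m) (f m)"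
    by (subst (1 2) a, simp only: B_comb2 B_comb fa' a'f) simp
  also have "\<kappa> * \<kappa> * B (f m) (f m) = (B (f m) a)\<^sup>2 / B (f m) (f m)"
    using nz'[OF mm(2)] by (simp add: Bm power2_eq_square)
  finally have B: "B a a = B a' a' + (B (f m) a)\<^sup>2 / B (f m) (f m)" .
  have IH: "B a' a' = (\<Sum>i=3..<m. (B (f i) a')\<^sup>2 / B (f i) (f i))"
    "(\<forall>i\<in>{3..<m}. B (f i) a' = 0) \<Longrightarrow> (\<forall>k\<ge>1. a' k = 0)"
    using Suc.IH[OF _ supp' ell0] Suc.prems by auto
  have "\<forall>k\<ge>1. a k = 0" if "\<forall>i\<in>{3..<Suc m}. B (f i) a = 0"
  proof -
    have "\<kappa> = 0" using that Bm nz'[OF mm(2)] Suc.hyps by auto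
    moreover have "\<forall>k\<ge>1. a' k = 0" using IH(2) that Bi by auto
    ultimately show ?thesis by (simp add: a'_def)
  qed
  then show ?case using B IH(1) Bi Suc.hyps by simp
qed

text \<open>If \<open>y n\<close> were zero, \<open>ell\<close> would vanish on the unit vector at
  2, against the rigidity of the triangle. In the degenerate case \<open>y n\<close> is the kernel
  vector.\<close>

lemma y_nonzero: "\<exists>k\<in>{2..<n}. y n k \<noteq> 0"
proof (rule ccontr)
  assume no: "\<not> ?thesis"
  have nn: "n \<in> {2..n}" using n_ge_3 by auto
  have 0: "y n k = 0" if "k \<ge> 1" for k
  proof -
    have "k = 1 \<or> k \<in> {2..<n} \<or> k \<ge> n" using that by auto
    then show ?thesis using no y_supp[OF nn] by (auto simp: supp_def)
  qed
  define e where "e = (\<lambda>k::nat. if k = 2 then 1 else 0 :: real)"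
  have e: "supp n e" "supp 3 e" using n_ge_3 by (auto simp: supp_def e_def)
  have "B (y n) e = 0" unfolding B_def E_def by (intro sum.neutral) (auto simp: 0)
  then have "ell e = 0" using B_y[OF nn e(1)] by simp
  then show False using base_case[OF e(2), of 2] by (simp add: e_def)
qed

end

section \<open>Variations of an inscribed polygon\<close>

lemma inner_rot90: "inner (rot90 p) (rot90 r) = inner p r" "inner (rot90 p) r = cross2 p r"
  "inner p (rot90 r) = - cross2 p r" "cross2 (rot90 p) (rot90 r) = cross2 p r"
  "cross2 (rot90 p) r = - inner p r" "cross2 p (rot90 r) = inner p r"
  by (simp_all add: plane_defs)

lemma cross2_linear:
  "cross2 (a + b) c = cross2 a c + cross2 b c" "cross2 c (a + b) = cross2 c a + cross2 c b"
  "cross2 (a - b) c = cross2 a c - cross2 b c" "cross2 c (a - b) = cross2 c a - cross2 c b"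
  "cross2 (k *\<^sub>R a) c = k * cross2 a c" "cross2 c (k *\<^sub>R a) = k * cross2 c a"
  by (simp_all add: plane_defs algebra_simps)

lemma inner_linear:
  "inner (a + b) c = inner a c + inner b c" "inner c (a + b) = inner c a + inner c b"
  "inner (a - b) c = inner a c - inner b c" "inner c (a - b) = inner c a - inner c b"
  "inner (k *\<^sub>R a) c = k * inner a c" "inner c (k *\<^sub>R a) = k * inner c a"
  for a b c :: "real \<times> real"
  by (simp_all add: inner_simps)

lemma half_tan_nz:
  assumes "inner p p = \<rho>" "inner r r = \<rho>" "cross2 p r \<noteq> 0"
  shows "half_tan \<rho> p r \<noteq> 0"
  using assms denominator_pos[OF assms] by (simp add: half_tan_def)

lemma frame_expansion:
  assumes "inner p p = \<rho>" "\<rho> \<noteq> 0"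
  shows "v = (inner v p / \<rho>) *\<^sub>R p + (inner v (rot90 p) / \<rho>) *\<^sub>R rot90 p"
proof -
  have "inner p p *\<^sub>R v = inner v p *\<^sub>R p + inner v (rot90 p) *\<^sub>R rot90 p"
    by (simp add: plane_defs prod_eq_iff algebra_simps)
  then have "(1 / \<rho>) *\<^sub>R (\<rho> *\<^sub>R v) = (1 / \<rho>) *\<^sub>R (inner v p *\<^sub>R p + inner v (rot90 p) *\<^sub>R rot90 p)"
    using assms by metis
  then show ?thesis using assms(2) by (simp add: scaleR_add_right)
qed

lemma half_tan_cos_sin:
  assumes "inner p p = \<rho>" "inner r r = \<rho>" "cross2 p r \<noteq> 0"
  defines "t \<equiv> half_tan \<rho> p r"
  shows "inner p r = \<rho> * ((1 - t\<^sup>2) / (1 + t\<^sup>2))" "cross2 p r = \<rho> * (2 * t / (1 + t\<^sup>2))"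
proof -
  note pos = denominator_pos[OF assms(1-3)]
  have "(inner p r)\<^sup>2 + (cross2 p r)\<^sup>2 = inner p p * inner r r"
    by (simp add: plane_defs power2_eq_square algebra_simps)
  then have "(cross2 p r)\<^sup>2 = (\<rho> - inner p r) * (\<rho> + inner p r)"
    using assms(1,2) by (simp add: algebra_simps power2_eq_square)
  moreover have tc: "t * (\<rho> + inner p r) = cross2 p r" using pos by (simp add: t_def half_tan_def)
  ultimately have "(t\<^sup>2 * (\<rho> + inner p r)) * (\<rho> + inner p r) = (\<rho> - inner p r) * (\<rho> + inner p r)"
    by (metis (no_types, lifting) power_mult_distrib power2_eq_square mult.assoc mult.commute)
  then have e: "t\<^sup>2 * (\<rho> + inner p r) = \<rho> - inner p r" using pos by simp
  have p1: "1 + t\<^sup>2 > 0" by (simp add: add_pos_nonneg)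
  have "inner p r * (1 + t\<^sup>2) = \<rho> * (1 - t\<^sup>2)" using e by (simp add: algebra_simps)
  then show c: "inner p r = \<rho> * ((1 - t\<^sup>2) / (1 + t\<^sup>2))" using p1 by (simp add: field_simps)
  have "(\<rho> + inner p r) * (1 + t\<^sup>2) = 2 * \<rho>" using e by (simp add: algebra_simps)
  then have "cross2 p r * (1 + t\<^sup>2) = 2 * \<rho> * t" unfolding tc[symmetric] by (simp only: mult.assoc) (simp add: mult_ac)
  then show "cross2 p r = \<rho> * (2 * t / (1 + t\<^sup>2))" using p1 by (simp add: field_simps)
qed

text \<open>The chord \<open>r - p\<close> equals \<open>half_tan \<rho> p r\<close> times
  \<open>rot90 p + rot90 r\<close>. As the tangent is nonzero, preserving the length to first order
  is a linear equation that can be solved for the tangential increment.\<close>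

lemma edge_constraint:
  assumes pr: "inner p p = \<rho>" "inner r r = \<rho>" "cross2 p r \<noteq> 0" and \<rho>: "\<rho> \<noteq> 0"
    and c: "inner (v' - v) (r - p) = 0"
  shows "inner v' (rot90 r) / \<rho> - inner v (rot90 p) / \<rho>
    = - half_tan \<rho> p r * (inner v p / \<rho> + inner v' r / \<rho>)"
proof -
  note pos = denominator_pos[OF pr]
  define a b a' b' where "a = inner v p / \<rho>" "b = inner v (rot90 p) / \<rho>"
    "a' = inner v' r / \<rho>" "b' = inner v' (rot90 r) / \<rho>"
  note ab = a_b_a'_b'_def
  have v: "v = a *\<^sub>R p + b *\<^sub>R rot90 p" using frame_expansion[OF pr(1) \<rho>, of v] by (simp add: ab)
  have v': "v' = a' *\<^sub>R r + b' *\<^sub>R rot90 r" using frame_expansion[OF pr(2) \<rho>, of v'] by (simp add: ab)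
  have "inner (v' - v) (r - p) = half_tan \<rho> p r * (inner (v' - v) (rot90 p) + inner (v' - v) (rot90 r))"
    using inner_half_tan_rot(2)[OF pr, of "v' - v"] by (simp add: inner_diff_right)
  then have "inner (v' - v) (rot90 p) + inner (v' - v) (rot90 r) = 0"
    using c half_tan_nz[OF pr] by simp
  moreover have "inner (v' - v) (rot90 p) + inner (v' - v) (rot90 r)
    = (b' - b) * (\<rho> + inner p r) + (a + a') * cross2 p r"
    unfolding v v' by (simp add: inner_linear inner_rot90 pr cross2_linear inner_commute[of r p] cross2_swap[of r p] algebra_simps)
       (simp add: cross2_def)
  ultimately have "b' - b = - (a + a') * cross2 p r / (\<rho> + inner p r)" using pos by (simp add: field_simps)
  also have "\<dots> = - half_tan \<rho> p r * (a + a')" by (simp add: half_tan_def algebra_simps add_divide_distrib diff_divide_distrib)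
  finally show ?thesis by (simp add: ab)
qed

lemma frame_inner:
  "inner (a *\<^sub>R p + b *\<^sub>R rot90 p) (c *\<^sub>R r + d *\<^sub>R rot90 r)
    = (a * c + b * d) * inner p r + (b * c - a * d) * cross2 p r"
  by (simp add: plane_defs algebra_simps)

lemma frame_cross2:
  "cross2 (a *\<^sub>R p + b *\<^sub>R rot90 p) (c *\<^sub>R r + d *\<^sub>R rot90 r)
    = (a * c + b * d) * cross2 p r + (a * d - b * c) * inner p r"
  by (simp add: plane_defs algebra_simps)

text \<open>In the frames at \<open>p\<close> and \<open>r\<close> the tangential components are
  eliminated by the length constraint. The result is the edge term in the radial components and a
  difference of end terms, which telescopes around the polygon.\<close>

lemma edge_second_variation:
  assumes pr: "inner p p = \<rho>" "inner r r = \<rho>" "cross2 p r \<noteq> 0" and \<rho>: "\<rho> \<noteq> 0"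
    and c1: "inner (v' - v) (r - p) = 0" and c2: "inner (w' - w) (r - p) = 0"
  defines "t \<equiv> half_tan \<rho> p r"
  defines "a \<equiv> inner v p / \<rho>" and "a' \<equiv> inner v' r / \<rho>" and "d \<equiv> inner w p / \<rho>" and "d' \<equiv> inner w' r / \<rho>"
  shows "cross2 v w' + cross2 w v' - (1 / t) * inner (v' - v) (w' - w)
    = \<rho> * (t * (a + a') * (d + d') - (1 / t) * (a' - a) * (d' - d))
      + (inner v' r * inner w' (rot90 r) + inner w' r * inner v' (rot90 r)
      - inner v p * inner w (rot90 p) - inner w p * inner v (rot90 p)) / \<rho>"
proof -
  define b b' e e' where "b = inner v (rot90 p) / \<rho>" "b' = inner v' (rot90 r) / \<rho>"
    "e = inner w (rot90 p) / \<rho>" "e' = inner w' (rot90 r) / \<rho>"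
  note bd = b_b'_e_e'_def
  have v: "v = a *\<^sub>R p + b *\<^sub>R rot90 p" using frame_expansion[OF pr(1) \<rho>, of v] by (simp add: bd a_def)
  have v': "v' = a' *\<^sub>R r + b' *\<^sub>R rot90 r" using frame_expansion[OF pr(2) \<rho>, of v'] by (simp add: bd a'_def)
  have w: "w = d *\<^sub>R p + e *\<^sub>R rot90 p" using frame_expansion[OF pr(1) \<rho>, of w] by (simp add: bd d_def)
  have w': "w' = d' *\<^sub>R r + e' *\<^sub>R rot90 r" using frame_expansion[OF pr(2) \<rho>, of w'] by (simp add: bd d'_def)
  have b': "b' = b - t * (a + a')" and e': "e' = e - t * (d + d')"
    using edge_constraint[OF pr \<rho> c1] edge_constraint[OF pr \<rho> c2] by (simp_all add: bd a_def a'_def d_def d'_def t_def)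
  define C S where "C = (1 - t\<^sup>2) / (1 + t\<^sup>2)" "S = 2 * t / (1 + t\<^sup>2)"
  have CS: "inner p r = \<rho> * C" "cross2 p r = \<rho> * S"
    using half_tan_cos_sin[OF pr] by (simp_all add: C_S_def t_def)
  \<comment> \<open>\<open>X\<close> and \<open>Y\<close> collect the coefficients of products
    between the frames at different ends, \<open>K\<close> those within one frame.\<close>
  define X Y K where "X = a * d' + b * e' + d * a' + e * b'" "Y = a * e' - b * d' + d * b' - e * a'"
    "K = a' * d' + b' * e' + a * d + b * e"
  note XYK = X_Y_K_def
  have x1: "cross2 v w' + cross2 w v' = \<rho> * (X * S + Y * C)"
    unfolding v w' w v' frame_cross2 CS XYK by (simp add: algebra_simps)
  have "inner (v' - v) (w' - w) = inner v' w' + inner v w - inner v w' - inner w v'"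
    by (simp add: inner_linear inner_commute)
  also have "\<dots> = \<rho> * (K - X * C + Y * S)"
    unfolding v w' w v' frame_inner CS XYK pr by (simp add: cross2_def algebra_simps)
  finally have x2: "inner (v' - v) (w' - w) = \<rho> * (K - X * C + Y * S)" .
  have tn: "t \<noteq> 0" using half_tan_nz[OF pr] by (simp add: t_def)
  have p1: "1 + t\<^sup>2 \<noteq> 0" using zero_le_power2[of t] by linarith
  \<comment> \<open>With \<open>C\<close> and \<open>S\<close> the cosine and sine of the full
    angle, these half-angle identities remove the angle from the result except through
    \<open>t\<close>.\<close>
  have C1: "S + C / t = 1 / t" "C - S / t = - 1"
  proof -
    have m: "(1 + t\<^sup>2) * S = 2 * t" "(1 + t\<^sup>2) * C = 1 - t\<^sup>2" using p1 by (simp_all add: C_S_def)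
    have "(1 + t\<^sup>2) * (S * t + C) = ((1 + t\<^sup>2) * S) * t + (1 + t\<^sup>2) * C" by (simp add: algebra_simps)
    also have "\<dots> = (1 + t\<^sup>2) * 1" unfolding m by (simp add: power2_eq_square)
    finally have 1: "S * t + C = 1" using p1 mult_left_cancel by blast
    have "(1 + t\<^sup>2) * (C * t - S) = ((1 + t\<^sup>2) * C) * t - (1 + t\<^sup>2) * S" by (simp add: algebra_simps)
    also have "\<dots> = (1 + t\<^sup>2) * (- t)" unfolding m by (simp add: algebra_simps)
    finally have 2: "C * t - S = - t" using p1 mult_left_cancel by blast
    have "S + C / t = (S * t + C) / t" "C - S / t = (C * t - S) / t"
      using tn by (simp_all add: add_divide_distrib diff_divide_distrib)
    then show "S + C / t = 1 / t" "C - S / t = - 1" using tn by (simp_all only: 1 2) simp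
  qed
  have "X * S + Y * C - (1 / t) * (K - X * C + Y * S) = X * (S + C / t) + Y * (C - S / t) - K / t"
    by (simp add: algebra_simps add_divide_distrib diff_divide_distrib)
  also have "\<dots> = (X - K) / t - Y" unfolding C1 by (simp add: diff_divide_distrib)
  also have "X - K = - (a' - a) * (d' - d) - t * (t * (a + a') * (d + d'))"
    unfolding XYK b' e' by (simp add: algebra_simps)
  also have "(- (a' - a) * (d' - d) - t * (t * (a + a') * (d + d'))) / t
      = - (1 / t) * (a' - a) * (d' - d) - t * (a + a') * (d + d')"
    using tn by (simp add: algebra_simps add_divide_distrib diff_divide_distrib)
  also have "\<dots> - Y = t * (a + a') * (d + d') - (1 / t) * (a' - a) * (d' - d) + (a' * e' + d' * b' - a * e - d * b)"
    unfolding XYK b' e' by (simp add: algebra_simps)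
  finally have h: "X * S + Y * C - (1 / t) * (K - X * C + Y * S)
      = t * (a + a') * (d + d') - (1 / t) * (a' - a) * (d' - d) + (a' * e' + d' * b' - a * e - d * b)" .
  have "\<rho> * (X * S + Y * C) - (1 / t) * (\<rho> * (K - X * C + Y * S))
      = \<rho> * (X * S + Y * C - (1 / t) * (K - X * C + Y * S))"
    by (simp add: algebra_simps)
  also have "\<dots> = \<rho> * (t * (a + a') * (d + d') - (1 / t) * (a' - a) * (d' - d)) + \<rho> * (a' * e' + d' * b' - a * e - d * b)"
    unfolding h by (simp only: distrib_left)
  finally have "\<rho> * (X * S + Y * C) - (1 / t) * (\<rho> * (K - X * C + Y * S))
      = \<rho> * (t * (a + a') * (d + d') - (1 / t) * (a' - a) * (d' - d)) + \<rho> * (a' * e' + d' * b' - a * e - d * b)" .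
  moreover have "\<rho> * (a' * e' + d' * b' - a * e - d * b)
      = (inner v' r * inner w' (rot90 r) + inner w' r * inner v' (rot90 r)
      - inner v p * inner w (rot90 p) - inner w p * inner v (rot90 p)) / \<rho>"
    using \<rho> by (simp add: bd a_def a'_def d_def d'_def field_simps)
  ultimately show ?thesis unfolding x1 x2 by simp
qed

text \<open>This exhibits \<open>1 / half_tan \<rho> p r\<close> as the Lagrange multiplier of the
  edge; the remaining difference of end terms telescopes.\<close>

lemma edge_first_variation:
  assumes pr: "inner p p = \<rho>" "inner r r = \<rho>" "cross2 p r \<noteq> 0"
  shows "cross2 v r + cross2 p v' = (1 / half_tan \<rho> p r) * inner (r - p) (v' - v) - (cross2 r v' - cross2 p v)"
proof -
  define t where "t = half_tan \<rho> p r"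
  have tn: "t \<noteq> 0" using half_tan_nz[OF pr] by (simp add: t_def)
  have "cross2 (p + r) (v' - v) = (1 / t) * inner (r - p) (v' - v)"
  proof -
    have "t * inner (rot90 (v' - v)) (p + r) = inner (rot90 (v' - v)) (rot90 p) - inner (rot90 (v' - v)) (rot90 r)"
      using inner_half_tan_rot(1)[OF pr, of "rot90 (v' - v)"] by (simp add: t_def inner_add_right)
    then have "t * cross2 (p + r) (v' - v) = inner (r - p) (v' - v)"
      by (simp add: inner_rot90 inner_linear cross2_swap[of "v' - v"] inner_commute)
    then show ?thesis using tn by (simp add: field_simps)
  qed
  then show ?thesis
    unfolding t_def[symmetric] by (simp add: cross2_def algebra_simps)
qed

lemma sum_nxt_split:
  assumes "n \<ge> 1"
  shows "(\<Sum>k=1..n. h k (nxt n k)) = (\<Sum>k=1..<n. h k (k + 1)) + (h n 1 :: real)"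
proof -
  have "{1..n} = insert n {1..<n}" using assms by auto
  then have "(\<Sum>k=1..n. h k (nxt n k)) = h n (nxt n n) + (\<Sum>k=1..<n. h k (nxt n k))" by simp
  also have "(\<Sum>k=1..<n. h k (nxt n k)) = (\<Sum>k=1..<n. h k (k + 1))"
    by (intro sum.cong refl) (auto simp: nxt_def)
  finally show ?thesis by (simp add: nxt_def)
qed

lemma sum_nxt_telescope:
  assumes "n \<ge> 1"
  shows "(\<Sum>k=1..n. g (nxt n k) - g k) = (0 :: real)"
proof -
  have "(\<Sum>k=1..<m. g (k + 1) - g k) = g m - g 1" if "m \<ge> 1" for m
    using that by (induction m rule: nat_induct_at_least) auto
  then show ?thesis
    using sum_nxt_split[OF assms, of "\<lambda>k j. g j - g k"] assms by simp
qed

section \<open>Radial coordinates of length-preserving variations\<close>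

context inscribed_polygon
begin

definition T :: "nat \<Rightarrow> real" where
  "T k = half_tan \<rho> (q k) (q (nxt n k))"

definition admissible :: "(nat \<Rightarrow> real \<times> real) \<Rightarrow> bool" where
  "admissible v \<longleftrightarrow> v 1 = 0 \<and> (\<forall>k\<in>{1..n}. inner (v (nxt n k) - v k) (q (nxt n k) - q k) = 0)"

text \<open>The polarized second derivative of the area minus the sum of the squared edge lengths
  divided by \<open>4 * T k\<close>.\<close>

definition second_variation :: "(nat \<Rightarrow> real \<times> real) \<Rightarrow> (nat \<Rightarrow> real \<times> real) \<Rightarrow> real" where
  "second_variation v w = 1/2 * (\<Sum>k=1..n. cross2 (v k) (w (nxt n k)) + cross2 (w k) (v (nxt n k))
     - (1 / T k) * inner (v (nxt n k) - v k) (w (nxt n k) - w k))"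

text \<open>The radial components of the variation after a translation orthogonal to \<open>q 1\<close>, chosen
  so that the radial component at \<open>q n\<close> vanishes.\<close>

definition shift :: "(nat \<Rightarrow> real \<times> real) \<Rightarrow> real \<times> real" where
  "shift v = (inner (v n) (q n) / cross2 (q 1) (q n)) *\<^sub>R rot90 (q 1)"

definition radial :: "(nat \<Rightarrow> real \<times> real) \<Rightarrow> nat \<Rightarrow> real" where
  "radial v k = (if k \<in> {1..n} then inner (v k - shift v) (q k) / \<rho> else 0)"

lemma \<rho>_nz: "\<rho> \<noteq> 0"
  using on_circle[of 1] diagonal[of 2] n_ge_3 by (auto simp: cross2_def)

lemma nxt_in: "k \<in> {1..n} \<Longrightarrow> nxt n k \<in> {1..n}"
  by (auto simp: nxt_def)

lemma edge_nxt: "k \<in> {1..n} \<Longrightarrow> cross2 (q k) (q (nxt n k)) \<noteq> 0"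
  using edge[of k] closing[of n] n_ge_3 by (auto simp: nxt_def)

lemma edge_facts:
  assumes "k \<in> {1..n}"
  shows "inner (q k) (q k) = \<rho>" "inner (q (nxt n k)) (q (nxt n k)) = \<rho>" "cross2 (q k) (q (nxt n k)) \<noteq> 0"
  using assms on_circle nxt_in edge_nxt by auto

lemma T_eq: "k \<in> {1..<n} \<Longrightarrow> T k = t k"
  by (auto simp: T_def t_def nxt_def)

lemma first_variation:
  "(\<Sum>k=1..n. cross2 (v k) (q (nxt n k)) + cross2 (q k) (v (nxt n k)))
    = (\<Sum>k=1..n. (1 / T k) * inner (q (nxt n k) - q k) (v (nxt n k) - v k))"
proof -
  have "(\<Sum>k=1..n. cross2 (v k) (q (nxt n k)) + cross2 (q k) (v (nxt n k)))
    = (\<Sum>k=1..n. (1 / T k) * inner (q (nxt n k) - q k) (v (nxt n k) - v k)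
        - (cross2 (q (nxt n k)) (v (nxt n k)) - cross2 (q k) (v k)))"
    unfolding T_def by (intro sum.cong refl edge_first_variation edge_facts)
  also have "\<dots> = (\<Sum>k=1..n. (1 / T k) * inner (q (nxt n k) - q k) (v (nxt n k) - v k))
    - (\<Sum>k=1..n. cross2 (q (nxt n k)) (v (nxt n k)) - cross2 (q k) (v k))"
    by (rule sum_subtractf)
  also have "(\<Sum>k=1..n. cross2 (q (nxt n k)) (v (nxt n k)) - cross2 (q k) (v k)) = 0"
    using n_ge_3 by (intro sum_nxt_telescope[of n "\<lambda>k. cross2 (q k) (v k)"]) simp
  finally show ?thesis by simp
qed

text \<open>Edge differences do not see translations, the mixed cross products telescope, and the
  constant ones cancel by antisymmetry. This licenses the normalization by
  \<open>shift\<close>.\<close>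

lemma second_variation_translate:
  "second_variation (\<lambda>k. v k - x0) (\<lambda>k. w k - y0) = second_variation v w"
proof -
  let ?g = "\<lambda>k. cross2 x0 (w k) + cross2 y0 (v k)"
  have "second_variation (\<lambda>k. v k - x0) (\<lambda>k. w k - y0) = 1/2 * (\<Sum>k=1..n. (cross2 (v k) (w (nxt n k)) + cross2 (w k) (v (nxt n k))
     - (1 / T k) * inner (v (nxt n k) - v k) (w (nxt n k) - w k)) - (?g (nxt n k) - ?g k))"
    unfolding second_variation_def
    by (intro arg_cong[where f = "(*) (1/2)"] sum.cong refl)
      (simp add: cross2_linear cross2_swap[of y0 x0] cross2_swap[of "v _" y0] cross2_swap[of "w _" x0])
  also have "\<dots> = second_variation v w - 1/2 * (\<Sum>k=1..n. ?g (nxt n k) - ?g k)"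
    unfolding second_variation_def sum_subtractf by (simp add: algebra_simps)
  also have "(\<Sum>k=1..n. ?g (nxt n k) - ?g k) = 0"
    using n_ge_3 by (intro sum_nxt_telescope) simp
  finally show ?thesis by simp
qed

lemma radial_1: "v 1 = 0 \<Longrightarrow> radial v 1 = 0"
  using n_ge_3 by (simp add: radial_def shift_def inner_linear inner_rot90) (simp add: cross2_def)

lemma radial_n: "radial v n = 0"
  using n_ge_3 diagonal[of n] by (simp add: radial_def shift_def inner_linear inner_rot90)

lemma radial_supp: "admissible v \<Longrightarrow> supp n (radial v)"
  using radial_1[of v] radial_n[of v] by (auto simp: supp_def admissible_def radial_def le_less)

lemma admissible_shift:
  "admissible v \<Longrightarrow> k \<in> {1..n} \<Longrightarrow>
    inner ((v (nxt n k) - shift v) - (v k - shift v)) (q (nxt n k) - q k) = 0"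
  by (simp add: admissible_def)

text \<open>Summing the edge identity around the polygon removes the end terms. After the shift the
  radial components vanish at both ends of the closing edge, so \<open>B\<close> can omit that
  edge.\<close>

theorem second_variation_eq:
  assumes v: "admissible v" and w: "admissible w"
  shows "second_variation v w = \<rho> / 2 * B (radial v) (radial w)"
proof -
  define v' where "v' = (\<lambda>k. v k - shift v)"
  define w' where "w' = (\<lambda>k. w k - shift w)"
  let ?a = "radial v" and ?d = "radial w"
  let ?g = "\<lambda>k. inner (v' k) (q k) * inner (w' k) (rot90 (q k)) + inner (w' k) (q k) * inner (v' k) (rot90 (q k))"
  let ?E = "\<lambda>k j. T k * (?a k + ?a j) * (?d k + ?d j) - (1 / T k) * (?a j - ?a k) * (?d j - ?d k)"
  have step: "cross2 (v' k) (w' (nxt n k)) + cross2 (w' k) (v' (nxt n k))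
     - (1 / T k) * inner (v' (nxt n k) - v' k) (w' (nxt n k) - w' k)
     = \<rho> * ?E k (nxt n k) + (1 / \<rho>) * (?g (nxt n k) - ?g k)" if k: "k \<in> {1..n}" for k
  proof -
    have r: "inner (v' k) (q k) / \<rho> = ?a k" "inner (v' (nxt n k)) (q (nxt n k)) / \<rho> = ?a (nxt n k)"
      "inner (w' k) (q k) / \<rho> = ?d k" "inner (w' (nxt n k)) (q (nxt n k)) / \<rho> = ?d (nxt n k)"
      using k nxt_in[OF k] by (simp_all only: radial_def v'_def w'_def if_True)
    have ad: "inner (v' (nxt n k) - v' k) (q (nxt n k) - q k) = 0"
      "inner (w' (nxt n k) - w' k) (q (nxt n k) - q k) = 0"
      unfolding v'_def w'_def by (rule admissible_shift[OF v k], rule admissible_shift[OF w k])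
    have "(X + Y - Z - W) / \<rho> = (1 / \<rho>) * ((X + Y) - (Z + W))" for X Y Z W
      by (simp add: diff_diff_add)
    then show ?thesis
      using edge_second_variation[OF edge_facts[OF k] \<rho>_nz ad, folded T_def, unfolded r] by (simp only:)
  qed
  have "second_variation v w = second_variation v' w'"
    unfolding v'_def w'_def by (rule second_variation_translate[symmetric])
  also have "\<dots> = 1/2 * (\<Sum>k=1..n. \<rho> * ?E k (nxt n k) + (1 / \<rho>) * (?g (nxt n k) - ?g k))"
    unfolding second_variation_def by (intro arg_cong[where f = "(*) (1/2)"] sum.cong refl step)
  also have "\<dots> = 1/2 * (\<rho> * (\<Sum>k=1..n. ?E k (nxt n k)) + (1 / \<rho>) * (\<Sum>k=1..n. ?g (nxt n k) - ?g k))"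
    by (simp only: sum.distrib sum_distrib_left)
  also have "(\<Sum>k=1..n. ?g (nxt n k) - ?g k) = 0"
    using n_ge_3 by (intro sum_nxt_telescope) simp
  also have "(\<Sum>k=1..n. ?E k (nxt n k)) = (\<Sum>k=1..<n. ?E k (k + 1)) + ?E n 1"
    using n_ge_3 by (intro sum_nxt_split) simp
  also have "?E n 1 = 0"
    using radial_1[of v] radial_1[of w] v w unfolding radial_n by (simp add: admissible_def)
  also have "(\<Sum>k=1..<n. ?E k (k + 1)) = B ?a ?d"
    unfolding B_def E_def by (intro sum.cong refl) (simp add: T_eq)
  finally show ?thesis by simp
qed

lemma tangential_step:
  assumes v: "admissible v" and k: "k \<in> {1..n}"
  shows "inner (v (nxt n k) - shift v) (rot90 (q (nxt n k))) / \<rho> - inner (v k - shift v) (rot90 (q k)) / \<rho>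
    = - T k * (radial v k + radial v (nxt n k))"
  using edge_constraint[OF edge_facts[OF k] \<rho>_nz admissible_shift[OF v k]] k nxt_in[OF k]
  by (simp add: radial_def T_def)

text \<open>The tangential component returns to its initial value after one turn around the
  polygon.\<close>

lemma ell_radial:
  assumes v: "admissible v"
  shows "ell (radial v) = 0"
proof -
  let ?b = "\<lambda>k. inner (v k - shift v) (rot90 (q k)) / \<rho>"
  have "0 = (\<Sum>k=1..n. ?b (nxt n k) - ?b k)"
    using n_ge_3 by (intro sum_nxt_telescope[symmetric]) simp
  also have "\<dots> = (\<Sum>k=1..n. - T k * (radial v k + radial v (nxt n k)))"
    by (intro sum.cong refl tangential_step[OF v])
  also have "\<dots> = (\<Sum>k=1..<n. - T k * (radial v k + radial v (k + 1))) + - T n * (radial v n + radial v 1)"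
    using n_ge_3 by (intro sum_nxt_split[of n "\<lambda>k j. - T k * (radial v k + radial v j)"]) simp
  also have "- T n * (radial v n + radial v 1) = 0"
    using radial_1[of v] v unfolding radial_n by (simp add: admissible_def)
  also have "(\<Sum>k=1..<n. - T k * (radial v k + radial v (k + 1))) = - ell (radial v)"
    unfolding ell_def sum_negf[symmetric] by (intro sum.cong refl) (simp add: T_eq)
  finally show ?thesis by simp
qed

text \<open>Without radial components the tangential ones are constant, so the shifted variation is
  a rotation about the center; fixing the vertices 1 and 2 leaves only zero.\<close>

lemma radial_injective:
  assumes v: "admissible v" and v2: "v 2 = 0" and 0: "\<And>k. k \<ge> 1 \<Longrightarrow> radial v k = 0" and k: "k \<in> {1..n}"
  shows "v k = 0"
proof -
  define b where "b = (\<lambda>k. inner (v k - shift v) (rot90 (q k)) / \<rho>)"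
  have step: "b (k + 1) = b k" if "k \<in> {1..<n}" for k
    using tangential_step[OF v, of k] that 0[of k] 0[of "k + 1"] by (auto simp: nxt_def b_def)
  have b_const: "b k = b 1" if "1 \<le> k" "k \<le> n" for k
    using that
  proof (induction k rule: nat_induct_at_least)
    case (Suc k)
    then show ?case using step[of k] by simp
  qed simp
  have exp: "v k - shift v = b 1 *\<^sub>R rot90 (q k)" if "k \<in> {1..n}" for k
  proof -
    have z: "inner (v k - shift v) (q k) / \<rho> = 0" using 0[of k] that by (simp add: radial_def)
    have bk: "b k = b 1" using b_const[of k] that by simp
    have "v k - shift v = (inner (v k - shift v) (q k) / \<rho>) *\<^sub>R q k + b k *\<^sub>R rot90 (q k)"
      unfolding b_def by (rule frame_expansion[OF on_circle[OF that] \<rho>_nz])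
    then show ?thesis unfolding z bk by simp
  qed
  have s: "shift v = - (b 1 *\<^sub>R rot90 (q 1))"
    using exp[of 1] v n_ge_3 by (simp add: admissible_def) (metis minus_minus)
  have "b 1 *\<^sub>R rot90 (q 1) = b 1 *\<^sub>R rot90 (q 2)"
    using exp[of 2] v2 n_ge_3 by (simp add: s)
  moreover have "rot90 (q 1) \<noteq> rot90 (q 2)"
    using diagonal[of 2] n_ge_3 by (auto simp: plane_defs)
  ultimately have "b 1 = 0" by simp
  then show ?thesis using exp[OF k] s by simp
qed

lemma radial_linear:
  assumes "finite J"
  shows "radial (\<lambda>k. \<Sum>j\<in>J. c j *\<^sub>R v j k) k = (\<Sum>j\<in>J. c j * radial (v j) k)"
proof -
  have "shift (\<lambda>k. \<Sum>j\<in>J. c j *\<^sub>R v j k) = (\<Sum>j\<in>J. c j *\<^sub>R shift (v j))"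
    by (simp add: shift_def inner_sum_left sum_divide_distrib scaleR_sum_left)
  then show ?thesis
    by (auto simp: radial_def inner_sum_left sum_subtractf[symmetric] sum_divide_distrib
        scaleR_diff_right[symmetric] inner_linear(5) simp flip: sum_subtractf intro!: sum.cong)
qed

lemma admissible_linear:
  assumes "\<And>j. j \<in> J \<Longrightarrow> admissible (v j)"
  shows "admissible (\<lambda>k. \<Sum>j\<in>J. c j *\<^sub>R v j k)"
  using assms
  by (auto simp: admissible_def inner_sum_left simp flip: sum_subtractf scaleR_diff_right)

end

section \<open>Signature of the second variation\<close>

context inscribed_polygon
begin

lemma \<rho>_pos: "\<rho> > 0"
  using on_circle[of 1] \<rho>_nz n_ge_3 by (metis atLeastAtMost_iff inner_ge_zero le_less le_trans one_le_numeral order_refl)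

lemma B_sum_left: "finite J \<Longrightarrow> B (\<lambda>k. \<Sum>j\<in>J. c j * a j k) b = (\<Sum>j\<in>J. c j * B (a j) b)"
proof (induction J rule: finite_induct)
  case empty
  then show ?case by (simp add: B_def E_def)
next
  case (insert i J)
  have "B (\<lambda>k. \<Sum>j\<in>insert i J. c j * a j k) b = B (\<lambda>k. c i * a i k + 1 * (\<Sum>j\<in>J. c j * a j k)) b"
    using insert by simp
  also have "\<dots> = c i * B (a i) b + 1 * B (\<lambda>k. \<Sum>j\<in>J. c j * a j k) b" by (rule B_comb)
  finally show ?case using insert by simp
qed

lemma B_sum_right: "finite J \<Longrightarrow> B b (\<lambda>k. \<Sum>j\<in>J. c j * a j k) = (\<Sum>j\<in>J. c j * B b (a j))"
  using B_sum_left[of J c a b] by (simp add: B_comm)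

context
  fixes v :: "nat \<Rightarrow> nat \<Rightarrow> real \<times> real" and S :: "real mat"
  assumes v: "\<And>j. j < n - 3 \<Longrightarrow> admissible (v j)" and v2: "\<And>j. j < n - 3 \<Longrightarrow> v j 2 = 0"
    and indep: "\<And>c. (\<forall>k\<in>{1..n}. (\<Sum>j<n - 3. c j *\<^sub>R v j k) = 0) \<Longrightarrow> \<forall>j<n - 3. c j = 0"
    and S: "S \<in> carrier_mat (n - 3) (n - 3)"
    and S_eq: "\<And>i j. i < n - 3 \<Longrightarrow> j < n - 3 \<Longrightarrow> S $$ (i, j) = second_variation (v i) (v j)"
begin

lemma S_B: "i < n - 3 \<Longrightarrow> j < n - 3 \<Longrightarrow> S $$ (i, j) = \<rho> / 2 * B (radial (v i)) (radial (v j))"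
  using S_eq second_variation_eq v by simp

text \<open>Independence of the variations passes to their radial parts because fixing vertex 2
  excludes rotations.\<close>

lemma comb_props:
  fixes c
  defines "a \<equiv> \<lambda>k. \<Sum>j<n - 3. c j * radial (v j) k"
  shows "supp n a" "ell a = 0" "(\<forall>k\<ge>1. a k = 0) \<Longrightarrow> \<forall>j<n - 3. c j = 0"
proof -
  let ?w = "\<lambda>k. \<Sum>j<n - 3. c j *\<^sub>R v j k"
  have w: "admissible ?w" by (rule admissible_linear) (use v in auto)
  have a: "radial ?w = a" by (auto simp: fun_eq_iff a_def radial_linear)
  show "supp n a" "ell a = 0" using radial_supp[OF w] ell_radial[OF w] by (simp_all add: a)
  have w2: "?w 2 = 0" using v2 by (intro sum.neutral) auto
  assume "\<forall>k\<ge>1. a k = 0"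
  then have "?w k = 0" if "k \<in> {1..n}" for k
    using radial_injective[OF w w2 _ that] by (simp add: a)
  then show "\<forall>j<n - 3. c j = 0" using indep by blast
qed

text \<open>When \<open>\<delta> n = 0\<close>, \<open>ell (y n) = 0\<close>, so \<open>y n\<close>
  lies in \<open>T\<^sub>n\<close> and is orthogonal to it. A dimension count writes a multiple of
  it through the radial parts of the \<open>v j\<close>, and the coefficients form a kernel vector
  of \<open>S\<close>.\<close>

lemma S_degenerate:
  assumes "\<delta> n = 0"
  shows "Determinant.det S = 0"
proof -
  let ?d = "n - 3"
  \<comment> \<open>The unknowns are \<open>n - 3\<close> coefficients and a factor for
    \<open>y n\<close>; the equations are the coordinates 3 to \<open>n - 1\<close>. The coordinate
    2 of the resulting combination then vanishes by the triangle case.\<close>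
  let ?L = "\<lambda>r i. if i < ?d then radial (v i) (r + 3) else - y n (r + 3)"
  have n2: "n \<in> {2..n}" using n_ge_3 by simp
  obtain c where c: "\<exists>i<Suc ?d. c i \<noteq> 0" "\<And>r. r \<in> {..<?d} \<Longrightarrow> (\<Sum>i<Suc ?d. ?L r i * c i) = 0"
    by (rule homogeneous_system_nontrivial_solution[of "{..<?d}" "Suc ?d" ?L], simp, simp, rule that)
  define l where "l = c ?d"
  define a where "a = (\<lambda>k. \<Sum>j<?d. c j * radial (v j) k)"
  note ap = comb_props[of c, folded a_def]
  define b where "b = (\<lambda>k. 1 * a k + (- l) * y n k)"
  have "b k = 0" if "k \<ge> 3" for k
  proof (cases "k \<ge> n")
    case True
    then show ?thesis using ap(1) y_supp[OF n2] by (simp add: b_def supp_def)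
  next
    case False
    then have "k - 3 \<in> {..<?d}" "k - 3 + 3 = k" using that by auto
    then have "(\<Sum>i<?d. radial (v i) k * c i) - y n k * c ?d = 0"
      using c(2)[of "k - 3"] by simp
    then show ?thesis by (simp add: b_def a_def l_def mult.commute)
  qed
  moreover have "b 1 = 0" using ap(1) y_supp[OF n2] by (simp add: b_def supp_def)
  ultimately have "supp 3 b" by (simp add: supp_def)
  moreover have "ell b = 0" unfolding b_def ell_comb using ap(2) ell_y[OF n2] assms by simp
  ultimately have "b k = 0" if "k \<ge> 1" for k using base_case that by blast
  then have ay: "a k = l * y n k" if "k \<ge> 1" for k using that by (simp add: b_def)
  \<comment> \<open>If all these coefficients were zero, \<open>l * y n\<close> would be zero, and
    then \<open>l\<close> as well, since \<open>y n\<close> is not.\<close>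
  have c0: "\<exists>i<?d. c i \<noteq> 0"
  proof (rule ccontr)
    assume no: "\<not> ?thesis"
    then have "a k = 0" for k by (auto simp: a_def intro!: sum.neutral)
    moreover obtain k where "k \<in> {2..<n}" "y n k \<noteq> 0" using y_nonzero by blast
    ultimately have "l = 0" using ay[of k] by simp
    then show False using no c(1) by (auto simp: l_def less_Suc_eq)
  qed
  have "S *\<^sub>v vec ?d c = 0\<^sub>v ?d"
  proof (rule eq_vecI)
    fix i assume "i < dim_vec (0\<^sub>v ?d :: real vec)"
    then have i: "i < ?d" by simp
    have vi: "admissible (v i)" using v i .
    have "(S *\<^sub>v vec ?d c) $ i = (\<Sum>j<?d. S $$ (i, j) * c j)"
      using i S by (auto simp: scalar_prod_def lessThan_atLeast0 intro!: sum.cong)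
    also have "\<dots> = (\<Sum>j<?d. \<rho> / 2 * (c j * B (radial (v i)) (radial (v j))))"
      by (intro sum.cong refl) (use i S_B in auto)
    also have "\<dots> = \<rho> / 2 * B (radial (v i)) a"
      unfolding a_def by (subst B_sum_right) (simp_all add: sum_distrib_left)
    also have "B (radial (v i)) a = B a (radial (v i))" by (rule B_comm)
    also have "\<dots> = B (\<lambda>k. l * y n k + 0 * y n k) (radial (v i))"
      by (rule B_cong) (use ay in simp)
    also have "\<dots> = 0"
      unfolding B_comb using B_y[OF n2 radial_supp[OF vi]] ell_radial[OF vi] by simp
    finally show "(S *\<^sub>v vec ?d c) $ i = 0\<^sub>v ?d $ i" using i by simp
  qed (use S in auto)
  moreover have "vec ?d c \<noteq> 0\<^sub>v ?d" using c0 by (metis index_vec index_zero_vec(1))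
  ultimately show ?thesis using det_0_iff_vec_prod_zero_field[OF S] by (metis vec_carrier)
qed

text \<open>The expansion in the adapted basis is a diagonal form of \<open>S\<close> whose
  coefficients have the signs \<open>H i * H (i + 1)\<close>: inertia counts the sign changes, and
  the determinant sign is a telescoping product.\<close>

theorem S_signature:
  assumes \<delta>: "\<And>i. i \<in> {3..n} \<Longrightarrow> \<delta> i \<noteq> 0"
  shows "num_neg_eigenvalues S = sign_changes H 3 n" and "sgn (Determinant.det S) = H n"
proof -
  let ?d = "n - 3"
  have Hnz: "H i \<noteq> 0" if "i \<in> {3..n}" for i
  proof -
    have "t k \<noteq> 0" if "k \<in> {1..<i}" for k using t_nz[of k] that \<open>i \<in> {3..n}\<close> by auto
    then show ?thesis using \<delta>[OF that] closing_nz[of i] that by (auto simp: H_def sgn_zero_iff)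
  qed
  have ff: "sgn (B (f i) (f i)) = H i * H (i + 1)" if "i \<in> {3..<n}" for i by (rule sgn_B_f_f[OF that])
  have ffnz: "B (f i) (f i) \<noteq> 0" if "i \<in> {3..<n}" for i
    using ff[OF that] Hnz[of i] Hnz[of "i + 1"] that by auto
  \<comment> \<open>The linear forms \<open>K\<close> are products with \<open>f\<close> that are
    not normalized, hence the reciprocal. The offset 3 matches coordinates counted from 0 with basis
    vectors counted from 3.\<close>
  define D where "D = (\<lambda>j. \<rho> / 2 / B (f (j + 3)) (f (j + 3)))"
  define K where "K = (\<lambda>j i. B (f (j + 3)) (radial (v i)))"
  have Dsgn: "sgn (D j) = H (j + 3) * H (j + 3 + 1)" if "j < ?d" for j
  proof -
    have "sgn (D j) = sgn (B (f (j + 3)) (f (j + 3)))" using \<rho>_pos by (simp add: D_def sgn_divide sgn_mult)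
    then show ?thesis using ff[of "j + 3"] that by simp
  qed
  have Kc: "(\<Sum>i<?d. K j i * c i) = B (f (j + 3)) (\<lambda>k. \<Sum>i<?d. c i * radial (v i) k)" for j c
    by (subst B_sum_right) (simp_all add: K_def mult.commute)
  have exp: "B a a = (\<Sum>i=3..<n. (B (f i) a)\<^sup>2 / B (f i) (f i)) \<and>
    ((\<forall>i\<in>{3..<n}. B (f i) a = 0) \<longrightarrow> (\<forall>k\<ge>1. a k = 0))" if "supp n a" "ell a = 0" for a
    by (rule orthogonal_expansion) (use \<delta> ffnz n_ge_3 that in auto)
  have inj: "\<forall>i<?d. c i = 0" if K0: "\<forall>j<?d. (\<Sum>i<?d. K j i * c i) = 0" for c
  proof -
    let ?a = "\<lambda>k. \<Sum>i<?d. c i * radial (v i) k"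
    have "B (f i) ?a = 0" if i: "i \<in> {3..<n}" for i
    proof -
      have "i - 3 < ?d" "i - 3 + 3 = i" using i by auto
      then show ?thesis using K0[rule_format, of "i - 3"] unfolding Kc by simp
    qed
    then show ?thesis using exp[of ?a] comb_props[of c] by blast
  qed
  have form: "(\<Sum>i<?d. \<Sum>j<?d. c i * c j * S $$ (i, j)) = (\<Sum>j<?d. D j * (\<Sum>i<?d. K j i * c i)\<^sup>2)" for c
  proof -
    let ?a = "\<lambda>k. \<Sum>i<?d. c i * radial (v i) k"
    have "(\<Sum>i<?d. \<Sum>j<?d. c i * c j * S $$ (i, j)) = (\<Sum>i<?d. c i * (\<Sum>j<?d. c j * (\<rho> / 2 * B (radial (v i)) (radial (v j)))))"
      by (simp add: S_B sum_distrib_left mult.assoc)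
    also have "\<dots> = \<rho> / 2 * (\<Sum>i<?d. c i * (\<Sum>j<?d. c j * B (radial (v i)) (radial (v j))))"
      by (simp add: sum_distrib_left mult.left_commute)
    also have "(\<Sum>i<?d. c i * (\<Sum>j<?d. c j * B (radial (v i)) (radial (v j)))) = B ?a ?a"
      by (subst B_sum_left, simp, subst B_sum_right, simp_all)
    also have "\<rho> / 2 * B ?a ?a = (\<Sum>i=3..<n. \<rho> / 2 / B (f i) (f i) * (B (f i) ?a)\<^sup>2)"
      unfolding conjunct1[OF exp[OF comb_props(1,2)[of c]]] sum_distrib_left
      by (intro sum.cong refl) simp
    also have "\<dots> = (\<Sum>j<?d. D j * (\<Sum>i<?d. K j i * c i)\<^sup>2)"
      unfolding Kc D_def
      by (rule sum.reindex_bij_witness[of _ "\<lambda>j. j + 3" "\<lambda>i. i - 3"]) auto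
    finally show ?thesis .
  qed
  have Dnz: "D j \<noteq> 0" if "j < ?d" for j
    using Dsgn[OF that] Hnz[of "j + 3"] Hnz[of "j + 3 + 1"] that by auto
  have Ssym: "S $$ (i, j) = S $$ (j, i)" if "i < ?d" "j < ?d" for i j
    using that by (simp add: S_B B_comm)
  have neg: "num_neg_eigenvalues S = card {j. j < ?d \<and> D j < 0}"
    by (rule sylvester_inertia(1)[OF S Ssym inj Dnz form])
  have sgn_det: "sgn (Determinant.det S) = (\<Prod>j<?d. sgn (D j))"
    by (rule sylvester_inertia(2)[OF S Ssym inj Dnz form])
  have "{i \<in> {3..<n}. H i * H (i + 1) < 0} = (\<lambda>j. j + 3) ` {j. j < ?d \<and> D j < 0}"
  proof (rule subset_antisym; rule subsetI)
    fix i assume i: "i \<in> {i \<in> {3..<n}. H i * H (i + 1) < 0}"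
    then obtain j where j: "i = j + 3" by (metis CollectD atLeastLessThan_iff le_add_diff_inverse2)
    have jd: "j < ?d" using i j by (simp add: less_diff_conv)
    have "H (j + 3) * H (j + 3 + 1) < 0" using i j by simp
    then have "D j < 0" using Dsgn[OF jd] by (metis sgn_less)
    then have "i = j + 3" "j \<in> {j. j < ?d \<and> D j < 0}" using j jd by auto
    then show "i \<in> (\<lambda>j. j + 3) ` {j. j < ?d \<and> D j < 0}" by (rule image_eqI)
  next
    fix i assume "i \<in> (\<lambda>j. j + 3) ` {j. j < ?d \<and> D j < 0}"
    then obtain j where j: "i = j + 3" "j < ?d" "D j < 0" by auto
    then have "H (j + 3) * H (j + 3 + 1) < 0" using Dsgn[of j] by (metis sgn_less)
    then show "i \<in> {i \<in> {3..<n}. H i * H (i + 1) < 0}" using j by (auto simp: less_diff_conv)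
  qed
  then show "num_neg_eigenvalues S = sign_changes H 3 n"
    unfolding neg sign_changes_def by (simp add: card_image)
  \<comment> \<open>Interior factors occur twice and square to 1, and the first factor is
    \<open>H 3 = 1\<close>.\<close>
  have "(\<Prod>j<m. H (j + 3) * H (j + 3 + 1)) = H (m + 3)" if "m \<le> ?d" for m
    using that
  proof (induction m)
    case 0
    then show ?case using H_3 by simp
  next
    case (Suc m)
    have "H (m + 3) * H (m + 3) = 1"
    proof -
      have m3: "m + 3 < n" using Suc.prems by linarith
      have "\<bar>sgn (t k)\<bar> = 1" if "k \<in> {1..<m + 3}" for k using t_nz[of k] that m3 by (auto simp: abs_sgn_eq)
      then have "\<bar>H (m + 3)\<bar> = 1"
        using \<delta>[of "m + 3"] closing_nz[of "m + 3"] m3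
        by (simp add: H_def abs_mult abs_prod abs_sgn_eq)
      then show ?thesis by (metis abs_mult_self_eq mult.right_neutral)
    qed
    then show ?case using Suc by simp
  qed
  from this[of ?d] show "sgn (Determinant.det S) = H n"
    unfolding sgn_det using n_ge_3 by (simp add: Dsgn)
qed

end

end

section \<open>The Hessian of the area in a chart\<close>

lemma eventually_upd_in_open:
  assumes U: "openin (Euclidean_space d) U" and x: "x \<in> U" and j: "j < d"
  shows "\<forall>\<^sub>F s in nhds (x j). x(j := s) \<in> U"
proof -
  obtain W where W: "openin (powertop_real UNIV) W" "U = W \<inter> {x. \<forall>i\<ge>d. x i = 0}"
    using U by (auto simp: Euclidean_space_def openin_subtopology)
  have "open W" using W(1) by (metis euclidean_product_topology open_openin)
  have "continuous_on UNIV (\<lambda>s. x(j := s))"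
  proof (rule continuous_on_coordinatewise_then_product)
    show "continuous_on UNIV (\<lambda>s. (x(j := s)) i)" for i by (cases "i = j") auto
  qed
  then have "open ((\<lambda>s. x(j := s)) -` W)" using \<open>open W\<close> by (simp add: open_vimage)
  moreover have "x j \<in> (\<lambda>s. x(j := s)) -` W" using x W by simp
  ultimately have "\<forall>\<^sub>F s in nhds (x j). s \<in> (\<lambda>s. x(j := s)) -` W" by (rule eventually_nhds_in_open)
  then show ?thesis
    by eventually_elim (use x W j in auto)
qed

lemma partial_deriv_works:
  assumes "C_k_on d (Suc m) U f" "x \<in> U" "j < d"
  shows "((\<lambda>s. f (x(j := s))) has_vector_derivative partial_deriv j f x) (at (x j))"
  using assms by (simp add: partial_deriv_def vector_derivative_works[symmetric])

text \<open>A small change of one coordinate stays in \<open>U\<close>, so identities known only on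
  \<open>U\<close> may be differentiated there.\<close>

lemma along_cong:
  assumes U: "openin (Euclidean_space d) U" and x: "x \<in> U" and j: "j < d"
    and eq: "\<And>y. y \<in> U \<Longrightarrow> f y = g y"
    and D: "((\<lambda>s. g (x(j := s))) has_vector_derivative D) (at (x j))"
  shows "((\<lambda>s. f (x(j := s))) has_vector_derivative D) (at (x j))"
proof -
  have "\<forall>\<^sub>F s in nhds (x j). f (x(j := s)) = g (x(j := s))"
    using eventually_upd_in_open[OF U x j] by eventually_elim (rule eq)
  moreover have "f (x(j := x j)) = g (x(j := x j))" using eq x by simp
  ultimately show ?thesis
    using D by (subst has_vector_derivative_cong_ev[where g = "\<lambda>s. g (x(j := s))"]) (auto elim: eventually_mono)
qed

lemma partial_deriv_eqI:
  assumes "openin (Euclidean_space d) U" "x \<in> U" "j < d" "\<And>y. y \<in> U \<Longrightarrow> f y = g y"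
    and "((\<lambda>s. g (x(j := s))) has_vector_derivative D) (at (x j))"
  shows "partial_deriv j f x = D"
  unfolding partial_deriv_def by (rule vector_derivative_at[OF along_cong[OF assms]])

lemma bounded_linear_rot90: "bounded_linear rot90"
  unfolding rot90_def by (intro bounded_linear_Pair bounded_linear_minus bounded_linear_fst bounded_linear_snd)

lemma bounded_bilinear_cross2: "bounded_bilinear cross2"
  using bounded_bilinear.comp1[OF bounded_bilinear_inner bounded_linear_rot90]
  by (simp add: cross2_eq_inner[abs_def])

lemma signed_area_cross2: "signed_area n Q = 1/2 * (\<Sum>k=1..n. cross2 (Q k) (Q (nxt n k)))"
  by (simp add: signed_area_def cross2_def mult.commute)

lemma partial_deriv_bilinear_sum:
  fixes f g :: "nat \<Rightarrow> (nat \<Rightarrow> real) \<Rightarrow> real \<times> real" and pr :: "real \<times> real \<Rightarrow> real \<times> real \<Rightarrow> real"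
  assumes bil: "bounded_bilinear pr"
    and U: "openin (Euclidean_space d) U" and x: "x \<in> U" and j: "j < d"
    and f: "\<And>k. k \<in> I \<Longrightarrow> ((\<lambda>s. f k (x(j := s))) has_vector_derivative f' k) (at (x j))"
    and g: "\<And>k. k \<in> I \<Longrightarrow> ((\<lambda>s. g k (x(j := s))) has_vector_derivative g' k) (at (x j))"
    and eq: "\<And>y. y \<in> U \<Longrightarrow> F y = c * (\<Sum>k\<in>I. pr (f k y) (g k y))"
  shows "partial_deriv j F x = c * (\<Sum>k\<in>I. pr (f k x) (g' k) + pr (f' k) (g k x))"
proof (rule partial_deriv_eqI[OF U x j eq])
  have "((\<lambda>s. \<Sum>k\<in>I. pr (f k (x(j := s))) (g k (x(j := s)))) has_vector_derivative
      (\<Sum>k\<in>I. pr (f k (x(j := x j))) (g' k) + pr (f' k) (g k (x(j := x j))))) (at (x j))"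
    by (intro has_vector_derivative_sum bounded_bilinear.has_vector_derivative[OF bil] f g)
  then have "((\<lambda>s. \<Sum>k\<in>I. pr (f k (x(j := s))) (g k (x(j := s)))) has_vector_derivative
      (\<Sum>k\<in>I. pr (f k x) (g' k) + pr (f' k) (g k x))) (at (x j))"
    by simp
  from has_vector_derivative_mult_right[OF this, of c]
  show "((\<lambda>s. c * (\<Sum>k\<in>I. pr (f k (x(j := s))) (g k (x(j := s))))) has_vector_derivative
     c * (\<Sum>k\<in>I. pr (f k x) (g' k) + pr (f' k) (g k x))) (at (x j))" .
qed

locale polygon_chart =
  fixes n :: nat and L :: "nat \<Rightarrow> real" and U :: "(nat \<Rightarrow> real) set"
    and \<phi> :: "(nat \<Rightarrow> real) \<Rightarrow> nat \<Rightarrow> real \<times> real" and u :: "nat \<Rightarrow> real"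
  assumes n3: "n \<ge> 3" and lp: "local_param n L U \<phi>" and u: "u \<in> U"
begin

section \<open>Derivatives of the constraints and of the area\<close>

lemma U_open: "openin (Euclidean_space (n - 3)) U"
  using lp by (simp add: local_param_def)

lemma C_k: "k \<in> {1..n} \<Longrightarrow> C_k_on (n - 3) m U (\<lambda>x. \<phi> x k)"
  using lp by (simp add: local_param_def smooth_fun_on_def)

lemma nxt_in: "k \<in> {1..n} \<Longrightarrow> nxt n k \<in> {1..n}"
  by (auto simp: nxt_def)

lemma in_moduli_space: "x \<in> U \<Longrightarrow> \<phi> x \<in> moduli_space n L"
  using lp unfolding local_param_def homeomorphism_def openin_euclidean_subtopology_iff by blast

definition tangent :: "nat \<Rightarrow> (nat \<Rightarrow> real) \<Rightarrow> nat \<Rightarrow> real \<times> real" where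
  "tangent j x k = partial_deriv j (\<lambda>y. \<phi> y k) x"

lemma C_k_tangent: "j < n - 3 \<Longrightarrow> k \<in> {1..n} \<Longrightarrow> C_k_on (n - 3) m U (\<lambda>x. tangent j x k)"
  using C_k[of k "Suc m"] unfolding tangent_def by (simp del: One_nat_def)

lemma tangent_1_2:
  assumes "x \<in> U" "j < n - 3"
  shows "tangent j x 1 = 0" "tangent j x 2 = 0"
proof -
  have "\<phi> y 1 = (0, 0)" "\<phi> y 2 = (0, L 1)" if "y \<in> U" for y
    using in_moduli_space[OF that] by (simp_all add: moduli_space_def)
  then show "tangent j x 1 = 0" "tangent j x 2 = 0"
    unfolding tangent_def
    by (intro partial_deriv_eqI[OF U_open assms, where g = "\<lambda>_. (0, 0)"] partial_deriv_eqI[OF U_open assms, where g = "\<lambda>_. (0, L 1)"]; simp)+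
qed

lemma along:
  assumes "x \<in> U" "j < n - 3" "k \<in> {1..n}"
  shows "((\<lambda>s. \<phi> (x(j := s)) k) has_vector_derivative tangent j x k) (at (x j))"
  unfolding tangent_def by (rule partial_deriv_works[of _ 0, OF C_k assms(1,2)]) fact

lemma along_tangent:
  assumes "x \<in> U" "i < n - 3" "j < n - 3" "k \<in> {1..n}"
  shows "((\<lambda>s. tangent j (x(i := s)) k) has_vector_derivative partial_deriv i (\<lambda>y. tangent j y k) x) (at (x i))"
  by (rule partial_deriv_works[of _ 0, OF C_k_tangent[OF assms(3,4)] assms(1,2)])

lemma side_const: "x \<in> U \<Longrightarrow> k \<in> {1..n} \<Longrightarrow> inner (\<phi> x (nxt n k) - \<phi> x k) (\<phi> x (nxt n k) - \<phi> x k) = (L k)\<^sup>2"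
  using in_moduli_space[of x]
  by (auto simp: moduli_space_def side_lengths_def dist_norm norm_minus_commute simp flip: power2_norm_eq_inner)

lemma constraint_1:
  assumes x: "x \<in> U" and j: "j < n - 3" and k: "k \<in> {1..n}"
  shows "inner (\<phi> x (nxt n k) - \<phi> x k) (tangent j x (nxt n k) - tangent j x k) = 0"
proof -
  note d = has_vector_derivative_diff[OF along[OF x j nxt_in[OF k]] along[OF x j k]]
  have "partial_deriv j (\<lambda>_. (L k)\<^sup>2) x = 1 * (\<Sum>_\<in>{()}.
      inner (\<phi> x (nxt n k) - \<phi> x k) (tangent j x (nxt n k) - tangent j x k)
      + inner (tangent j x (nxt n k) - tangent j x k) (\<phi> x (nxt n k) - \<phi> x k))"
    by (rule partial_deriv_eqI[OF U_open x j, where g = "\<lambda>y. inner (\<phi> y (nxt n k) - \<phi> y k) (\<phi> y (nxt n k) - \<phi> y k)"])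
      (use side_const[OF _ k] bounded_bilinear.has_vector_derivative[OF bounded_bilinear_inner d d] in auto)
  moreover have "partial_deriv j (\<lambda>_. (L k)\<^sup>2) x = 0"
    by (rule partial_deriv_eqI[OF U_open x j refl]) simp
  ultimately show ?thesis by (simp add: inner_commute)
qed

text \<open>The first-order constraint differentiated once more. It trades the second derivatives of
  the chart, paired with an edge, for first derivatives.\<close>

lemma constraint_2:
  assumes x: "x \<in> U" and i: "i < n - 3" and j: "j < n - 3" and k: "k \<in> {1..n}"
  shows "inner (\<phi> x (nxt n k) - \<phi> x k) (partial_deriv i (\<lambda>y. tangent j y (nxt n k)) x - partial_deriv i (\<lambda>y. tangent j y k) x)
    = - inner (tangent i x (nxt n k) - tangent i x k) (tangent j x (nxt n k) - tangent j x k)"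
proof -
  note d = has_vector_derivative_diff[OF along[OF x i nxt_in[OF k]] along[OF x i k]]
  note d' = has_vector_derivative_diff[OF along_tangent[OF x i j nxt_in[OF k]] along_tangent[OF x i j k]]
  have "partial_deriv i (\<lambda>_. 0) x =
      inner (\<phi> x (nxt n k) - \<phi> x k) (partial_deriv i (\<lambda>y. tangent j y (nxt n k)) x - partial_deriv i (\<lambda>y. tangent j y k) x)
      + inner (tangent i x (nxt n k) - tangent i x k) (tangent j x (nxt n k) - tangent j x k)"
    by (rule partial_deriv_eqI[OF U_open x i, where g = "\<lambda>y. inner (\<phi> y (nxt n k) - \<phi> y k) (tangent j y (nxt n k) - tangent j y k)"])
      (use constraint_1[OF _ j k] bounded_bilinear.has_vector_derivative[OF bounded_bilinear_inner d d'] in auto)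
  moreover have "partial_deriv i (\<lambda>_. 0 :: real) x = 0"
    by (rule partial_deriv_eqI[OF U_open x i refl]) simp
  ultimately show ?thesis by simp
qed

lemma area_gradient:
  assumes x: "x \<in> U" and j: "j < n - 3"
  shows "partial_deriv j (\<lambda>y. signed_area n (\<phi> y)) x
    = 1/2 * (\<Sum>k=1..n. cross2 (\<phi> x k) (tangent j x (nxt n k)) + cross2 (tangent j x k) (\<phi> x (nxt n k)))"
  by (rule partial_deriv_bilinear_sum[OF bounded_bilinear_cross2 U_open x j along along])
    (use x j nxt_in in \<open>auto simp: signed_area_cross2\<close>)

text \<open>The second sum has the shape of a first variation of the area in the direction of the
  second derivatives of the chart.\<close>

lemma area_hessian:
  assumes x: "x \<in> U" and i: "i < n - 3" and j: "j < n - 3"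
  shows "partial_deriv i (partial_deriv j (\<lambda>y. signed_area n (\<phi> y))) x
    = 1/2 * (\<Sum>k=1..n. cross2 (tangent i x k) (tangent j x (nxt n k)) + cross2 (tangent j x k) (tangent i x (nxt n k)))
    + 1/2 * (\<Sum>k=1..n. cross2 (partial_deriv i (\<lambda>y. tangent j y k) x) (\<phi> x (nxt n k))
        + cross2 (\<phi> x k) (partial_deriv i (\<lambda>y. tangent j y (nxt n k)) x))"
proof -
  let ?V = "\<lambda>k. partial_deriv i (\<lambda>y. tangent j y k) x"
  have d: "((\<lambda>s. \<Sum>k=1..n. cross2 (\<phi> (x(i := s)) k) (tangent j (x(i := s)) (nxt n k)) + cross2 (tangent j (x(i := s)) k) (\<phi> (x(i := s)) (nxt n k)))
    has_vector_derivative (\<Sum>k=1..n. (cross2 (\<phi> (x(i := x i)) k) (?V (nxt n k)) + cross2 (tangent i x k) (tangent j (x(i := x i)) (nxt n k)))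
      + (cross2 (tangent j (x(i := x i)) k) (tangent i x (nxt n k)) + cross2 (?V k) (\<phi> (x(i := x i)) (nxt n k))))) (at (x i))"
    by (intro has_vector_derivative_sum has_vector_derivative_add
        bounded_bilinear.has_vector_derivative[OF bounded_bilinear_cross2] along along_tangent x i j nxt_in)
  have "partial_deriv i (partial_deriv j (\<lambda>y. signed_area n (\<phi> y))) x
    = 1/2 * (\<Sum>k=1..n. (cross2 (\<phi> x k) (?V (nxt n k)) + cross2 (tangent i x k) (tangent j x (nxt n k)))
      + (cross2 (tangent j x k) (tangent i x (nxt n k)) + cross2 (?V k) (\<phi> x (nxt n k))))"
    by (rule partial_deriv_eqI[OF U_open x i area_gradient[OF _ j]])
      (use has_vector_derivative_mult_right[OF d, of "1/2"] in simp_all)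
  then show ?thesis
    by (simp add: sum.distrib algebra_simps)
qed

lemma tangent_independent:
  assumes x: "x \<in> U" and c: "\<forall>k\<in>{1..n}. (\<Sum>j<n - 3. c j *\<^sub>R tangent j x k) = 0"
  shows "\<forall>j<n - 3. c j = 0"
  using lp x c unfolding local_param_def tangent_def by blast

end

locale inscribed_polygon_chart = inscribed_polygon n \<rho> q + polygon_chart n L U \<phi> u
  for n \<rho> q L U \<phi> u +
  fixes C :: "real \<times> real"
  assumes center: "\<And>k. k \<in> {1..n} \<Longrightarrow> \<phi> u k = C + q k"
begin

lemma edge_vector: "k \<in> {1..n} \<Longrightarrow> \<phi> u (nxt n k) - \<phi> u k = q (nxt n k) - q k"
  using center[of k] center[of "nxt n k"] nxt_in[of k] by simp

lemma admissible_tangent: "j < n - 3 \<Longrightarrow> admissible (tangent j u)"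
  using constraint_1[OF u, of j] tangent_1_2(1)[OF u, of j]
  by (simp add: admissible_def edge_vector inner_commute)

lemma area_first_variation:
  "(\<Sum>k=1..n. cross2 (V k) (\<phi> u (nxt n k)) + cross2 (\<phi> u k) (V (nxt n k)))
    = (\<Sum>k=1..n. (1 / T k) * inner (\<phi> u (nxt n k) - \<phi> u k) (V (nxt n k) - V k))"
proof -
  have "(\<Sum>k=1..n. cross2 (V k) (\<phi> u (nxt n k)) + cross2 (\<phi> u k) (V (nxt n k)))
    = (\<Sum>k=1..n. (cross2 (V k) (q (nxt n k)) + cross2 (q k) (V (nxt n k))) + (cross2 C (V (nxt n k)) - cross2 C (V k)))"
  proof (intro sum.cong refl)
    fix k assume k: "k \<in> {1..n}"
    show "cross2 (V k) (\<phi> u (nxt n k)) + cross2 (\<phi> u k) (V (nxt n k))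
      = (cross2 (V k) (q (nxt n k)) + cross2 (q k) (V (nxt n k))) + (cross2 C (V (nxt n k)) - cross2 C (V k))"
      unfolding center[OF k] center[OF nxt_in[OF k]] by (simp add: cross2_linear cross2_swap[of C "V k"])
  qed
  also have "\<dots> = (\<Sum>k=1..n. cross2 (V k) (q (nxt n k)) + cross2 (q k) (V (nxt n k)))
      + (\<Sum>k=1..n. cross2 C (V (nxt n k)) - cross2 C (V k))"
    by (rule sum.distrib)
  also have "(\<Sum>k=1..n. cross2 C (V (nxt n k)) - cross2 C (V k)) = 0"
    using n_ge_3 by (intro sum_nxt_telescope) simp
  also have "(\<Sum>k=1..n. cross2 (V k) (q (nxt n k)) + cross2 (q k) (V (nxt n k)))
    = (\<Sum>k=1..n. (1 / T k) * inner (\<phi> u (nxt n k) - \<phi> u k) (V (nxt n k) - V k))"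
    unfolding first_variation by (intro sum.cong refl) (simp add: edge_vector)
  finally show ?thesis by simp
qed

lemma area_critical: "j < n - 3 \<Longrightarrow> partial_deriv j (\<lambda>x. signed_area n (\<phi> x)) u = 0"
  using area_first_variation[of "tangent j u"] constraint_1[OF u, of j]
  by (simp add: area_gradient[OF u] add.commute)

text \<open>The multipliers turn the term with second derivatives of the chart into pairings with
  edges, and the differentiated constraint evaluates these. The curvature of the chart thus
  disappears, leaving a form in tangent vectors.\<close>

lemma area_hessian_eq:
  assumes "i < n - 3" "j < n - 3"
  shows "partial_deriv i (partial_deriv j (\<lambda>y. signed_area n (\<phi> y))) u
    = second_variation (tangent i u) (tangent j u)"
proof -
  have aux: "a = - b \<Longrightarrow> 1/2 * s + 1/2 * a = 1/2 * (s - b)" for a b s :: real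
    by (simp add: algebra_simps)
  have "(\<Sum>k=1..n. cross2 (partial_deriv i (\<lambda>y. tangent j y k) u) (\<phi> u (nxt n k))
        + cross2 (\<phi> u k) (partial_deriv i (\<lambda>y. tangent j y (nxt n k)) u))
    = (\<Sum>k=1..n. - ((1 / T k) * inner (tangent i u (nxt n k) - tangent i u k) (tangent j u (nxt n k) - tangent j u k)))"
    unfolding area_first_variation[of "\<lambda>k. partial_deriv i (\<lambda>y. tangent j y k) u"]
    by (intro sum.cong refl) (simp add: constraint_2[OF u assms])
  then show ?thesis
    unfolding area_hessian[OF u assms] second_variation_def sum_subtractf sum_negf by (rule aux)
qed

end

section \<open>Smooth functions\<close>

lemma C_k_on_cong:
  assumes U: "openin (Euclidean_space d) U"
  shows "C_k_on d k U g \<Longrightarrow> (\<And>x. x \<in> U \<Longrightarrow> f x = g x) \<Longrightarrow> C_k_on d k U f"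
proof (induction k arbitrary: f g)
  case 0
  then show ?case using continuous_on_cong[of U U f g] by simp
next
  case (Suc k)
  have d: "((\<lambda>s. f (x(j := s))) has_vector_derivative partial_deriv j g x) (at (x j))" if "x \<in> U" "j < d" for x j
    by (rule along_cong[OF U that Suc.prems(2) partial_deriv_works[OF Suc.prems(1) that]])
  show ?case unfolding C_k_on.simps
  proof (intro conjI allI impI ballI)
    show "continuous_on U f" using Suc.prems continuous_on_cong[of U U f g] by simp
    fix j assume j: "j < d"
    show "(\<lambda>s. f (x(j := s))) differentiable at (x j)" if "x \<in> U" for x
      using d[OF that j] by (auto simp: has_vector_derivative_def differentiable_def)
    show "C_k_on d k U (partial_deriv j f)"
    proof (rule Suc.IH)
      show "C_k_on d k U (partial_deriv j g)" using Suc.prems(1) j by simp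
      show "partial_deriv j f x = partial_deriv j g x" if "x \<in> U" for x
        using d[OF that j] by (simp add: partial_deriv_def[of j f] vector_derivative_at)
    qed
  qed
qed

text \<open>The proposed derivatives \<open>D\<close> have to agree with
  \<open>partial_deriv\<close> on \<open>U\<close> only, which suffices because being of class
  \<open>C_k_on\<close> depends only on values on \<open>U\<close>.\<close>

lemma C_k_on_SucI:
  assumes U: "openin (Euclidean_space d) U" and "continuous_on U f"
    and D: "\<And>j x. j < d \<Longrightarrow> x \<in> U \<Longrightarrow> ((\<lambda>s. f (x(j := s))) has_vector_derivative D j x) (at (x j))"
    and C: "\<And>j. j < d \<Longrightarrow> C_k_on d k U (D j)"
  shows "C_k_on d (Suc k) U f"
  unfolding C_k_on.simps
proof (intro conjI allI impI ballI)
  show "continuous_on U f" by fact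
  fix j assume j: "j < d"
  show "(\<lambda>s. f (x(j := s))) differentiable at (x j)" if "x \<in> U" for x
    using D[OF j that] by (auto simp: has_vector_derivative_def differentiable_def)
  show "C_k_on d k U (partial_deriv j f)"
    by (rule C_k_on_cong[OF U C[OF j]]) (use D[OF j] in \<open>simp add: partial_deriv_def vector_derivative_at\<close>)
qed

lemma C_k_on_SucD: "C_k_on d (Suc k) U f \<Longrightarrow> C_k_on d k U f"
proof (induction k arbitrary: f)
  case (Suc k)
  show ?case unfolding C_k_on.simps(2)[of d k]
  proof (intro conjI allI impI)
    show "continuous_on U f" using Suc.prems by simp
    fix j assume "j < d"
    then have "C_k_on d (Suc k) U (partial_deriv j f)"
      and "\<forall>x\<in>U. (\<lambda>s. f (x(j := s))) differentiable at (x j)"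
      using Suc.prems unfolding C_k_on.simps(2)[of d "Suc k"] by blast+
    then show "\<forall>x\<in>U. (\<lambda>s. f (x(j := s))) differentiable at (x j)" "C_k_on d k U (partial_deriv j f)"
      using Suc.IH by blast+
  qed
qed simp

context
  fixes d :: nat and U :: "(nat \<Rightarrow> real) set"
  assumes U: "openin (Euclidean_space d) U"
begin

section \<open>Closure properties of smooth functions\<close>

lemma C_k_on_const: "C_k_on d k U (\<lambda>_. c)"
proof (induction k arbitrary: c)
  case (Suc k)
  show ?case by (rule C_k_on_SucI[OF U, where D = "\<lambda>_ _. 0"]) (use Suc in auto)
qed simp

lemma C_k_on_coord: "C_k_on d k U (\<lambda>x. x i)"
proof (cases k)
  case 0
  then show ?thesis by (simp add: continuous_on_product_coordinates continuous_on_subset[OF _ subset_UNIV])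
next
  case (Suc m)
  have "((\<lambda>s. (x(j := s)) i) has_vector_derivative (if i = j then 1 else 0)) (at (x j))" for x j
    by (cases "i = j") (auto intro: has_vector_derivative_id)
  then show ?thesis unfolding Suc
    by (intro C_k_on_SucI[OF U, where D = "\<lambda>j _. if i = j then 1 else 0"])
      (auto simp: C_k_on_const continuous_on_product_coordinates continuous_on_subset[OF _ subset_UNIV])
qed

lemma C_k_on_imp_continuous: "C_k_on d k U f \<Longrightarrow> continuous_on U f"
  by (cases k) auto

lemma C_k_on_add: "C_k_on d k U f \<Longrightarrow> C_k_on d k U g \<Longrightarrow> C_k_on d k U (\<lambda>x. f x + g x)"
proof (induction k arbitrary: f g)
  case (Suc k)
  show ?case
  proof (rule C_k_on_SucI[OF U, where D = "\<lambda>j x. partial_deriv j f x + partial_deriv j g x"])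
    show "continuous_on U (\<lambda>x. f x + g x)"
      using Suc.prems by (intro continuous_on_add) (auto intro: C_k_on_imp_continuous)
    show "((\<lambda>s. f (x(j := s)) + g (x(j := s))) has_vector_derivative partial_deriv j f x + partial_deriv j g x) (at (x j))"
      if "j < d" "x \<in> U" for j x
      by (intro has_vector_derivative_add partial_deriv_works[OF Suc.prems(1)] partial_deriv_works[OF Suc.prems(2)] that)
    show "C_k_on d k U (\<lambda>x. partial_deriv j f x + partial_deriv j g x)" if "j < d" for j
      by (rule Suc.IH) (use Suc.prems that in auto)
  qed
qed (auto intro: continuous_on_add)

lemma C_k_on_bilinear:
  assumes "bounded_bilinear pr"
  shows "C_k_on d k U f \<Longrightarrow> C_k_on d k U g \<Longrightarrow> C_k_on d k U (\<lambda>x. pr (f x) (g x))"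
proof (induction k arbitrary: f g)
  case 0
  then show ?case using bounded_bilinear.continuous_on[OF assms] by simp
next
  case (Suc k)
  show ?case
  proof (rule C_k_on_SucI[OF U, where D = "\<lambda>j x. pr (f x) (partial_deriv j g x) + pr (partial_deriv j f x) (g x)"])
    show "continuous_on U (\<lambda>x. pr (f x) (g x))"
      using Suc.prems by (intro bounded_bilinear.continuous_on[OF assms]) (auto intro: C_k_on_imp_continuous)
    show "((\<lambda>s. pr (f (x(j := s))) (g (x(j := s)))) has_vector_derivative pr (f x) (partial_deriv j g x) + pr (partial_deriv j f x) (g x)) (at (x j))"
      if "j < d" "x \<in> U" for j x
      using bounded_bilinear.has_vector_derivative[OF assms partial_deriv_works[OF Suc.prems(1) that(2,1)] partial_deriv_works[OF Suc.prems(2) that(2,1)]]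
      by (simp only: fun_upd_triv)
    show "C_k_on d k U (\<lambda>x. pr (f x) (partial_deriv j g x) + pr (partial_deriv j f x) (g x))" if "j < d" for j
      by (intro C_k_on_add Suc.IH) (use Suc.prems that C_k_on_SucD in auto)
  qed
qed

lemma C_k_on_linear:
  assumes "bounded_linear h"
  shows "C_k_on d k U f \<Longrightarrow> C_k_on d k U (\<lambda>x. h (f x))"
proof (induction k arbitrary: f)
  case 0
  then show ?case using bounded_linear.continuous_on[OF assms] by simp
next
  case (Suc k)
  show ?case
  proof (rule C_k_on_SucI[OF U, where D = "\<lambda>j x. h (partial_deriv j f x)"])
    show "continuous_on U (\<lambda>x. h (f x))"
      using Suc.prems by (intro bounded_linear.continuous_on[OF assms]) (auto intro: C_k_on_imp_continuous)
    show "((\<lambda>s. h (f (x(j := s)))) has_vector_derivative h (partial_deriv j f x)) (at (x j))"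
      if "j < d" "x \<in> U" for j x
      by (rule bounded_linear.has_vector_derivative[OF assms partial_deriv_works[OF Suc.prems that(2,1)]])
    show "C_k_on d k U (\<lambda>x. h (partial_deriv j f x))" if "j < d" for j
      by (intro Suc.IH) (use Suc.prems that in auto)
  qed
qed

text \<open>Real powers are closed under differentiation up to a shift of the exponent, so one
  induction over all exponents yields square roots and reciprocals together.\<close>

lemma C_k_on_powr:
  fixes f :: "(nat \<Rightarrow> real) \<Rightarrow> real"
  assumes pos: "\<And>x. x \<in> U \<Longrightarrow> f x > 0"
  shows "C_k_on d k U f \<Longrightarrow> C_k_on d k U (\<lambda>x. f x powr a)"
proof (induction k arbitrary: a)
  case 0
  then show ?case using pos by (auto intro!: continuous_on_powr simp: order_less_imp_not_eq2)
next
  case (Suc k)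
  show ?case
  proof (rule C_k_on_SucI[OF U, where D = "\<lambda>j x. (a * f x powr (a - 1)) * partial_deriv j f x"])
    show "continuous_on U (\<lambda>x. f x powr a)"
    proof (intro continuous_on_powr C_k_on_imp_continuous[OF Suc.prems] continuous_on_const ballI)
      show "f x \<noteq> 0" if "x \<in> U" for x using pos[OF that] by simp
    qed
    show "((\<lambda>s. f (x(j := s)) powr a) has_vector_derivative a * f x powr (a - 1) * partial_deriv j f x) (at (x j))"
      if "j < d" "x \<in> U" for j x
    proof -
      have 1: "((\<lambda>s. f (x(j := s))) has_real_derivative partial_deriv j f x) (at (x j))"
        unfolding has_real_derivative_iff_has_vector_derivative
        by (rule partial_deriv_works[OF Suc.prems that(2,1)])
      have "f (x(j := x j)) > 0" using pos[OF that(2)] by (simp only: fun_upd_triv)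
      then have "((\<lambda>z. z powr a) has_real_derivative a * f (x(j := x j)) powr (a - 1)) (at (f (x(j := x j))))"
        by (rule has_real_derivative_powr)
      from DERIV_chain2[OF this 1] show ?thesis
        unfolding has_real_derivative_iff_has_vector_derivative by (simp only: fun_upd_triv)
    qed
    show "C_k_on d k U (\<lambda>x. a * f x powr (a - 1) * partial_deriv j f x)" if "j < d" for j
      using Suc.prems that C_k_on_SucD[OF Suc.prems]
      by (intro C_k_on_bilinear[OF bounded_bilinear_mult] C_k_on_const Suc.IH) auto
  qed
qed

lemma smooth_cong: "smooth_fun_on d U g \<Longrightarrow> (\<And>x. x \<in> U \<Longrightarrow> f x = g x) \<Longrightarrow> smooth_fun_on d U f"
  unfolding smooth_fun_on_def using C_k_on_cong[OF U] by blast

lemma smooth_const: "smooth_fun_on d U (\<lambda>_. c)"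
  by (simp add: smooth_fun_on_def C_k_on_const)

lemma smooth_coord: "smooth_fun_on d U (\<lambda>x. x i)"
  by (simp add: smooth_fun_on_def C_k_on_coord)

lemma smooth_add: "smooth_fun_on d U f \<Longrightarrow> smooth_fun_on d U g \<Longrightarrow> smooth_fun_on d U (\<lambda>x. f x + g x)"
  by (simp add: smooth_fun_on_def C_k_on_add)

lemma smooth_linear: "bounded_linear h \<Longrightarrow> smooth_fun_on d U f \<Longrightarrow> smooth_fun_on d U (\<lambda>x. h (f x))"
  by (simp add: smooth_fun_on_def C_k_on_linear)

lemma smooth_bilinear:
  "bounded_bilinear pr \<Longrightarrow> smooth_fun_on d U f \<Longrightarrow> smooth_fun_on d U g \<Longrightarrow> smooth_fun_on d U (\<lambda>x. pr (f x) (g x))"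
  by (simp add: smooth_fun_on_def C_k_on_bilinear)

lemma smooth_diff:
  "smooth_fun_on d U f \<Longrightarrow> smooth_fun_on d U g \<Longrightarrow> smooth_fun_on d U (\<lambda>x. f x - g x)"
  using smooth_add[of f "\<lambda>x. - g x"] smooth_linear[OF bounded_linear_minus[OF bounded_linear_ident], of g] by simp

lemma smooth_sum:
  "finite I \<Longrightarrow> (\<And>i. i \<in> I \<Longrightarrow> smooth_fun_on d U (f i)) \<Longrightarrow> smooth_fun_on d U (\<lambda>x. \<Sum>i\<in>I. f i x)"
  by (induction I rule: finite_induct) (auto simp: smooth_const smooth_add)

lemma smooth_mult:
  fixes f g :: "(nat \<Rightarrow> real) \<Rightarrow> real"
  shows "smooth_fun_on d U f \<Longrightarrow> smooth_fun_on d U g \<Longrightarrow> smooth_fun_on d U (\<lambda>x. f x * g x)"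
  by (rule smooth_bilinear[OF bounded_bilinear_mult])

lemma smooth_sqrt:
  assumes "smooth_fun_on d U f" and pos: "\<And>x. x \<in> U \<Longrightarrow> f x > 0"
  shows "smooth_fun_on d U (\<lambda>x. sqrt (f x))"
proof (rule smooth_cong)
  show "smooth_fun_on d U (\<lambda>x. f x powr (1/2))"
    using assms by (simp add: smooth_fun_on_def C_k_on_powr)
  show "sqrt (f x) = f x powr (1/2)" if "x \<in> U" for x
    using pos[OF that] by (simp add: powr_half_sqrt)
qed

lemma smooth_divide:
  fixes f g :: "(nat \<Rightarrow> real) \<Rightarrow> real"
  assumes "smooth_fun_on d U f" "smooth_fun_on d U g" and pos: "\<And>x. x \<in> U \<Longrightarrow> g x > 0"
  shows "smooth_fun_on d U (\<lambda>x. f x / g x)"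
proof (rule smooth_cong)
  show "smooth_fun_on d U (\<lambda>x. f x * g x powr (-1))"
  proof (rule smooth_mult[OF assms(1)])
    show "smooth_fun_on d U (\<lambda>x. g x powr (-1))"
      unfolding smooth_fun_on_def
      by (intro allI C_k_on_powr pos) (use assms(2) in \<open>auto simp: smooth_fun_on_def\<close>)
  qed
  show "f x / g x = f x * g x powr (-1)" if "x \<in> U" for x
    using pos[OF that] by (simp add: powr_neg_one)
qed

end

section \<open>A chart of the moduli space\<close>

text \<open>Sixteen times the squared area of the triangle with side lengths \<open>a\<close>,
  \<open>b\<close> and \<open>|v|\<close>, by Heron's formula; its positivity means that the two
  circles cross in two points.\<close>

definition circle_disc :: "real \<Rightarrow> real \<Rightarrow> real \<times> real \<Rightarrow> real" where
  "circle_disc a b v = 4 * b\<^sup>2 * inner v v - (inner v v + b\<^sup>2 - a\<^sup>2)\<^sup>2"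

text \<open>The intersection point of the circle of radius \<open>b\<close> around the origin with the circle of
  radius \<open>a\<close> around \<open>v\<close>, on the side of the line through the centers given by the sign \<open>s\<close>.\<close>

definition circle_meet :: "real \<Rightarrow> real \<Rightarrow> real \<Rightarrow> real \<times> real \<Rightarrow> real \<times> real" where
  "circle_meet s a b v = ((inner v v + b\<^sup>2 - a\<^sup>2) / (2 * inner v v)) *\<^sub>R v
     + (s * sqrt (circle_disc a b v) / (2 * inner v v)) *\<^sub>R rot90 v"

lemma circle_disc_pos_imp: "circle_disc a b v > 0 \<Longrightarrow> inner v v > 0"
  by (cases "v = 0") (auto simp: circle_disc_def)

lemma circle_meet_props:
  assumes D: "circle_disc a b v > 0" and s: "s\<^sup>2 = 1"
  shows "inner (circle_meet s a b v) (circle_meet s a b v) = b\<^sup>2"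
    and "inner (circle_meet s a b v - v) (circle_meet s a b v - v) = a\<^sup>2"
    and "s * cross2 v (circle_meet s a b v) > 0"
proof -
  define m where "m = inner v v"
  have m: "m > 0" using circle_disc_pos_imp[OF D] by (simp add: m_def)
  define e where "e = m + b\<^sup>2 - a\<^sup>2"
  define r where "r = sqrt (circle_disc a b v)"
  have r: "r > 0" "r\<^sup>2 = 4 * b\<^sup>2 * m - e\<^sup>2"
    using D by (simp_all add: r_def) (simp add: circle_disc_def m_def e_def)
  let ?p = "circle_meet s a b v"
  have p: "?p = (e / (2 * m)) *\<^sub>R v + (s * r / (2 * m)) *\<^sub>R rot90 v"
    by (simp add: circle_meet_def m_def e_def r_def)
  have pv: "inner ?p v = e / 2" "cross2 v ?p = s * r / 2"
    using m unfolding p by (simp_all add: inner_linear inner_rot90 cross2_linear m_def[symmetric])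
      (simp_all add: cross2_def)
  have "inner ?p ?p = (e\<^sup>2 + s\<^sup>2 * r\<^sup>2) / (4 * m)"
    using m unfolding p frame_inner by (simp add: m_def[symmetric] field_simps power2_eq_square)
  also have "\<dots> = b\<^sup>2" unfolding s r(2) using m by simp
  finally show pp: "inner ?p ?p = b\<^sup>2" .
  show "inner (?p - v) (?p - v) = a\<^sup>2"
    by (simp add: inner_linear pp pv inner_commute[of v ?p] m_def[symmetric]) (simp add: e_def)
  have "s * cross2 v ?p = s\<^sup>2 * r / 2" by (simp add: pv power2_eq_square)
  then show "s * cross2 v ?p > 0" using r(1) by (simp add: s)
qed

lemma circle_meet_unique:
  assumes b: "inner p p = b\<^sup>2" and a: "inner (p - v) (p - v) = a\<^sup>2" and s: "s\<^sup>2 = 1" and pos: "s * cross2 v p > 0"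
  shows "circle_disc a b v > 0" "circle_meet s a b v = p"
proof -
  have e: "inner v v + b\<^sup>2 - a\<^sup>2 = 2 * inner p v"
    unfolding a[symmetric] b[symmetric] by (simp add: inner_linear inner_commute)
  have "circle_disc a b v = 4 * (inner p p * inner v v - (inner p v)\<^sup>2)"
    unfolding circle_disc_def e by (simp add: b power_mult_distrib algebra_simps)
  also have "inner p p * inner v v - (inner p v)\<^sup>2 = (cross2 v p)\<^sup>2"
    by (simp add: plane_defs power2_eq_square algebra_simps)
  finally have D: "circle_disc a b v = (2 * cross2 v p)\<^sup>2" by (simp add: power_mult_distrib)
  have "cross2 v p \<noteq> 0" using pos by auto
  then show "circle_disc a b v > 0" by (simp add: D)
  have v: "inner v v \<noteq> 0" using \<open>cross2 v p \<noteq> 0\<close> by (auto simp: cross2_def)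
  have s1: "\<bar>s\<bar> = 1" using s by (metis abs_1 abs_power2 power2_eq_1_iff abs_minus_cancel)
  have "s * sqrt (circle_disc a b v) = s * (2 * \<bar>cross2 v p\<bar>)"
    unfolding D real_sqrt_abs by (simp add: abs_mult)
  also have "\<bar>cross2 v p\<bar> = s * cross2 v p" using pos s1 by (metis abs_mult abs_of_pos mult_1)
  also have "s * (2 * (s * cross2 v p)) = 2 * inner p (rot90 v)"
    using s by (simp add: power2_eq_square inner_rot90 cross2_swap[of p v])
  finally show "circle_meet s a b v = p"
    unfolding circle_meet_def e using frame_expansion[OF refl v, of p] by simp
qed

text \<open>The coordinates are the sines of the rotation angles of the edges \<open>2, \<dots>, n - 2\<close>; the
  vertex \<open>n\<close> is then an intersection point of two circles. This needs the vertices \<open>n - 1\<close>,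
  \<open>n\<close> and \<open>1\<close> of \<open>P\<close> not to be collinear.\<close>

locale polygon_with_ear =
  fixes n :: nat and L :: "nat \<Rightarrow> real" and P :: "nat \<Rightarrow> real \<times> real"
  assumes n3: "n \<ge> 3" and L_pos: "\<And>k. k \<in> {1..n} \<Longrightarrow> L k > 0"
    and PM: "P \<in> moduli_space n L" and ear: "cross2 (P (n - 1)) (P n) \<noteq> 0"
begin

definition w :: "nat \<Rightarrow> real \<times> real" where
  "w j = P (j + 1) - P j"

definition s :: real where
  "s = sgn (cross2 (P (n - 1)) (P n))"

text \<open>The edge \<open>w j\<close> of \<open>P\<close> turned by the acute angle with sine
  \<open>x (j - 2)\<close>. Edges start at 2 because the first one is pinned, coordinates start at
  0.\<close>

definition edge_vec :: "nat \<Rightarrow> (nat \<Rightarrow> real) \<Rightarrow> real \<times> real" where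
  "edge_vec j x = sqrt (1 - (x (j - 2))\<^sup>2) *\<^sub>R w j + x (j - 2) *\<^sub>R rot90 (w j)"

definition vert :: "nat \<Rightarrow> (nat \<Rightarrow> real) \<Rightarrow> real \<times> real" where
  "vert k x = (0, L 1) + (\<Sum>j=2..<k. edge_vec j x)"

definition \<phi> :: "(nat \<Rightarrow> real) \<Rightarrow> nat \<Rightarrow> real \<times> real" where
  "\<phi> x k = (if k = 1 then (0, 0) else if k \<in> {2..<n} then vert k x
     else if k = n then circle_meet s (L (n - 1)) (L n) (vert (n - 1) x) else undefined)"

definition U :: "(nat \<Rightarrow> real) set" where
  "U = {x \<in> topspace (Euclidean_space (n - 3)). (\<forall>j<n - 3. \<bar>x j\<bar> < 1)
     \<and> circle_disc (L (n - 1)) (L n) (vert (n - 1) x) > 0}"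

text \<open>The configurations whose edges 2 to \<open>n - 2\<close> make acute angles with those of
  \<open>P\<close> and whose last triangle has the orientation it has in \<open>P\<close>. The first
  condition fixes the sign of a cosine, the second the choice between two intersection
  points.\<close>

definition V :: "(nat \<Rightarrow> real \<times> real) set" where
  "V = {Q \<in> moduli_space n L. (\<forall>j\<in>{2..<n - 1}. inner (Q (j + 1) - Q j) (w j) > 0)
     \<and> s * cross2 (Q (n - 1)) (Q n) > 0}"

definition \<psi> :: "(nat \<Rightarrow> real \<times> real) \<Rightarrow> nat \<Rightarrow> real" where
  "\<psi> Q i = (if i < n - 3 then inner (Q (i + 3) - Q (i + 2)) (rot90 (w (i + 2))) / (L (i + 2))\<^sup>2 else 0)"

section \<open>Inverse maps between coordinates and configurations\<close>

lemma side:
  assumes "Q \<in> moduli_space n L"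
  shows "\<And>j. j \<in> {1..<n} \<Longrightarrow> inner (Q (j + 1) - Q j) (Q (j + 1) - Q j) = (L j)\<^sup>2"
    and "inner (Q n) (Q n) = (L n)\<^sup>2" "Q 1 = (0, 0)" "Q 2 = (0, L 1)"
proof -
  have d: "dist (Q k) (Q (nxt n k)) = L k" if "k \<in> {1..n}" for k
    using assms that by (auto simp: moduli_space_def side_lengths_def)
  show "inner (Q (j + 1) - Q j) (Q (j + 1) - Q j) = (L j)\<^sup>2" if "j \<in> {1..<n}" for j
    using d[of j] that by (auto simp: nxt_def dist_norm norm_minus_commute simp flip: power2_norm_eq_inner)
  show Q: "Q 1 = (0, 0)" "Q 2 = (0, L 1)" using assms by (simp_all add: moduli_space_def)
  have "norm (Q n) = L n" using d[of n] n3 Q by (simp add: nxt_def flip: zero_prod_def)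
  then show "inner (Q n) (Q n) = (L n)\<^sup>2" by (simp flip: power2_norm_eq_inner)
qed

lemma w_norm: "j \<in> {2..<n - 1} \<Longrightarrow> inner (w j) (w j) = (L j)\<^sup>2"
  unfolding w_def by (rule side(1)[OF PM]) auto

lemma s2: "s\<^sup>2 = 1"
  using ear by (auto simp: s_def sgn_if)

lemma edge_vec_props:
  assumes j: "j \<in> {2..<n - 1}" and x: "\<bar>x (j - 2)\<bar> < 1"
  shows "inner (edge_vec j x) (edge_vec j x) = (L j)\<^sup>2" "inner (edge_vec j x) (w j) > 0"
    "inner (edge_vec j x) (rot90 (w j)) = x (j - 2) * (L j)\<^sup>2"
proof -
  have L: "L j > 0" using j L_pos[of j] by auto
  have x2: "(x (j - 2))\<^sup>2 < 1" using x by (simp add: abs_square_less_1)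
  have c: "cross2 (w j) (w j) = 0" by (simp add: cross2_def)
  have "inner (edge_vec j x) (edge_vec j x) = ((sqrt (1 - (x (j - 2))\<^sup>2))\<^sup>2 + (x (j - 2))\<^sup>2) * (L j)\<^sup>2"
    unfolding edge_vec_def frame_inner by (simp add: w_norm[OF j] c power2_eq_square algebra_simps)
  then show "inner (edge_vec j x) (edge_vec j x) = (L j)\<^sup>2" using x2 by simp
  have "inner (edge_vec j x) (w j) = sqrt (1 - (x (j - 2))\<^sup>2) * (L j)\<^sup>2"
    by (simp add: edge_vec_def inner_linear inner_rot90 c w_norm[OF j])
  then show "inner (edge_vec j x) (w j) > 0" using x2 L by simp
  show "inner (edge_vec j x) (rot90 (w j)) = x (j - 2) * (L j)\<^sup>2"
    unfolding edge_vec_def inner_linear inner_rot90(1) by (simp add: inner_rot90(3) c w_norm[OF j])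
qed

lemma vert_step: "j \<ge> 2 \<Longrightarrow> vert (j + 1) x - vert j x = edge_vec j x"
  by (simp add: vert_def)

lemma \<phi>_vert: "k \<in> {2..<n} \<Longrightarrow> \<phi> x k = vert k x"
  by (simp add: \<phi>_def)

lemma \<phi>_edge: "j \<in> {2..<n - 1} \<Longrightarrow> \<phi> x (j + 1) - \<phi> x j = edge_vec j x"
  using vert_step[of j x] by (subst (1 2) \<phi>_vert) auto

lemma \<phi>_n: "\<phi> x n = circle_meet s (L (n - 1)) (L n) (\<phi> x (n - 1))"
proof -
  have "\<phi> x (n - 1) = vert (n - 1) x" by (rule \<phi>_vert) (use n3 in auto)
  moreover have "\<phi> x n = circle_meet s (L (n - 1)) (L n) (vert (n - 1) x)" using n3 by (simp add: \<phi>_def)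
  ultimately show ?thesis by simp
qed

lemma U_D:
  assumes "x \<in> U"
  shows "circle_disc (L (n - 1)) (L n) (\<phi> x (n - 1)) > 0" "j \<in> {2..<n - 1} \<Longrightarrow> \<bar>x (j - 2)\<bar> < 1"
  using assms n3 \<phi>_vert[of "n - 1" x] by (auto simp: U_def)

lemma \<phi>_in_V:
  assumes x: "x \<in> U"
  shows "\<phi> x \<in> V"
proof -
  note m = circle_meet_props[OF U_D(1)[OF x] s2, folded \<phi>_n]
  have dist_eqI: "inner (p - r) (p - r) = l\<^sup>2 \<Longrightarrow> l > 0 \<Longrightarrow> dist r p = l" for p r :: "real \<times> real" and l
    by (subst dist_commute) (simp add: dist_norm norm_eq_sqrt_inner)
  have "side_lengths n (\<phi> x) k = L k" if k: "k \<in> {1..n}" for k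
  proof -
    consider "k = 1" | "k \<in> {2..<n - 1}" | "k = n - 1" "k \<ge> 2" | "k = n" using k n3 by fastforce
    then show ?thesis
    proof cases
      case 1
      have "\<phi> x 2 = (0, L 1)" "\<phi> x 1 = (0, 0)" "nxt n 1 = 2" using n3 by (auto simp: \<phi>_def vert_def nxt_def)
      then show ?thesis using L_pos[OF k] 1 by (simp add: side_lengths_def dist_Pair_Pair)
    next
      case 2
      have "dist (\<phi> x k) (\<phi> x (k + 1)) = L k"
        by (rule dist_eqI[OF _ L_pos[OF k]], unfold \<phi>_edge[OF 2])
          (rule edge_vec_props(1)[where x = x, OF 2 U_D(2)[OF x 2]])
      moreover have "nxt n k = k + 1" using 2 by (auto simp: nxt_def)
      ultimately show ?thesis by (simp add: side_lengths_def)
    next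
      case 3
      have "dist (\<phi> x (n - 1)) (\<phi> x n) = L (n - 1)"
        by (rule dist_eqI[OF m(2)]) (use L_pos[OF k] 3 in simp)
      moreover have "nxt n k = n" using 3 n3 by (auto simp: nxt_def)
      ultimately show ?thesis by (simp add: side_lengths_def 3)
    next
      case 4
      have "dist 0 (\<phi> x n) = L n" using m(1) L_pos[OF k] 4 by (intro dist_eqI) simp_all
      moreover have "nxt n k = 1" "\<phi> x 1 = 0" using 4 by (auto simp: nxt_def \<phi>_def zero_prod_def)
      ultimately show ?thesis by (simp add: side_lengths_def 4 dist_commute)
    qed
  qed
  moreover have "\<phi> x \<in> extensional {1..n}" using n3 by (auto simp: extensional_def \<phi>_def)
  moreover have "\<phi> x 1 = (0, 0)" "\<phi> x 2 = (0, L 1)" using n3 by (simp_all add: \<phi>_def vert_def)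
  ultimately have "\<phi> x \<in> moduli_space n L" by (simp add: moduli_space_def)
  moreover have "inner (\<phi> x (j + 1) - \<phi> x j) (w j) > 0" if "j \<in> {2..<n - 1}" for j
    unfolding \<phi>_edge[OF that] by (rule edge_vec_props(2)[where x = x, OF that U_D(2)[OF x that]])
  ultimately show ?thesis
    using m(3) unfolding V_def by blast
qed

lemma \<psi>_\<phi>:
  assumes x: "x \<in> U"
  shows "\<psi> (\<phi> x) = x"
proof
  fix i
  show "\<psi> (\<phi> x) i = x i"
  proof (cases "i < n - 3")
    case True
    then have j: "i + 2 \<in> {2..<n - 1}" by auto
    have "\<phi> x (i + 3) - \<phi> x (i + 2) = edge_vec (i + 2) x"
      using \<phi>_edge[OF j] by (simp add: eval_nat_numeral)
    then have "\<psi> (\<phi> x) i = x i * (L (i + 2))\<^sup>2 / (L (i + 2))\<^sup>2"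
      using True edge_vec_props(3)[OF j, of x] U_D(2)[OF x j] by (simp add: \<psi>_def)
    moreover have "L (i + 2) > 0" using L_pos[of "i + 2"] True by auto
    ultimately show ?thesis by simp
  next
    case False
    then show ?thesis using x by (simp add: \<psi>_def U_def topspace_Euclidean_space)
  qed
qed

text \<open>An edge of known length is determined by its component orthogonal to \<open>w j\<close>
  up to the sign of the other component, and that sign is positive on \<open>V\<close>.\<close>

lemma V_edge:
  assumes Q: "Q \<in> V" and j: "j \<in> {2..<n - 1}"
  shows "\<bar>\<psi> Q (j - 2)\<bar> < 1" "edge_vec j (\<psi> Q) = Q (j + 1) - Q j"
proof -
  let ?e = "Q (j + 1) - Q j"
  have QM: "Q \<in> moduli_space n L" and pos: "inner ?e (w j) > 0" using Q j by (auto simp: V_def)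
  have L: "L j > 0" using j L_pos[of j] by auto
  have j3: "j - 2 < n - 3" "j - 2 + 3 = j + 1" "j - 2 + 2 = j" using j by auto
  have p: "\<psi> Q (j - 2) = inner ?e (rot90 (w j)) / (L j)\<^sup>2"
    unfolding \<psi>_def j3 using j3 by simp
  have ee: "inner ?e ?e = (L j)\<^sup>2" using side(1)[OF QM, of j] j by auto
  have "(inner ?e (w j))\<^sup>2 + (inner ?e (rot90 (w j)))\<^sup>2 = inner ?e ?e * inner (w j) (w j)"
    unfolding plane_defs by (simp add: power2_eq_square algebra_simps)
  then have "(inner ?e (w j))\<^sup>2 + (inner ?e (rot90 (w j)))\<^sup>2 = (L j)\<^sup>2 * (L j)\<^sup>2"
    by (simp only: ee w_norm[OF j])
  then have "((inner ?e (w j))\<^sup>2 + (inner ?e (rot90 (w j)))\<^sup>2) / ((L j)\<^sup>2 * (L j)\<^sup>2) = 1" using L by simp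
  then have sq: "(inner ?e (w j) / (L j)\<^sup>2)\<^sup>2 + (\<psi> Q (j - 2))\<^sup>2 = 1"
    by (simp add: p power_divide add_divide_distrib power2_eq_square)
  have c: "inner ?e (w j) / (L j)\<^sup>2 > 0" using pos L by simp
  then have "(\<psi> Q (j - 2))\<^sup>2 < 1" using sq by (smt (verit) zero_less_power)
  then show "\<bar>\<psi> Q (j - 2)\<bar> < 1" by (simp add: abs_square_less_1)
  have "sqrt (1 - (\<psi> Q (j - 2))\<^sup>2) = inner ?e (w j) / (L j)\<^sup>2"
    using sq c by (intro real_sqrt_unique) (auto simp: algebra_simps)
  then show "edge_vec j (\<psi> Q) = ?e"
    using frame_expansion[OF w_norm[OF j], of ?e] L by (simp add: edge_vec_def p)
qed

lemma V_vert:
  assumes Q: "Q \<in> V" and k: "k \<in> {2..<n}"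
  shows "vert k (\<psi> Q) = Q k"
proof -
  have "k \<ge> 2 \<Longrightarrow> k < n \<Longrightarrow> vert k (\<psi> Q) = Q k"
  proof (induction k rule: nat_induct_at_least)
    case base
    then show ?case using Q side(4)[of Q] by (simp add: vert_def V_def)
  next
    case (Suc k)
    then have "edge_vec k (\<psi> Q) = Q (k + 1) - Q k" by (intro V_edge(2)[OF Q]) auto
    then show ?case using Suc vert_step[of k "\<psi> Q"] by (simp add: algebra_simps)
  qed
  then show ?thesis using k by auto
qed

lemma V_meet:
  assumes Q: "Q \<in> V"
  shows "circle_disc (L (n - 1)) (L n) (Q (n - 1)) > 0" "circle_meet s (L (n - 1)) (L n) (Q (n - 1)) = Q n"
proof -
  have QM: "Q \<in> moduli_space n L" and pos: "s * cross2 (Q (n - 1)) (Q n) > 0" using Q by (auto simp: V_def)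
  have a: "inner (Q n - Q (n - 1)) (Q n - Q (n - 1)) = (L (n - 1))\<^sup>2" using side(1)[OF QM, of "n - 1"] n3 by auto
  note u = circle_meet_unique[OF side(2)[OF QM] a s2 pos]
  show "circle_disc (L (n - 1)) (L n) (Q (n - 1)) > 0" "circle_meet s (L (n - 1)) (L n) (Q (n - 1)) = Q n"
    by (rule u)+
qed

lemma \<psi>_in_U:
  assumes Q: "Q \<in> V"
  shows "\<psi> Q \<in> U"
proof -
  have "\<bar>\<psi> Q j\<bar> < 1" if "j < n - 3" for j
    using V_edge(1)[OF Q, of "j + 2"] that by auto
  moreover have "vert (n - 1) (\<psi> Q) = Q (n - 1)" using V_vert[OF Q, of "n - 1"] n3 by auto
  ultimately show ?thesis
    using V_meet(1)[OF Q] by (auto simp: U_def topspace_Euclidean_space \<psi>_def)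
qed

lemma \<phi>_\<psi>:
  assumes Q: "Q \<in> V"
  shows "\<phi> (\<psi> Q) = Q"
proof
  fix k
  have QM: "Q \<in> moduli_space n L" using Q by (auto simp: V_def)
  have v: "vert (n - 1) (\<psi> Q) = Q (n - 1)" using V_vert[OF Q, of "n - 1"] n3 by auto
  consider "k = 1" | "k \<in> {2..<n}" | "k = n" | "k \<notin> {1..n}" by fastforce
  then show "\<phi> (\<psi> Q) k = Q k"
  proof cases
    case 4
    then have "Q k = undefined" using QM by (auto simp: moduli_space_def extensional_def)
    then show ?thesis using 4 n3 by (auto simp: \<phi>_def)
  qed (use n3 side(3)[OF QM] V_vert[OF Q] V_meet(2)[OF Q] v in \<open>auto simp: \<phi>_def\<close>)
qed

lemma P_in_V: "P \<in> V"
proof -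
  have "inner (w j) (w j) > 0" if "j \<in> {2..<n - 1}" for j
  proof -
    have "L j > 0" using L_pos[of j] that by auto
    then show ?thesis using w_norm[OF that] by simp
  qed
  moreover have "s * cross2 (P (n - 1)) (P n) > 0" using ear by (auto simp: s_def sgn_if)
  ultimately show ?thesis using PM by (auto simp: V_def w_def)
qed

section \<open>Openness, smoothness and immersion property of the chart\<close>

lemma continuous_vert: "continuous_on UNIV (vert k)"
  unfolding vert_def edge_vec_def
  by (intro continuous_intros continuous_on_product_coordinates)

lemma U_open: "openin (Euclidean_space (n - 3)) U"
proof -
  let ?D = "\<lambda>x. circle_disc (L (n - 1)) (L n) (vert (n - 1) x)"
  have "open {x. ?D x > 0}"
    unfolding circle_disc_def
    by (intro open_Collect_less continuous_intros continuous_vert)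
  moreover have "open {x :: nat \<Rightarrow> real. \<forall>j<n - 3. \<bar>x j\<bar> < 1}"
  proof -
    have "open {x :: nat \<Rightarrow> real. \<bar>x j\<bar> < 1}" for j
      by (intro open_Collect_less continuous_intros continuous_on_product_coordinates)
    then have "open (\<Inter>j\<in>{..<n - 3}. {x :: nat \<Rightarrow> real. \<bar>x j\<bar> < 1})" by (intro open_INT) auto
    moreover have "(\<Inter>j\<in>{..<n - 3}. {x :: nat \<Rightarrow> real. \<bar>x j\<bar> < 1}) = {x. \<forall>j<n - 3. \<bar>x j\<bar> < 1}" by auto
    ultimately show ?thesis by simp
  qed
  ultimately have "open ({x. \<forall>j<n - 3. \<bar>x j\<bar> < 1} \<inter> {x. ?D x > 0})" by (intro open_Int)
  then have "openin (powertop_real UNIV) ({x. \<forall>j<n - 3. \<bar>x j\<bar> < 1} \<inter> {x. ?D x > 0})"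
    by (subst euclidean_product_topology) (simp only: open_openin[symmetric])
  then show ?thesis
    unfolding Euclidean_space_def openin_subtopology
    by (intro exI conjI) (auto simp: U_def topspace_Euclidean_space)
qed

lemma V_open: "openin (top_of_set (moduli_space n L)) V"
proof -
  have c: "continuous_on UNIV (\<lambda>Q :: nat \<Rightarrow> real \<times> real. Q k)" for k
    by (rule continuous_on_product_coordinates)
  have c2: "continuous_on UNIV (\<lambda>Q :: nat \<Rightarrow> real \<times> real. cross2 (Q (n - 1)) (Q n))"
    by (rule bounded_bilinear.continuous_on[OF bounded_bilinear_cross2 c c])
  have "open {Q :: nat \<Rightarrow> real \<times> real. s * cross2 (Q (n - 1)) (Q n) > 0}"
    by (intro open_Collect_less continuous_intros c2)
  moreover have "open (\<Inter>j\<in>{2..<n - 1}. {Q :: nat \<Rightarrow> real \<times> real. inner (Q (j + 1) - Q j) (w j) > 0})"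
    by (intro open_INT finite_atLeastLessThan ballI open_Collect_less continuous_intros c)
  ultimately have "openin (top_of_set (moduli_space n L)) (moduli_space n L \<inter>
      ((\<Inter>j\<in>{2..<n - 1}. {Q :: nat \<Rightarrow> real \<times> real. inner (Q (j + 1) - Q j) (w j) > 0})
      \<inter> {Q. s * cross2 (Q (n - 1)) (Q n) > 0}))" by (intro openin_open_Int open_Int)
  also have "moduli_space n L \<inter>
      ((\<Inter>j\<in>{2..<n - 1}. {Q :: nat \<Rightarrow> real \<times> real. inner (Q (j + 1) - Q j) (w j) > 0})
      \<inter> {Q. s * cross2 (Q (n - 1)) (Q n) > 0}) = V"
    by (auto simp: V_def)
  finally show ?thesis .
qed

lemma smooth_\<phi>:
  assumes k: "k \<in> {1..n}"
  shows "smooth_fun_on (n - 3) U (\<lambda>x. \<phi> x k)"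
proof -
  have edge: "smooth_fun_on (n - 3) U (edge_vec j)" if "j \<in> {2..<n - 1}" for j
  proof -
    have "smooth_fun_on (n - 3) U (\<lambda>x. sqrt (1 - (x (j - 2))\<^sup>2))"
    proof (rule smooth_sqrt[OF U_open])
      show "smooth_fun_on (n - 3) U (\<lambda>x. 1 - (x (j - 2))\<^sup>2)"
        unfolding power2_eq_square
        by (intro smooth_diff[OF U_open] smooth_mult[OF U_open] smooth_const[OF U_open] smooth_coord[OF U_open])
      show "1 - (x (j - 2))\<^sup>2 > 0" if "x \<in> U" for x
        using U_D(2)[OF that \<open>j \<in> {2..<n - 1}\<close>] by (simp add: abs_square_less_1)
    qed
    then show ?thesis
      unfolding edge_vec_def
      by (intro smooth_add[OF U_open] smooth_bilinear[OF U_open bounded_bilinear_scaleR]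
          smooth_coord[OF U_open] smooth_const[OF U_open])
  qed
  have vert: "smooth_fun_on (n - 3) U (vert k)" if "k < n" for k
    unfolding vert_def
    by (intro smooth_add[OF U_open] smooth_sum[OF U_open] smooth_const[OF U_open] edge) (use that in auto)
  let ?v = "vert (n - 1)"
  have v: "smooth_fun_on (n - 3) U ?v" using vert n3 by auto
  have m: "smooth_fun_on (n - 3) U (\<lambda>x. inner (?v x) (?v x))"
    by (rule smooth_bilinear[OF U_open bounded_bilinear_inner v v])
  have pos: "circle_disc (L (n - 1)) (L n) (?v x) > 0" if "x \<in> U" for x using that by (simp add: U_def)
  have pos2: "2 * inner (?v x) (?v x) > 0" if "x \<in> U" for x using circle_disc_pos_imp[OF pos[OF that]] by simp
  have "smooth_fun_on (n - 3) U (\<lambda>x. circle_meet s (L (n - 1)) (L n) (?v x))"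
    unfolding circle_meet_def
  proof (intro smooth_add[OF U_open] smooth_bilinear[OF U_open bounded_bilinear_scaleR] smooth_divide[OF U_open]
      smooth_diff[OF U_open] smooth_mult[OF U_open] smooth_const[OF U_open] smooth_sqrt[OF U_open]
      smooth_linear[OF U_open bounded_linear_rot90] m v pos pos2)
    show "smooth_fun_on (n - 3) U (\<lambda>x. circle_disc (L (n - 1)) (L n) (?v x))"
      unfolding circle_disc_def power2_eq_square
      by (intro smooth_diff[OF U_open] smooth_add[OF U_open] smooth_mult[OF U_open] smooth_const[OF U_open] m)
  qed
  moreover have "\<phi> x n = circle_meet s (L (n - 1)) (L n) (?v x)" "\<phi> x 1 = (0, 0)" for x
    using n3 by (simp_all add: \<phi>_def)
  ultimately have ends: "smooth_fun_on (n - 3) U (\<lambda>x. \<phi> x n)" "smooth_fun_on (n - 3) U (\<lambda>x. \<phi> x 1)"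
    by (simp_all only: smooth_const[OF U_open])
  consider "k = 1" | "k \<in> {2..<n}" | "k = n" using k by fastforce
  then show ?thesis
  proof cases
    case 2
    then show ?thesis using vert[of k] by (simp only: \<phi>_vert[OF 2]) auto
  qed (simp_all only: ends)
qed

lemma homeomorphism_\<phi>: "homeomorphism U V \<phi> \<psi>"
proof (rule homeomorphismI)
  show "continuous_on U \<phi>"
  proof (rule continuous_on_coordinatewise_then_product)
    fix k
    show "continuous_on U (\<lambda>x. \<phi> x k)"
    proof (cases "k \<in> {1..n}")
      case True
      then have "C_k_on (n - 3) 0 U (\<lambda>x. \<phi> x k)" using smooth_\<phi> by (simp only: smooth_fun_on_def)
      then show ?thesis by simp
    next
      case False
      then have "\<phi> x k = undefined" for x using n3 by (auto simp: \<phi>_def)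
      then show ?thesis by (simp only: continuous_on_const)
    qed
  qed
  show "continuous_on V \<psi>"
  proof (rule continuous_on_coordinatewise_then_product)
    fix i
    have c: "continuous_on V (\<lambda>Q. Q k)" for k
      by (rule continuous_on_subset[OF continuous_on_product_coordinates subset_UNIV])
    show "continuous_on V (\<lambda>Q. \<psi> Q i)"
    proof (cases "i < n - 3")
      case True
      have "L (i + 2) > 0" by (rule L_pos) (use True in auto)
      then have "L (i + 2) \<noteq> 0" by simp
      then show ?thesis using True unfolding \<psi>_def by (simp, intro continuous_intros c) auto
    qed (simp add: \<psi>_def)
  qed
qed (use \<phi>_in_V \<psi>_in_U \<psi>_\<phi> \<phi>_\<psi> in auto)

text \<open>Pairing the edge \<open>i + 2\<close> with \<open>rot90 (w (i + 2))\<close> recovers the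
  coordinate \<open>i\<close> times \<open>(L (i + 2))\<^sup>2\<close>, so differentiating this
  function isolates \<open>c i\<close>.\<close>

lemma independent:
  assumes x: "x \<in> U" and c: "\<forall>k\<in>{1..n}. (\<Sum>j<n - 3. c j *\<^sub>R partial_deriv j (\<lambda>y. \<phi> y k) x) = 0" and i: "i < n - 3"
  shows "c i = 0"
proof -
  let ?r = "rot90 (w (i + 2))"
  have L: "L (i + 2) > 0" using L_pos[of "i + 2"] i by auto
  have k: "i + 3 \<in> {1..n}" "i + 2 \<in> {1..n}" using i by auto
  have d: "inner (partial_deriv j (\<lambda>y. \<phi> y (i + 3)) x - partial_deriv j (\<lambda>y. \<phi> y (i + 2)) x) ?r
      = (L (i + 2))\<^sup>2 * (if i = j then 1 else 0)" if j: "j < n - 3" for j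
  proof -
    have C: "C_k_on (n - 3) (Suc 0) U (\<lambda>x. \<phi> x k)" if "k \<in> {1..n}" for k
      using smooth_\<phi>[OF that] by (simp only: smooth_fun_on_def)
    have "((\<lambda>s. inner (\<phi> (x(j := s)) (i + 3) - \<phi> (x(j := s)) (i + 2)) ?r) has_vector_derivative
      inner (partial_deriv j (\<lambda>y. \<phi> y (i + 3)) x - partial_deriv j (\<lambda>y. \<phi> y (i + 2)) x) ?r) (at (x j))"
      by (intro bounded_linear.has_vector_derivative[OF bounded_linear_inner_left] has_vector_derivative_diff
          partial_deriv_works[OF C x j] k)
    then have "partial_deriv j (\<lambda>y. (L (i + 2))\<^sup>2 * y i) x = inner (partial_deriv j (\<lambda>y. \<phi> y (i + 3)) x - partial_deriv j (\<lambda>y. \<phi> y (i + 2)) x) ?r"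
    proof (rule partial_deriv_eqI[OF U_open x j, rotated])
      fix y assume "y \<in> U"
      then have "\<psi> (\<phi> y) i = y i" using \<psi>_\<phi> by simp
      then show "(L (i + 2))\<^sup>2 * y i = inner (\<phi> y (i + 3) - \<phi> y (i + 2)) ?r"
        using i L by (simp add: \<psi>_def field_simps)
    qed
    moreover have "partial_deriv j (\<lambda>y. (L (i + 2))\<^sup>2 * y i) x = (L (i + 2))\<^sup>2 * (if i = j then 1 else 0)"
    proof (rule partial_deriv_eqI[OF U_open x j refl])
      have "((\<lambda>s. (x(j := s)) i) has_vector_derivative (if i = j then 1 else 0)) (at (x j))"
        by (cases "i = j") (auto intro: has_vector_derivative_id)
      then show "((\<lambda>s. (L (i + 2))\<^sup>2 * (x(j := s)) i) has_vector_derivative (L (i + 2))\<^sup>2 * (if i = j then 1 else 0)) (at (x j))"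
        by (rule has_vector_derivative_mult_right)
    qed
    ultimately show ?thesis by simp
  qed
  have "0 = inner ((\<Sum>j<n - 3. c j *\<^sub>R partial_deriv j (\<lambda>y. \<phi> y (i + 3)) x) - (\<Sum>j<n - 3. c j *\<^sub>R partial_deriv j (\<lambda>y. \<phi> y (i + 2)) x)) ?r"
    using c k by simp
  also have "\<dots> = (\<Sum>j<n - 3. c j * inner (partial_deriv j (\<lambda>y. \<phi> y (i + 3)) x - partial_deriv j (\<lambda>y. \<phi> y (i + 2)) x) ?r)"
    by (simp add: inner_sum_left sum_subtractf[symmetric] scaleR_diff_right[symmetric] del: scaleR_diff_right flip: sum_subtractf)
  also have "\<dots> = (\<Sum>j<n - 3. if i = j then c j * (L (i + 2))\<^sup>2 else 0)"
  proof (intro sum.cong refl)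
    fix j assume "j \<in> {..<n - 3}"
    then have j: "j < n - 3" by simp
    show "c j * inner (partial_deriv j (\<lambda>y. \<phi> y (i + 3)) x - partial_deriv j (\<lambda>y. \<phi> y (i + 2)) x) ?r
      = (if i = j then c j * (L (i + 2))\<^sup>2 else 0)"
      unfolding d[OF j] by simp
  qed
  also have "\<dots> = c i * (L (i + 2))\<^sup>2" using i by simp
  finally show ?thesis using L by simp
qed

theorem exists_local_param: "\<exists>U \<phi> u. local_param n L U \<phi> \<and> u \<in> U \<and> \<phi> u = P"
proof (intro exI conjI)
  show "local_param n L U \<phi>"
    unfolding local_param_def
    using U_open smooth_\<phi> independent V_open homeomorphism_\<phi> by blast
  show "\<psi> P \<in> U" "\<phi> (\<psi> P) = P" using \<psi>_in_U[OF P_in_V] \<phi>_\<psi>[OF P_in_V] .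
qed

end

section \<open>Generic cyclic configurations\<close>

context inscribed_polygon_chart
begin

abbreviation "S \<equiv> hessian (n - 3) (\<lambda>x. signed_area n (\<phi> x)) u"

lemma S_carrier: "S \<in> carrier_mat (n - 3) (n - 3)"
  by (simp add: hessian_def)

lemma S_entry: "i < n - 3 \<Longrightarrow> j < n - 3 \<Longrightarrow> S $$ (i, j) = second_variation (tangent i u) (tangent j u)"
  by (simp add: hessian_def area_hessian_eq)

lemma hessian_degenerate: "\<delta> n = 0 \<Longrightarrow> Determinant.det S = 0"
  by (rule S_degenerate[OF admissible_tangent tangent_1_2(2)[OF u] tangent_independent[OF u] S_carrier S_entry])

lemma hessian_signature:
  assumes "\<And>i. i \<in> {3..n} \<Longrightarrow> \<delta> i \<noteq> 0"
  shows "num_neg_eigenvalues S = sign_changes H 3 n" "sgn (Determinant.det S) = H n"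
proof -
  show "num_neg_eigenvalues S = sign_changes H 3 n"
    by (rule S_signature(1)[OF admissible_tangent tangent_1_2(2)[OF u] tangent_independent[OF u] S_carrier S_entry assms])
  show "sgn (Determinant.det S) = H n"
    by (rule S_signature(2)[OF admissible_tangent tangent_1_2(2)[OF u] tangent_independent[OF u] S_carrier S_entry assms])
qed

end

locale cyclic_ear = inscribed_polygon n \<rho> q + polygon_with_ear n L P
  for n \<rho> q L P +
  fixes C :: "real \<times> real"
  assumes centered: "\<And>k. k \<in> {1..n} \<Longrightarrow> P k = C + q k"
begin

lemma chart_at_P:
  assumes "local_param n L W \<theta>" "u \<in> W" "\<theta> u = P"
  shows "inscribed_polygon_chart n \<rho> q L W \<theta> u C"
  by unfold_locales (use assms n_ge_3 centered in auto)

text \<open>A cyclic configuration is critical, so the Morse property forbids a vanishing Hessian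
  determinant in the constructed chart.\<close>

lemma \<delta>_nonzero:
  assumes "area_is_morse n L"
  shows "\<delta> n \<noteq> 0"
proof
  assume 0: "\<delta> n = 0"
  obtain W \<theta> u where c: "local_param n L W \<theta>" "u \<in> W" "\<theta> u = P" using exists_local_param by blast
  interpret ch: inscribed_polygon_chart n \<rho> q L W \<theta> u C by (rule chart_at_P[OF c])
  have "Determinant.det (hessian (n - 3) (\<lambda>x. signed_area n (\<theta> x)) u) \<noteq> 0"
    using assms c ch.area_critical unfolding area_is_morse_def by blast
  then show False using ch.hessian_degenerate[OF 0] by contradiction
qed

text \<open>The two definite descriptions are resolved here: the constructed chart provides a value,
  and the computation applies to every chart at \<open>P\<close>.\<close>

lemma signature:
  assumes \<delta>: "\<And>i. i \<in> {3..n} \<Longrightarrow> \<delta> i \<noteq> 0"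
  shows "morse_index n L P = sign_changes H 3 n" "hessian_sign n L P = H n"
proof -
  obtain W \<theta> u where c: "local_param n L W \<theta>" "u \<in> W" "\<theta> u = P" using exists_local_param by blast
  have sig: "num_neg_eigenvalues (hessian (n - 3) (\<lambda>x. signed_area n (\<theta> x)) u) = sign_changes H 3 n"
    "sgn (Determinant.det (hessian (n - 3) (\<lambda>x. signed_area n (\<theta> x)) u)) = H n"
    if "local_param n L W \<theta>" "u \<in> W" "\<theta> u = P" for W \<theta> u
    by (rule inscribed_polygon_chart.hessian_signature[OF chart_at_P[OF that]], erule \<delta>)+
  show "morse_index n L P = sign_changes H 3 n"
    unfolding morse_index_def
  proof (rule the_equality)
    show "\<exists>U \<phi> u. local_param n L U \<phi> \<and> u \<in> U \<and> \<phi> u = P \<and>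
      sign_changes H 3 n = num_neg_eigenvalues (hessian (n - 3) (\<lambda>x. signed_area n (\<phi> x)) u)"
      using c sig(1)[OF c] by metis
  qed (use sig(1) in auto)
  show "hessian_sign n L P = H n"
    unfolding hessian_sign_def
  proof (rule the_equality)
    show "\<exists>U \<phi> u. local_param n L U \<phi> \<and> u \<in> U \<and> \<phi> u = P \<and>
      H n = sgn (Determinant.det (hessian (n - 3) (\<lambda>x. signed_area n (\<phi> x)) u))"
      using c sig(2)[OF c] by metis
  qed (use sig(2) in auto)
qed

end

text \<open>On the line through \<open>p\<close> and \<open>r\<close>, the circle equation is
  quadratic in the parameter \<open>l\<close> and has the roots 0 and 1 only.\<close>

lemma not_collinear_on_circle:
  fixes p r s :: "real \<times> real"
  assumes p: "inner p p = \<rho>" and r: "inner r r = \<rho>" and s: "inner s s = \<rho>"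
    and ne: "p \<noteq> r" "p \<noteq> s" "r \<noteq> s"
  shows "cross2 (r - p) (s - p) \<noteq> 0"
proof
  assume c: "cross2 (r - p) (s - p) = 0"
  let ?d = "r - p" and ?e = "s - p"
  have d0: "inner ?d ?d \<noteq> 0" using ne by simp
  define l where "l = inner ?e ?d / inner ?d ?d"
  have e: "?e = l *\<^sub>R ?d"
    using frame_expansion[OF refl d0, of ?e] c by (simp add: l_def inner_rot90 cross2_swap[of ?e ?d])
  have dd: "2 * inner p ?d + inner ?d ?d = 0" using p r by (simp add: inner_linear inner_commute)
  have "2 * inner p ?e + inner ?e ?e = 0" using p s by (simp add: inner_linear inner_commute)
  then have "l * (2 * inner p ?d + l * inner ?d ?d) = 0" unfolding e inner_linear(5,6) by (simp add: algebra_simps)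
  moreover have "2 * inner p ?d + l * inner ?d ?d = (l - 1) * inner ?d ?d" using dd by (simp add: algebra_simps)
  ultimately have "l = 0 \<or> l = 1" using d0 by simp
  then show False using e ne by auto
qed

text \<open>Parallel vectors of equal length are equal or opposite; in the second case the segment
  has the center as its midpoint.\<close>

lemma cross2_nz_if_not_central:
  fixes p r :: "real \<times> real"
  assumes p: "inner p p = \<rho>" and r: "inner r r = \<rho>" and ne: "p \<noteq> r" and nc: "0 \<notin> closed_segment p r"
  shows "cross2 p r \<noteq> 0"
proof
  assume c: "cross2 p r = 0"
  have "(inner p r)\<^sup>2 + (cross2 p r)\<^sup>2 = inner p p * inner r r"
    by (simp add: plane_defs power2_eq_square algebra_simps)
  then have "inner p r = \<rho> \<or> inner p r = - \<rho>" using p r c by (simp add: power2_eq_square square_eq_iff)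
  then show False
  proof
    assume "inner p r = \<rho>"
    then have "inner (p - r) (p - r) = 0" using p r by (simp add: inner_linear inner_commute)
    then show False using ne by simp
  next
    assume "inner p r = - \<rho>"
    then have "inner (p + r) (p + r) = 0" using p r by (simp add: inner_linear inner_commute)
    then have "r = - p" by (simp add: add_eq_0_iff)
    then have "0 = (1 - 1/2) *\<^sub>R p + (1/2) *\<^sub>R r" by (simp flip: scaleR_add_right)
    then have "0 \<in> closed_segment p r" unfolding closed_segment_def by (intro CollectI exI[of _ "1/2"]) auto
    then show False using nc by simp
  qed
qed

text \<open>The tangent of half an angle is the sine divided by one plus the cosine. The absolute
  value appears because the angle here is unoriented.\<close>

lemma tan_half_angle_between:
  assumes p: "inner p p = \<rho>" and r: "inner r r = \<rho>" and c: "cross2 p r \<noteq> 0"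
  shows "tan (angle_between p r / 2) = \<bar>half_tan \<rho> p r\<bar>"
proof -
  note pos = denominator_pos[OF p r c]
  have \<rho>: "\<rho> > 0" using p c by (metis cross2_eq_inner inner_ge_zero inner_gt_zero_iff inner_rot90(2) inner_zero_left le_less rot90_def zero_prod_def fst_zero snd_zero minus_zero)
  define x where "x = inner p r / \<rho>"
  have "norm p * norm r = \<rho>" using p r \<rho> by (simp add: norm_eq_sqrt_inner)
  then have a: "angle_between p r = arccos x" by (simp add: angle_between_def x_def)
  have "(inner p r)\<^sup>2 + (cross2 p r)\<^sup>2 = inner p p * inner r r"
    by (simp add: plane_defs power2_eq_square algebra_simps)
  then have "((inner p r)\<^sup>2 + (cross2 p r)\<^sup>2) / \<rho>\<^sup>2 = 1" using p r \<rho> by (simp add: power2_eq_square)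
  then have sq: "1 - x\<^sup>2 = (cross2 p r / \<rho>)\<^sup>2" by (simp add: x_def power_divide add_divide_distrib)
  then have "x\<^sup>2 \<le> 1" by (smt (verit) zero_le_power2)
  then have "\<bar>x\<bar> \<le> 1" by (simp add: abs_square_le_1)
  then have x1: "- 1 \<le> x" "x \<le> 1" by auto
  have "tan (angle_between p r / 2) = sqrt (1 - x\<^sup>2) / (x + 1)"
    unfolding a tan_half using x1 by (simp add: sin_arccos)
  also have "\<dots> = \<bar>cross2 p r\<bar> / \<rho> / (x + 1)" unfolding sq using \<rho> by simp
  also have "\<dots> = \<bar>half_tan \<rho> p r\<bar>"
    using pos \<rho> by (simp add: half_tan_def x_def field_simps)
  finally show ?thesis .
qed

lemma left_of_iff: "left_of C p r \<longleftrightarrow> cross2 (p - C) (r - C) > 0"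
proof -
  have "(fst r - fst p) * (snd C - snd p) - (snd r - snd p) * (fst C - fst p) = cross2 (p - C) (r - C)"
    by (simp add: cross2_def algebra_simps)
  then show ?thesis by (simp add: left_of_def)
qed

locale generic_cyclic_polygon =
  fixes n :: nat and L :: "nat \<Rightarrow> real" and P :: "nat \<Rightarrow> real \<times> real" and C :: "real \<times> real" and R :: real
  assumes link: "linkage n L" and PM: "P \<in> moduli_space n L" and gen: "generic_cyclic n P"
    and circle: "R > 0" "\<And>k. k \<in> {1..n} \<Longrightarrow> dist C (P k) = R"
begin

definition \<rho> :: real where "\<rho> = R\<^sup>2"

definition q :: "nat \<Rightarrow> real \<times> real" where "q k = P k - C"

section \<open>Subconfigurations of a generic cyclic polygon\<close>

lemma n3: "n \<ge> 3"
  using link by (simp add: linkage_def)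

lemma P_facts: "P 1 = 0" "P 2 = (0, L 1)" "\<And>k. k \<in> {1..n} \<Longrightarrow> dist (P k) (P (nxt n k)) = L k"
  "\<And>k. k \<in> {1..n} \<Longrightarrow> L k > 0"
  using PM link by (auto simp: moduli_space_def linkage_def side_lengths_def zero_prod_def)

lemma P_consecutive: "k \<in> {1..<n} \<Longrightarrow> P k \<noteq> P (k + 1)"
  using P_facts(3,4)[of k] by (auto simp: nxt_def)

lemma generic:
  assumes "i \<in> {3..n}"
  shows "P i \<noteq> P 1" "\<not> central_conf i (subconf i P)" "generic_linkage i (side_lengths i (subconf i P))"
  using gen assms by (auto simp: generic_cyclic_def)

lemma subconf_eq: "k \<in> {1..i} \<Longrightarrow> subconf i P k = P k"
  by (simp add: subconf_def)

lemma q_circle: "k \<in> {1..n} \<Longrightarrow> inner (q k) (q k) = \<rho>"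
  using circle(2)[of k]
  by (simp add: q_def \<rho>_def dist_norm norm_minus_commute flip: power2_norm_eq_inner)

lemma q_eq_iff: "q j = q k \<longleftrightarrow> P j = P k"
  by (simp add: q_def)

lemma not_collinear:
  assumes "j \<in> {1..n}" "k \<in> {1..n}" "l \<in> {1..n}" "P j \<noteq> P k" "P j \<noteq> P l" "P k \<noteq> P l"
  shows "cross2 (P k - P j) (P l - P j) \<noteq> 0"
  using not_collinear_on_circle[OF q_circle[OF assms(1)] q_circle[OF assms(2)] q_circle[OF assms(3)]] assms
  by (simp add: q_eq_iff) (simp add: q_def)

text \<open>The first three vertices are distinct points of a circle, hence not collinear, and
  already determine the center. So all subconfigurations share \<open>C\<close>.\<close>

lemma center_eq:
  assumes i: "i \<in> {3..n}"
  shows "center i (subconf i P) = C"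
  unfolding center_def
proof (rule the_equality)
  show "inscribed i (subconf i P) C"
    unfolding inscribed_def using circle i by (intro exI[of _ R]) (auto simp: subconf_eq)
  fix D assume "inscribed i (subconf i P) D"
  then obtain r where r: "\<And>k. k \<in> {1..i} \<Longrightarrow> dist D (P k) = r"
    unfolding inscribed_def by (metis subconf_eq)
  have r3: "dist D (P 1) = r" "dist D (P 2) = r" "dist D (P 3) = r" using i by (auto intro: r)
  have c3: "dist C (P 1) = R" "dist C (P 2) = R" "dist C (P 3) = R"
    using i by (auto intro: circle)
  have eq: "inner (X - P 1) (X - P 1) = inner (X - P k) (X - P k)" if "dist X (P 1) = dist X (P k)" for X k
    using that by (simp add: dist_norm flip: power2_norm_eq_inner)
  have "inner (D - C) (P k - P 1) = 0" if "k = 2 \<or> k = 3" for k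
  proof -
    have "inner (D - P 1) (D - P 1) = inner (D - P k) (D - P k)" "inner (C - P 1) (C - P 1) = inner (C - P k) (C - P k)"
      using eq[of D k] eq[of C k] that r3 c3 by auto
    then have "2 * inner D (P k - P 1) = 2 * inner C (P k - P 1)"
      by (simp add: inner_linear inner_commute)
    then show ?thesis by (simp add: inner_linear)
  qed
  then have o: "inner (D - C) (P 2 - P 1) = 0" "inner (D - C) (P 3 - P 1) = 0" by auto
  have n: "cross2 (P 2 - P 1) (P 3 - P 1) \<noteq> 0"
    using P_consecutive[of 1] P_consecutive[of 2] generic(1)[of 3] i
    by (intro not_collinear) (auto simp: numeral_2_eq_2 numeral_3_eq_3)
  have "cross2 a b *\<^sub>R v = inner v a *\<^sub>R (- rot90 b) + inner v b *\<^sub>R rot90 a" for a b v :: "real \<times> real"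
    by (simp add: plane_defs prod_eq_iff algebra_simps)
  from this[of "P 2 - P 1" "P 3 - P 1" "D - C"] show "D = C" using o n by simp
qed

lemma edge_nz:
  assumes i: "i \<in> {3..n}" and k: "k \<in> {1..i}"
  shows "cross2 (q k) (q (nxt i k)) \<noteq> 0"
proof (rule cross2_nz_if_not_central)
  have n: "nxt i k \<in> {1..i}" using k by (auto simp: nxt_def)
  show "inner (q k) (q k) = \<rho>" "inner (q (nxt i k)) (q (nxt i k)) = \<rho>"
    using i k n by (auto intro: q_circle)
  have "P k \<noteq> P (nxt i k)"
    using P_consecutive[of k] generic(1)[OF i] i k by (auto simp: nxt_def)
  then show "q k \<noteq> q (nxt i k)" by (simp add: q_eq_iff)
  have "C \<notin> closed_segment (subconf i P k) (subconf i P (nxt i k))"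
    using generic(2)[OF i] k unfolding central_conf_def center_eq[OF i] by blast
  then have "C \<notin> closed_segment (P k) (P (nxt i k))"
    by (simp only: subconf_eq[OF k] subconf_eq[OF n] not_False_eq_True)
  then have "C + 0 \<notin> closed_segment (C + q k) (C + q (nxt i k))" by (simp add: q_def)
  then show "0 \<notin> closed_segment (q k) (q (nxt i k))" unfolding closed_segment_translation_eq .
qed

text \<open>The diagonals from vertex 1 are closing edges of earlier subconfigurations, which are
  not central and whose end points are distinct.\<close>

lemma inscribed_polygon:
  assumes i: "i \<in> {3..n}"
  shows "inscribed_polygon i \<rho> q"
proof
  show "i \<ge> 3" using i by simp
  show "inner (q k) (q k) = \<rho>" if "k \<in> {1..i}" for k using q_circle that i by auto
  show "cross2 (q k) (q (k + 1)) \<noteq> 0" if "k \<in> {1..<i}" for k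
    using edge_nz[OF i, of k] that by (auto simp: nxt_def)
  show "cross2 (q 1) (q k) \<noteq> 0" if "k \<in> {2..i}" for k
  proof (cases "k = 2")
    case True
    then show ?thesis using edge_nz[OF i, of 1] i by (auto simp: nxt_def numeral_2_eq_2)
  next
    case False
    then have k: "k \<in> {3..n}" using that i by auto
    then have "cross2 (q k) (q 1) \<noteq> 0" using edge_nz[OF k, of k] by (auto simp: nxt_def)
    then show ?thesis using cross2_swap[of "q k" "q 1"] by simp
  qed
qed

text \<open>The ear of the chart exists because the vertices \<open>i - 1\<close>, \<open>i\<close>
  and 1 are three distinct points of the circle. The lengths \<open>l\<close> are prescribed only on
  \<open>{1..i}\<close>, so that both the side lengths of a subconfiguration and the given
  \<open>L\<close> qualify.\<close>

lemma cyclic_ear: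
  assumes i: "i \<in> {3..n}" and l: "\<And>k. k \<in> {1..i} \<Longrightarrow> l k = side_lengths i (subconf i P) k"
  shows "cyclic_ear i \<rho> q l (subconf i P) C"
proof -
  interpret inscribed_polygon i \<rho> q by (rule inscribed_polygon[OF i])
  have n1: "nxt i 1 = 2" using i by (simp add: nxt_def numeral_2_eq_2)
  show ?thesis
  proof
    have nx: "nxt i k \<in> {1..i}" if "k \<in> {1..i}" for k using that by (auto simp: nxt_def)
    show "l k > 0" if "k \<in> {1..i}" for k
    proof -
      have "q k \<noteq> q (nxt i k)" using edge_nz[OF i that] by (auto simp: cross2_def)
      then show ?thesis using that nx[OF that] by (simp add: l side_lengths_def subconf_eq q_eq_iff)
    qed
    have "dist (P 1) (P 2) = L 1" using P_facts(3)[of 1] n3 by (simp add: nxt_def numeral_2_eq_2)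
    then have "l 1 = L 1" using l[of 1] i n1 by (simp add: side_lengths_def subconf_eq)
    then show "subconf i P \<in> moduli_space i l"
      using i P_facts(1,2) l by (auto simp: moduli_space_def subconf_eq zero_prod_def subconf_def)
    have i3: "3 \<le> i" "i \<le> n" using i by auto
    then have i1: "i - 1 \<in> {1..<n}" "i - 1 + 1 = i" "i - 1 \<in> {1..i}"
      unfolding atLeastLessThan_iff atLeastAtMost_iff by linarith+
    have "P (i - 1) \<noteq> P i" using P_consecutive[OF i1(1)] unfolding i1(2) .
    moreover have "P 1 \<noteq> P i" using generic(1)[OF i] by auto
    moreover have "P 1 \<noteq> P (i - 1)"
    proof (cases "i = 3")
      case True
      then show ?thesis using P_consecutive[of 1] n3 by (auto simp: numeral_2_eq_2)
    next
      case False
      then have "i - 1 \<in> {3..n}" using i3 unfolding atLeastAtMost_iff by linarith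
      then show ?thesis using generic(1)[of "i - 1"] by auto
    qed
    ultimately have "cross2 (P (i - 1) - P 1) (P i - P 1) \<noteq> 0"
      using i i1(1) by (intro not_collinear) auto
    then show "cross2 (subconf i P (i - 1)) (subconf i P i) \<noteq> 0"
      using i by (simp only: subconf_eq[OF i1(3)] subconf_eq[of i i] P_facts(1) diff_zero) (simp add: subconf_eq)
    show "subconf i P k = C + q k" if "k \<in> {1..i}" for k using that by (simp add: subconf_eq q_def)
  qed (use i in auto)
qed

lemma \<delta>_nz: "i \<in> {3..n} \<Longrightarrow> inscribed_polygon.\<delta> \<rho> q i \<noteq> 0"
  using cyclic_ear.\<delta>_nonzero[OF cyclic_ear[OF _ refl]] generic(3) by (simp add: generic_linkage_def)

text \<open>Edge sign times the tangent of the unoriented half angle is the oriented tangent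
  \<open>T k\<close>, so \<open>delta\<close> becomes \<open>\<delta> i\<close>; each positive edge
  contributes a factor -1, which is \<open>- sgn (T k)\<close>.\<close>

lemma delta_formula:
  assumes i: "i \<in> {3..n}"
  shows "inscribed_polygon.H \<rho> q i = - delta_sign i (subconf i P) * (-1) ^ num_pos_edges i (subconf i P)"
proof -
  interpret inscribed_polygon i \<rho> q by (rule inscribed_polygon[OF i])
  let ?Q = "subconf i P"
  have nx: "nxt i k \<in> {1..i}" if "k \<in> {1..i}" for k using that by (auto simp: nxt_def)
  have sgnT: "sgn (T k) = sgn (cross2 (q k) (q (nxt i k)))" if "k \<in> {1..i}" for k
    unfolding T_def by (rule sgn_half_tan[OF edge_facts[OF that]])
  have es: "edge_sign i ?Q k = sgn (T k)" if "k \<in> {1..i}" for k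
  proof -
    have "edge_sign i ?Q k = sgn (cross2 (q k) (q (nxt i k)))"
      using edge_nz[OF i that]
      unfolding edge_sign_def center_eq[OF i] left_of_iff subconf_eq[OF that] subconf_eq[OF nx[OF that]] q_def[symmetric]
      by (simp add: sgn_if)
    then show ?thesis by (simp only: sgnT[OF that])
  qed
  have ta: "tan (half_angle i ?Q k) = \<bar>T k\<bar>" if "k \<in> {1..i}" for k
    unfolding half_angle_def center_eq[OF i] subconf_eq[OF that] subconf_eq[OF nx[OF that]] q_def[symmetric] T_def
    by (rule tan_half_angle_between[OF edge_facts[OF that]])
  have "delta i ?Q = (\<Sum>k=1..i. T k)"
    unfolding delta_def by (intro sum.cong refl) (simp add: es ta sgn_mult_abs del: One_nat_def)
  also have "\<dots> = (\<Sum>k=1..<i. half_tan \<rho> (q k) (q (k + 1))) + half_tan \<rho> (q i) (q 1)"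
    unfolding T_def using i by (intro sum_nxt_split) auto
  finally have d: "delta i ?Q = \<delta> i" by (simp add: \<delta>_def t_def)
  have "(-1) ^ num_pos_edges i ?Q = (\<Prod>k\<in>{k\<in>{1..i}. edge_sign i ?Q k = 1}. - 1 :: real)"
    by (simp add: num_pos_edges_def prod_constant)
  also have "\<dots> = (\<Prod>k=1..i. if edge_sign i ?Q k = 1 then - 1 else 1)"
    by (subst prod.inter_filter) auto
  also have "\<dots> = (\<Prod>k=1..i. - sgn (T k))"
  proof (intro prod.cong refl)
    fix k assume k: "k \<in> {1..i}"
    have "T k \<noteq> 0" using sgnT[OF k] edge_nz[OF i k] by (auto simp: sgn_zero_iff)
    then show "(if edge_sign i ?Q k = 1 then - 1 else 1) = - sgn (T k)" unfolding es[OF k] by (simp add: sgn_if)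
  qed
  also have "{1..i} = insert i {1..<i}" using i by auto
  also have "(\<Prod>k\<in>insert i {1..<i}. - sgn (T k)) = (\<Prod>k=1..<i. - sgn (t k)) * (- sgn (half_tan \<rho> (q i) (q 1)))"
    by (simp add: T_def[of i] nxt_def T_eq)
  finally show ?thesis unfolding H_def delta_sign_def d by simp
qed

lemma H_seq_eq:
  assumes i: "i \<in> {3..n}"
  shows "H_seq P i = inscribed_polygon.H \<rho> q i"
proof -
  interpret inscribed_polygon i \<rho> q by (rule inscribed_polygon[OF i])
  show ?thesis
  proof (cases "i = 3")
    case True
    then show ?thesis using H_3 by (simp add: H_seq_def)
  next
    case False
    then show ?thesis
      unfolding H_seq_def using cyclic_ear.signature(2)[OF cyclic_ear[OF i refl]] \<delta>_nz i by auto
  qed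
qed

lemma morse_index_eq: "morse_index n L P = sign_changes (H_seq P) 3 n"
proof -
  have n: "n \<in> {3..n}" using n3 by simp
  have "P \<in> extensional {1..n}" using PM by (simp add: moduli_space_def)
  then have s: "subconf n P = P" by (simp add: subconf_def extensional_restrict)
  have L: "L k = side_lengths n (subconf n P) k" if "k \<in> {1..n}" for k
    using PM that by (simp add: moduli_space_def s)
  have "morse_index n L P = sign_changes (inscribed_polygon.H \<rho> q) 3 n"
    using cyclic_ear.signature(1)[OF cyclic_ear[OF n L]] \<delta>_nz by (simp add: s)
  also have "\<dots> = sign_changes (H_seq P) 3 n"
    unfolding sign_changes_def by (intro arg_cong[where f = card] Collect_cong) (auto simp: H_seq_eq)
  finally show ?thesis .
qed

end

theorem theorem4p2:
  fixes n :: nat and L :: "nat \<Rightarrow> real" and P :: "nat \<Rightarrow> real \<times> real"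
  assumes "linkage n L"
    and "P \<in> moduli_space n L"
    and "generic_cyclic n P"
  shows "morse_index n L P = sign_changes (H_seq P) 3 n \<and>
    (\<forall>i\<in>{4..n}. H_seq P i = - delta_sign i (subconf i P) * (-1) ^ num_pos_edges i (subconf i P))"
proof -
  have "cyclic_conf n P" using assms(3) by (simp add: generic_cyclic_def)
  then obtain C R where "R > 0" "\<And>k. k \<in> {1..n} \<Longrightarrow> dist C (P k) = R"
    unfolding cyclic_conf_def inscribed_def by blast
  then interpret generic_cyclic_polygon n L P C R
    using assms by unfold_locales auto
  show ?thesis using morse_index_eq H_seq_eq delta_formula by simp
qed

end
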